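(* Let $(X,f)$ be a topological dynamical system with $h_{\mathrm{top}}(f)<+\infty$, and let $\varphi,\psi\in C(X,\mathbb{R})$ with $\psi>0$. The following properties hold: (i) $t_{\psi,\varphi}(X,f)$ is a compact convex set; (ii) $\mathcal{M}_{\psi,\varphi}(X,f)\subset t_{\psi,\varphi}(X,f)\subset\mathcal{M}(X,f)$; (iii) if the entropy map $\mu\mapsto h_\mu(f)$ is upper semi-continuous on $\mathcal{M}(X,f)$, then $\mathcal{M}_{\psi,\varphi}(X,f)$ is non-empty, and thus $t_{\psi,\varphi}(X,f)\ne\emptyset$; (iv) for a Borel probability measure $\mu$ on $X$, $\mu\in t_{\psi,\varphi}(X,f)$ if and only if $$P_\psi(\varphi)-\frac{\int\varphi\,d\mu}{\int\psi\,d\mu}=\inf\Big\{P_\psi(h)-\frac{\int h\,d\mu}{\int\psi\,d\mu}:h\in C(X,\mathbb{R})\Big\};$$ (v) $d^+P_\psi(\varphi)(g)\ge\sup\Big\{\frac{\int g\,d\mu}{\int\psi\,d\mu}:\mu\in t_{\psi,\varphi}(X,f)\Big\}$ for every $g\in C(X,\mathbb{R})$.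
   Context: A topological dynamical system (TDS) $(X,f)$ is a continuous map $f:X\to X$ on a compact metric space $(X,d)$; $h_{\mathrm{top}}(f)$ is its topological entropy. $C(X,\mathbb{R})$ is the space of continuous real functions on $X$; $S_n\varphi=\sum_{i=0}^{n-1}\varphi\circ f^i$; $\mathbb{N}$ denotes the positive integers; $\mathcal{M}(X,f)$ is the set of $f$-invariant Borel probability measures and $h_\mu(f)$ the measure-theoretic entropy. Topological notions for sets of measures refer to the weak-* topology. Let $d_n(x,y)=\max\{d(f^ix,f^iy):0\le i\le n-1\}$. For nonempty $Z\subset X$, a set $F_n\subset X$ is an $(n,\varepsilon)$-spanning set of $Z$ if for each $y\in Z$ there is $x\in F_n$ with $d_n(x,y)\le\varepsilon$. For $\psi>0$ and $T>0$ let $S_T=\{n\in\mathbb{N}:\exists x\in X,\ S_n\psi(x)\le T\text{ and }S_{n+1}\psi(x)>T\}$, and for $n\in S_T$ let $X_n=\{x\in X:S_n\psi(x)\le T\text{ and }S_{n+1}\psi(x)>T\}$. Put $$Q_{\psi,T}(f,\varphi,\varepsilon)=\inf\Big\{\sum_{n\in S_T}\sum_{x\in F_n}e^{S_n\varphi(x)}:F_n\text{ is an }(n,\varepsilon)\text{-spanning set of }X_n,\ n\in S_T\Big\}.$$ The $\psi$-induced topological pressure of $\varphi$ is $P_\psi(\varphi)=\lim_{\varepsilon\to0}\limsup_{T\to\infty}\frac1T\log Q_{\psi,T}(f,\varphi,\varepsilon)$. A measure $\mu\in\mathcal{M}(X,f)$ is an equilibrium state of $P_\psi(\varphi)$ if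 $P_\psi(\varphi)=\frac{h_\mu(f)+\int\varphi\,d\mu}{\int\psi\,d\mu}$; $\mathcal{M}_{\psi,\varphi}(X,f)$ is the set of all equilibrium states of $P_\psi(\varphi)$. A Borel probability measure $\mu$ on $X$ is a tangent functional of $P_\psi(\cdot)$ at $\varphi$ if $P_\psi(\varphi+g)-P_\psi(\varphi)\ge\frac{\int g\,d\mu}{\int\psi\,d\mu}$ for all $g\in C(X,\mathbb{R})$; $t_{\psi,\varphi}(X,f)$ is the set of all such $\mu$. Finally, $d^+P_\psi(\varphi)(g)=\lim_{t\to0+}\frac1t\left(P_\psi(\varphi+tg)-P_\psi(\varphi)\right)$ (this limit exists because $t\mapsto P_\psi(\varphi+tg)$ is convex). *)

theory Defs
  imports "HOL-Probability.Probability"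
begin

text \<open>
  The compact metric space is the whole of a type of class \<open>metric_space\<close> (compactness of
  \<open>UNIV\<close> is a hypothesis of the theorem), so it is nonempty.  Quantities that could be infinite
  (pressure, entropies) are \<open>ereal\<close>-valued.
\<close>

definition birkhoff_sum :: "('a \<Rightarrow> 'a) \<Rightarrow> ('a \<Rightarrow> real) \<Rightarrow> nat \<Rightarrow> 'a \<Rightarrow> real" where
  "birkhoff_sum f \<phi> n x = (\<Sum>i<n. \<phi> ((f ^^ i) x))"

text \<open>Only meaningful for \<open>n \<ge> 1\<close>.\<close>

definition bowen_dist :: "('a::metric_space \<Rightarrow> 'a) \<Rightarrow> nat \<Rightarrow> 'a \<Rightarrow> 'a \<Rightarrow> real" where
  "bowen_dist f n x y = Max ((\<lambda>i. dist ((f ^^ i) x) ((f ^^ i) y)) ` {..<n})"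

definition spanning :: "('a::metric_space \<Rightarrow> 'a) \<Rightarrow> nat \<Rightarrow> real \<Rightarrow> 'a set \<Rightarrow> 'a set \<Rightarrow> bool" where
  "spanning f n \<epsilon> Z F \<longleftrightarrow> (\<forall>y\<in>Z. \<exists>x\<in>F. bowen_dist f n x y \<le> \<epsilon>)"

subsection \<open>Topological entropy\<close>

definition span_number :: "('a::metric_space \<Rightarrow> 'a) \<Rightarrow> nat \<Rightarrow> real \<Rightarrow> nat" where
  "span_number f n \<epsilon> = Inf {card F | F. finite F \<and> spanning f n \<epsilon> UNIV F}"

definition top_entropy :: "('a::metric_space \<Rightarrow> 'a) \<Rightarrow> ereal" where
  "top_entropy f =
     Lim (at_right 0) (\<lambda>\<epsilon>. limsup (\<lambda>n. ereal (ln (real (span_number f n \<epsilon>)) / real n)))"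

subsection \<open>Induced topological pressure\<close>

definition level_set :: "('a \<Rightarrow> 'a) \<Rightarrow> ('a \<Rightarrow> real) \<Rightarrow> real \<Rightarrow> nat \<Rightarrow> 'a set" where
  "level_set f \<psi> T n = {x. birkhoff_sum f \<psi> n x \<le> T \<and> birkhoff_sum f \<psi> (Suc n) x > T}"

definition level_times :: "('a \<Rightarrow> 'a) \<Rightarrow> ('a \<Rightarrow> real) \<Rightarrow> real \<Rightarrow> nat set" where
  "level_times f \<psi> T = {n. n \<ge> 1 \<and> level_set f \<psi> T n \<noteq> {}}"

text \<open>Spanning sets may be infinite, in which case the sums below take the value \<open>\<infinity>\<close>
  whenever they diverge; every family of \<open>ennreal\<close> is summable.\<close>

definition induced_Q ::
  "('a::metric_space \<Rightarrow> 'a) \<Rightarrow> ('a \<Rightarrow> real) \<Rightarrow> ('a \<Rightarrow> real) \<Rightarrow> real \<Rightarrow> real \<Rightarrow> ennreal" where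
  "induced_Q f \<psi> \<phi> T \<epsilon> =
     (INF F\<in>{F. \<forall>n\<in>level_times f \<psi> T. spanning f n \<epsilon> (level_set f \<psi> T n) (F n)}.
        \<Sum>\<^sub>\<infinity>n\<in>level_times f \<psi> T. \<Sum>\<^sub>\<infinity>x\<in>F n. ennreal (exp (birkhoff_sum f \<phi> n x)))"

definition ln_ennreal :: "ennreal \<Rightarrow> ereal" where
  "ln_ennreal q = (if q = 0 then -\<infinity> else if q = \<infinity> then \<infinity> else ereal (ln (enn2real q)))"

definition induced_pressure ::
  "('a::metric_space \<Rightarrow> 'a) \<Rightarrow> ('a \<Rightarrow> real) \<Rightarrow> ('a \<Rightarrow> real) \<Rightarrow> ereal" where
  "induced_pressure f \<psi> \<phi> =
     Lim (at_right 0)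
       (\<lambda>\<epsilon>. Limsup at_top (\<lambda>T::real. ln_ennreal (induced_Q f \<psi> \<phi> T \<epsilon>) / ereal T))"

text \<open>The limit exists in the setting of the theorem, by convexity of
  \<open>t \<mapsto> induced_pressure f \<psi> (\<phi> + t g)\<close>.\<close>

definition induced_pressure_right_deriv ::
  "('a::metric_space \<Rightarrow> 'a) \<Rightarrow> ('a \<Rightarrow> real) \<Rightarrow> ('a \<Rightarrow> real) \<Rightarrow> ('a \<Rightarrow> real) \<Rightarrow> ereal" where
  "induced_pressure_right_deriv f \<psi> \<phi> g =
     Lim (at_right 0)
       (\<lambda>t::real. (induced_pressure f \<psi> (\<lambda>x. \<phi> x + t * g x) - induced_pressure f \<psi> \<phi>) / ereal t)"

subsection \<open>Measures and measure-theoretic entropy\<close>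

abbreviation borel_probs :: "'a::topological_space measure set" where
  "borel_probs \<equiv> space (prob_algebra borel)"

definition invariant_probs :: "('a::topological_space \<Rightarrow> 'a) \<Rightarrow> 'a measure set" where
  "invariant_probs f = {\<mu> \<in> borel_probs. distr \<mu> borel f = \<mu>}"

definition borel_partition :: "'a::topological_space set set \<Rightarrow> bool" where
  "borel_partition \<xi> \<longleftrightarrow> finite \<xi> \<and> \<xi> \<subseteq> sets borel \<and> partition_on UNIV \<xi>"

text \<open>The join of \<open>\<xi>, f\<^sup>-\<^sup>1 \<xi>, \<dots>, f\<^sup>-\<^sup>(\<^sup>n\<^sup>-\<^sup>1\<^sup>) \<xi>\<close>.\<close>

definition iterated_join :: "('a \<Rightarrow> 'a) \<Rightarrow> 'a set set \<Rightarrow> nat \<Rightarrow> 'a set set" where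
  "iterated_join f \<xi> n = {\<Inter>i<n. (f ^^ i) -` A i | A. \<forall>i<n. A i \<in> \<xi>} - {{}}"

text \<open>The convention \<open>0 log 0 = 0\<close> is automatic.\<close>

definition partition_entropy :: "'a measure \<Rightarrow> 'a set set \<Rightarrow> real" where
  "partition_entropy \<mu> \<xi> = - (\<Sum>A\<in>\<xi>. measure \<mu> A * ln (measure \<mu> A))"

definition measure_entropy :: "('a::topological_space \<Rightarrow> 'a) \<Rightarrow> 'a measure \<Rightarrow> ereal" where
  "measure_entropy f \<mu> =
     (SUP \<xi>\<in>{\<xi>. borel_partition \<xi>}.
        ereal (lim (\<lambda>n. partition_entropy \<mu> (iterated_join f \<xi> n) / real n)))"

text \<open>The coarsest topology on the Borel probability measures making \<open>\<mu> \<mapsto> \<integral>g d\<mu>\<close> continuous for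
  every continuous \<open>g\<close>.\<close>

definition weak_star_topology :: "'a::topological_space measure topology" where
  "weak_star_topology = topology_generated_by
     {{\<mu> \<in> borel_probs. (\<integral>x. g x \<partial>\<mu>) \<in> U} | (g :: 'a \<Rightarrow> real) U. continuous_on UNIV g \<and> open U}"

definition mix_measure :: "real \<Rightarrow> 'a::topological_space measure \<Rightarrow> 'a measure \<Rightarrow> 'a measure" where
  "mix_measure p \<mu> \<nu> = measure_of UNIV (sets borel)
     (\<lambda>A. ennreal p * emeasure \<mu> A + ennreal (1 - p) * emeasure \<nu> A)"

definition convex_measures :: "'a::topological_space measure set \<Rightarrow> bool" where
  "convex_measures S \<longleftrightarrow> (\<forall>\<mu>\<in>S. \<forall>\<nu>\<in>S. \<forall>p\<in>{0..1}. mix_measure p \<mu> \<nu> \<in> S)"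

definition upper_semicontinuous_map :: "'b topology \<Rightarrow> ('b \<Rightarrow> ereal) \<Rightarrow> bool" where
  "upper_semicontinuous_map X h \<longleftrightarrow> (\<forall>c. openin X {x \<in> topspace X. h x < c})"

subsection \<open>Equilibrium states and tangent functionals\<close>

definition equilibrium_states ::
  "('a::metric_space \<Rightarrow> 'a) \<Rightarrow> ('a \<Rightarrow> real) \<Rightarrow> ('a \<Rightarrow> real) \<Rightarrow> 'a measure set" where
  "equilibrium_states f \<psi> \<phi> = {\<mu> \<in> invariant_probs f.
     induced_pressure f \<psi> \<phi> =
       (measure_entropy f \<mu> + ereal (\<integral>x. \<phi> x \<partial>\<mu>)) / ereal (\<integral>x. \<psi> x \<partial>\<mu>)}"

definition tangent_functionals ::
  "('a::metric_space \<Rightarrow> 'a) \<Rightarrow> ('a \<Rightarrow> real) \<Rightarrow> ('a \<Rightarrow> real) \<Rightarrow> 'a measure set" where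
  "tangent_functionals f \<psi> \<phi> = {\<mu> \<in> borel_probs. \<forall>g. continuous_on UNIV g \<longrightarrow>
     induced_pressure f \<psi> (\<lambda>x. \<phi> x + g x) - induced_pressure f \<psi> \<phi>
       \<ge> ereal ((\<integral>x. g x \<partial>\<mu>) / (\<integral>x. \<psi> x \<partial>\<mu>))}"

end

theory Submission
  imports Defs
begin

text \<open>
  Everything rests on the variational principle
  \<open>P\<^sub>\<psi>(\<phi>) = sup (h\<^sub>\<mu> + \<integral>\<phi> d\<mu>) / \<integral>\<psi> d\<mu>\<close> over the invariant measures.  For \<open>\<beta> > P\<^sub>\<psi>(\<phi>)\<close> the level sets
  at the heights \<open>T = k a\<close> supply spanning sets on which the Birkhoff sums of \<open>\<phi> - \<beta> \<psi>\<close> have subexponential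
  growth, so \<open>h\<^sub>\<mu> + \<integral>(\<phi> - \<beta> \<psi>) d\<mu> \<le> 0\<close>; for \<open>\<beta> < P\<^sub>\<psi>(\<phi>)\<close> Misiurewicz's argument, applied to separated
  subsets of suitable level sets and the potential \<open>\<phi> - \<beta> \<psi>\<close>, produces an invariant measure with the
  reverse inequality.  The pressure is thereby a real-valued supremum of affine functions of \<open>\<phi>\<close> that depends
  on \<open>\<phi>\<close> only through its integrals against invariant measures, which gives convexity, the invariance of
  tangent functionals and the tangency of equilibrium states.  Weak-star limits of measures are limits of
  functionals in a product of compact intervals, represented by measures through Riesz's theorem.
\<close>

subsection \<open>Borel probability measures and continuous functions\<close>

text \<open>The quotient is not affine in the measure, but since the integral of \<psi> is positive,
  comparing it with \<beta> amounts to comparing the entropy plus the integral of \<phi> - \<beta>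
  \<psi> with 0. The induced pressure is thus the value of \<beta> at which the ordinary pressure of
  \<phi> - \<beta> \<psi> changes sign, and both halves of the variational principle are proved in
  this form. On a level set of height T the Birkhoff sum of \<psi> stays within max \<psi> of T, so
  the weights of \<phi> and of \<phi> - \<beta> \<psi> differ there by exp (-\<beta> T) up to a
  bounded factor; and only O(T) times n occur, which any gap between two exponents absorbs. This is
  why the estimates carry an additive constant C and why pairs such as \<beta>0 < \<beta> appear.
  Finite topological entropy bounds all measure entropies by one number, which keeps the pressure
  from being infinite. Cluster points are taken along filters finer than
  \<open>sequentially\<close>, so neither metrizability of the space of measures nor a choice of
  subsequences enters.\<close>

lemma continuous_UNIV_bounded:
  fixes g :: "'a::metric_space \<Rightarrow> real"
  assumes "compact (UNIV::'a set)" "continuous_on UNIV g"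
  obtains B where "B > 0" "\<And>x. \<bar>g x\<bar> \<le> B"
proof -
  have "bounded (range g)"
    using assms compact_continuous_image compact_imp_bounded by blast
  then show ?thesis using that unfolding bounded_pos by (metis rangeI real_norm_def)
qed

lemma infdist_approx_mono:
  fixes C :: "'a::metric_space set"
  shows "min 1 (real k * infdist x C) \<le> min 1 (real (Suc k) * infdist x C)"
  by (rule min.mono) (auto intro: mult_right_mono infdist_nonneg)

text \<open>Off a closed set the distance is positive, so a large multiple exceeds 1. The set must
  be nonempty because \<open>infdist x {}\<close> is 0 by convention. These continuous functions,
  increasing to the indicator of \<open>-C\<close>, serve both the uniqueness of measures and the
  measurability of closed sets.\<close>

lemma infdist_approx_tendsto:
  fixes C :: "'a::metric_space set"
  assumes "closed C" "C \<noteq> {}"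
  shows "(\<lambda>k. min 1 (real k * infdist x C)) \<longlonglongrightarrow> (if x \<in> C then 0 else 1)"
proof (cases "x \<in> C")
  case True then show ?thesis by simp
next
  case False
  then have p: "infdist x C > 0"
    using assms infdist_pos_not_in_closed by blast
  obtain m where m: "real m * infdist x C > 1"
    using p reals_Archimedean3 by blast
  have "\<forall>\<^sub>F k in sequentially. min 1 (real k * infdist x C) = 1"
    using eventually_ge_at_top[of m]
  proof eventually_elim
    case (elim k)
    have "real m * infdist x C \<le> real k * infdist x C"
      using elim p by (intro mult_right_mono) auto
    then show ?case using m by auto
  qed
  then show ?thesis using False by (simp add: tendsto_eventually)
qed

lemma continuous_infdist_approx:
  "continuous_on UNIV (\<lambda>x. min 1 (real k * infdist x C))"
  by (intro continuous_intros)

lemma borel_prob_integrable: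
  fixes g :: "'a::metric_space \<Rightarrow> real"
  assumes "compact (UNIV::'a set)" "M \<in> borel_probs" "continuous_on UNIV g"
  shows "integrable M g"
proof -
  have s: "sets M = sets borel" and p: "prob_space M"
    using assms(2) by (auto simp: space_prob_algebra)
  interpret prob_space M by (rule p)
  obtain B where B: "\<And>x. \<bar>g x\<bar> \<le> B"
    using continuous_UNIV_bounded[OF assms(1,3)] by metis
  have "g \<in> borel_measurable M"
    using borel_measurable_continuous_onI[OF assms(3)] s by (simp cong: measurable_cong_sets)
  then show ?thesis by (rule integrable_const_bound[rotated, where B=B]) (auto simp: B)
qed

lemma space_borel_prob: "M \<in> borel_probs \<Longrightarrow> space M = UNIV"
  using sets_eq_imp_space_eq by (fastforce simp: space_prob_algebra)

text \<open>Dominated convergence along the functions above recovers the measure of every closed set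
  from integrals of continuous functions, and the closed sets are a generator stable under
  intersection.\<close>

lemma borel_probs_eqI:
  fixes M N :: "'a::metric_space measure"
  assumes c: "compact (UNIV::'a set)" and M: "M \<in> borel_probs" and N: "N \<in> borel_probs"
    and eq: "\<And>g :: 'a \<Rightarrow> real. continuous_on UNIV g \<Longrightarrow> (\<integral>x. g x \<partial>M) = (\<integral>x. g x \<partial>N)"
  shows "M = N"
proof -
  have sM: "sets M = sets borel" and pM: "prob_space M" and sN: "sets N = sets borel" and pN: "prob_space N"
    using M N by (auto simp: space_prob_algebra)
  interpret M: prob_space M by fact
  interpret N: prob_space N by fact
  have closed_eq: "measure M C = measure N C" if C: "closed C" for C
  proof (cases "C = {}")
    case False
    have lim: "(\<lambda>k. \<integral>x. min 1 (real k * infdist x C) \<partial>Q) \<longlonglongrightarrow> (\<integral>x. indicator (-C) x \<partial>Q)"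
      if "Q \<in> borel_probs" for Q :: "'a measure"
    proof (rule integral_dominated_convergence[where w="\<lambda>_. 1"])
      interpret Q: prob_space Q using that by (simp add: space_prob_algebra)
      have sQ: "sets Q = sets borel" using that by (simp add: space_prob_algebra)
      show "(\<lambda>x. indicator (-C) x :: real) \<in> borel_measurable Q"
        using C sQ by (intro borel_measurable_indicator) auto
      show "(\<lambda>x. min 1 (real k * infdist x C)) \<in> borel_measurable Q" for k
        using borel_measurable_continuous_onI[OF continuous_infdist_approx] sQ
        by (simp cong: measurable_cong_sets)
      show "AE x in Q. (\<lambda>k. min 1 (real k * infdist x C)) \<longlonglongrightarrow> indicator (-C) x"
      proof (rule AE_I2)
        fix x show "(\<lambda>k. min 1 (real k * infdist x C)) \<longlonglongrightarrow> indicator (-C) x"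
          using infdist_approx_tendsto[OF C False, of x] by (cases "x \<in> C") auto
      qed
      show "integrable Q (\<lambda>x. 1::real)" by simp
      show "AE x in Q. norm (min 1 (real k * infdist x C)) \<le> 1" for k
        by (simp add: infdist_nonneg)
    qed
    have "(\<integral>x. indicator (-C) x \<partial>M) = (\<integral>x. indicator (-C) x \<partial>N :: real)"
      using lim[OF M] lim[OF N] eq[OF continuous_infdist_approx]
      by (simp add: LIMSEQ_unique)
    then have "measure M (-C) = measure N (-C)"
      using C sM sN by (simp add: space_borel_prob[OF M] space_borel_prob[OF N])
    then show ?thesis
      using M.prob_compl[of C] N.prob_compl[of C] C sM sN
      by (simp add: space_borel_prob[OF M] space_borel_prob[OF N] Compl_eq_Diff_UNIV)
  qed simp
  show ?thesis
  proof (rule measure_eqI_generator_eq[where E="Collect closed" and \<Omega>=UNIV and A="\<lambda>_. UNIV"])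
    show "Int_stable (Collect closed :: 'a set set)" by (auto intro!: Int_stableI)
    show "sets M = sigma_sets UNIV (Collect closed)" "sets N = sigma_sets UNIV (Collect closed)"
      by (simp_all add: sM sN borel_eq_closed)
    show "\<And>X. X \<in> Collect closed \<Longrightarrow> emeasure M X = emeasure N X"
      using closed_eq by (simp add: M.emeasure_eq_measure N.emeasure_eq_measure)
  qed (auto simp: M.emeasure_eq_measure)
qed

subsection \<open>Riesz representation on a compact metric space\<close>

text \<open>\<open>L\<close> is defined on all functions and constrained only at continuous ones, so
  that such functionals are points of a plain product space.\<close>

locale positive_functional =
  fixes L :: "('a::metric_space \<Rightarrow> real) \<Rightarrow> real"
  assumes compact_UNIV: "compact (UNIV :: 'a set)"
    and L_add: "\<lbrakk>continuous_on UNIV g; continuous_on UNIV h\<rbrakk> \<Longrightarrow> L (\<lambda>x. g x + h x) = L g + L h"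
    and L_cmult: "continuous_on UNIV g \<Longrightarrow> L (\<lambda>x. c * g x) = c * L g"
    and L_nonneg: "\<lbrakk>continuous_on UNIV g; \<And>x. g x \<ge> 0\<rbrakk> \<Longrightarrow> L g \<ge> 0"
    and L_one: "L (\<lambda>_. 1) = 1"
begin

lemma L_const: "L (\<lambda>_. c) = c"
  using L_cmult[of "\<lambda>_. 1" c] L_one by simp

lemma L_diff:
  assumes "continuous_on UNIV g" "continuous_on UNIV h"
  shows "L (\<lambda>x. g x - h x) = L g - L h"
  using L_add[of g "\<lambda>x. (-1) * h x"] L_cmult[of h "-1"] assms by (simp add: continuous_on_minus)

lemma L_mono:
  assumes "continuous_on UNIV g" "continuous_on UNIV h" "\<And>x. g x \<le> h x"
  shows "L g \<le> L h"
  using L_nonneg[of "\<lambda>x. h x - g x"] L_diff[of h g] assms by (simp add: continuous_on_diff)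

lemma L_sum:
  assumes "finite I" "\<And>i. i \<in> I \<Longrightarrow> continuous_on UNIV (g i)"
  shows "L (\<lambda>x. \<Sum>i\<in>I. g i x) = (\<Sum>i\<in>I. L (g i))"
  using assms
proof (induction I rule: finite_induct)
  case empty then show ?case using L_const[of 0] by simp
next
  case (insert i I)
  then show ?case by (simp add: L_add continuous_on_sum)
qed

text \<open>Daniell's approach: sets are covered by series of nonnegative continuous functions
  rather than by open sets, so that the outer measure is read off \<open>L\<close> directly, without
  a first step that assigns values to open sets.\<close>

definition covers :: "'a set \<Rightarrow> (nat \<Rightarrow> 'a \<Rightarrow> real) set" where
  "covers A = {g. (\<forall>n. continuous_on UNIV (g n) \<and> (\<forall>x. g n x \<ge> 0)) \<and> (\<forall>x\<in>A. 1 \<le> (\<Sum>n. ennreal (g n x)))}"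

definition outer :: "'a set \<Rightarrow> ennreal" where
  "outer A = (INF g\<in>covers A. \<Sum>n. ennreal (L (g n)))"

lemma coversD:
  assumes "g \<in> covers A"
  shows "continuous_on UNIV (g n)" "g n x \<ge> 0" "x \<in> A \<Longrightarrow> 1 \<le> (\<Sum>n. ennreal (g n x))"
  using assms by (auto simp: covers_def)

text \<open>A Dini argument: the partial sums exceed \<open>h - \<delta>\<close> on an increasing
  family of open sets that cover the compact space, so one partial sum works everywhere. Compactness
  is what turns finite additivity of \<open>L\<close> into a statement about series.\<close>

lemma L_le_suminf:
  assumes h: "continuous_on UNIV h"
    and g: "\<And>n. continuous_on UNIV (g n)" "\<And>n x. g n x \<ge> 0"
    and le: "\<And>x. ennreal (h x) \<le> (\<Sum>n. ennreal (g n x))"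
  shows "ennreal (L h) \<le> (\<Sum>n. ennreal (L (g n)))"
proof (rule ennreal_le_epsilon)
  fix \<delta> :: real assume \<delta>: "\<delta> > 0"
  define U where "U N = {x. h x < \<delta> + (\<Sum>n<N. g n x)}" for N
  have opn: "open (U N)" for N
    unfolding U_def using g h by (intro open_Collect_less continuous_intros) auto
  have cov: "UNIV \<subseteq> (\<Union>N. U N)"
  proof
    fix x
    have "\<exists>N. h x < \<delta> + (\<Sum>n<N. g n x)"
    proof (rule ccontr)
      assume "\<nexists>N. h x < \<delta> + (\<Sum>n<N. g n x)"
      then have *: "(\<Sum>n<N. g n x) \<le> h x - \<delta>" for N
        by (metis add.commute le_diff_eq linorder_not_less)
      have "(\<Sum>n. ennreal (g n x)) \<le> ennreal (h x - \<delta>)"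
        by (rule suminf_le_const) (auto simp: g * sum_ennreal intro!: ennreal_leI)
      then have "ennreal (h x) \<le> ennreal (h x - \<delta>)" using le order_trans by blast
      moreover have "h x - \<delta> \<ge> 0" using *[of 0] by simp
      ultimately show False using \<delta> by simp
    qed
    then show "x \<in> (\<Union>N. U N)" by (auto simp: U_def)
  qed
  obtain D where D: "finite D" "UNIV \<subseteq> (\<Union>N\<in>D. U N)"
    using compactE_image[OF compact_UNIV, of UNIV U] opn cov by metis
  obtain m where m: "\<And>N. N \<in> D \<Longrightarrow> N \<le> m" using D(1) unfolding finite_nat_set_iff_bounded_le by auto
  have "h x \<le> \<delta> + (\<Sum>n<m. g n x)" for x
  proof -
    obtain N where "N \<in> D" "x \<in> U N" using D(2) by auto
    moreover have "(\<Sum>n<N. g n x) \<le> (\<Sum>n<m. g n x)"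
      using m[OF \<open>N \<in> D\<close>] by (intro sum_mono2) (auto simp: g)
    ultimately show ?thesis by (simp add: U_def)
  qed
  then have "L h \<le> L (\<lambda>x. \<delta> + (\<Sum>n<m. g n x))"
    using g h by (intro L_mono continuous_intros) auto
  also have "\<dots> = \<delta> + (\<Sum>n<m. L (g n))"
    using g by (subst L_add) (auto simp: L_const L_sum intro!: continuous_intros)
  finally have "ennreal (L h) \<le> ennreal ((\<Sum>n<m. L (g n)) + \<delta>)" by (intro ennreal_leI) simp
  also have "\<dots> = (\<Sum>n<m. ennreal (L (g n))) + ennreal \<delta>"
    using \<delta> g by (subst ennreal_plus) (auto intro!: sum_nonneg L_nonneg simp: sum_ennreal L_nonneg)
  also have "\<dots> \<le> (\<Sum>n. ennreal (L (g n))) + ennreal \<delta>"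
    by (intro add_right_mono sum_le_suminf) auto
  finally show "ennreal (L h) \<le> (\<Sum>n. ennreal (L (g n))) + ennreal \<delta>" .
qed

lemma outer_le_one: "outer A \<le> 1"
proof -
  let ?g = "\<lambda>(n::nat) (x::'a). if n = 0 then 1 else 0::real"
  have s: "(\<Sum>n. ennreal (if n = 0 then 1 else 0)) = 1"
    by (subst suminf_finite[of "{0}"]) auto
  have "?g \<in> covers A" using s by (auto simp: covers_def)
  then have "outer A \<le> (\<Sum>n. ennreal (L (?g n)))" unfolding outer_def by (rule INF_lower)
  also have "\<dots> = 1" using L_const by (subst suminf_finite[of "{0}"]) auto
  finally show ?thesis .
qed

lemma outer_UNIV: "outer UNIV = 1"
proof (rule antisym[OF outer_le_one])
  show "1 \<le> outer UNIV" unfolding outer_def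
  proof (rule INF_greatest)
    fix g assume g: "g \<in> covers UNIV"
    have "ennreal (L (\<lambda>_. 1)) \<le> (\<Sum>n. ennreal (L (g n)))"
      by (rule L_le_suminf[OF continuous_on_const coversD(1,2)[OF g]]) (simp add: coversD(3)[OF g])
    then show "1 \<le> (\<Sum>n. ennreal (L (g n)))" by (simp add: L_one)
  qed
qed

lemma outer_close:
  assumes "\<epsilon> > 0"
  obtains g where "g \<in> covers A" "(\<Sum>n. ennreal (L (g n))) < outer A + ennreal \<epsilon>"
proof -
  have "outer A < outer A + ennreal \<epsilon>"
    using outer_le_one[of A] assms by (cases "outer A") (auto simp: top_unique ennreal_lessI simp flip: ennreal_plus)
  then show ?thesis using that unfolding outer_def INF_less_iff by blast
qed

lemma outer_mono: "A \<subseteq> B \<Longrightarrow> outer A \<le> outer B"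
  unfolding outer_def by (intro INF_superset_mono) (auto simp: covers_def)

lemma outer_empty: "outer {} = 0"
proof -
  have "(\<lambda>_ _. 0) \<in> covers {}" by (auto simp: covers_def)
  then have "outer {} \<le> (\<Sum>n::nat. ennreal (L (\<lambda>_. 0)))" unfolding outer_def by (rule INF_lower)
  then show ?thesis by (simp add: L_const)
qed

text \<open>Near-optimal covers whose errors sum to \<open>\<epsilon>\<close> are merged into one
  sequence by enumerating pairs.\<close>

lemma outer_UN_le: "outer (\<Union>i. A i) \<le> (\<Sum>i::nat. outer (A i))"
proof (rule ennreal_le_epsilon)
  fix \<epsilon> :: real assume \<epsilon>: "\<epsilon> > 0"
  have "\<exists>g. g \<in> covers (A i) \<and> (\<Sum>n. ennreal (L (g n))) \<le> outer (A i) + ennreal (\<epsilon> * (1/2)^Suc i)" for i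
    using outer_close[of "\<epsilon> * (1/2)^Suc i" "A i"] \<epsilon> by (metis less_imp_le mult_pos_pos zero_less_divide_1_iff zero_less_numeral zero_less_power)
  then obtain g where g: "\<And>i. g i \<in> covers (A i)"
    "\<And>i. (\<Sum>n. ennreal (L (g i n))) \<le> outer (A i) + ennreal (\<epsilon> * (1/2)^Suc i)" by metis
  let ?g = "\<lambda>k. g (fst (prod_decode k)) (snd (prod_decode k))"
  have cov: "?g \<in> covers (\<Union>i. A i)"
  proof -
    have "1 \<le> (\<Sum>k. ennreal (?g k x))" if "x \<in> A i" for x i
    proof -
      have "1 \<le> (\<Sum>n. ennreal (g i n x))" using coversD(3)[OF g(1) that] .
      also have "\<dots> \<le> (\<Sum>i. \<Sum>n. ennreal (g i n x))"
        using sum_le_suminf[of "\<lambda>i. \<Sum>n. ennreal (g i n x)" "{i}"] by auto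
      also have "\<dots> = (\<Sum>k. (\<lambda>(i,n). ennreal (g i n x)) (prod_decode k))"
        by (rule suminf_ennreal_2dimen[symmetric]) simp
      finally show ?thesis by (simp add: case_prod_beta)
    qed
    then show ?thesis using coversD[OF g(1)] by (auto simp: covers_def)
  qed
  have "outer (\<Union>i. A i) \<le> (\<Sum>k. ennreal (L (?g k)))"
    unfolding outer_def using cov by (rule INF_lower)
  also have "\<dots> = (\<Sum>k. (\<lambda>(i,n). ennreal (L (g i n))) (prod_decode k))" by (simp add: case_prod_beta)
  also have "\<dots> = (\<Sum>i. \<Sum>n. ennreal (L (g i n)))" by (rule suminf_ennreal_2dimen) simp
  also have "\<dots> \<le> (\<Sum>i. outer (A i) + ennreal (\<epsilon> * (1/2)^Suc i))"
    by (intro suminf_le g(2)) auto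
  also have "\<dots> = (\<Sum>i. outer (A i)) + (\<Sum>i. ennreal (\<epsilon> * (1/2)^Suc i))"
    by (rule suminf_add[symmetric]) auto
  also have "(\<Sum>i. ennreal (\<epsilon> * (1/2)^Suc i)) = ennreal \<epsilon>"
    using \<epsilon> sums_mult[OF power_half_series, of \<epsilon>] by (intro suminf_ennreal_eq) auto
  finally show "outer (\<Union>i. A i) \<le> (\<Sum>i. outer (A i)) + ennreal \<epsilon>" .
qed

lemma outer_Un_le: "outer (A \<union> B) \<le> outer A + outer B"
proof -
  have "outer (A \<union> B) \<le> (\<Sum>i. outer (binaryset A B i))"
    using outer_UN_le[of "binaryset A B"] by (simp only: UN_binaryset_eq)
  also have "\<dots> = outer A + outer B"
    by (rule suminf_binaryset_eq) (rule outer_empty)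
  finally show ?thesis .
qed

text \<open>Multiply a near-optimal cover of \<open>A\<close> by a continuous factor. The factor
  \<open>1 - p k\<close> equals 1 on \<open>C\<close>, which gives a cover of
  \<open>A \<inter> C\<close>; the factor increasing to 1 off \<open>C\<close> gives one of
  \<open>A - C\<close>. The two costs add up to that of the original cover, up to
  \<open>\<epsilon>\<close>.\<close>

lemma outer_closed_split:
  assumes C: "closed C" "C \<noteq> {}"
  shows "outer (A \<inter> C) + outer (A - C) \<le> outer A"
proof (rule ennreal_le_epsilon)
  fix \<epsilon> :: real assume \<epsilon>: "\<epsilon> > 0"
  obtain g where g: "g \<in> covers A" "(\<Sum>n. ennreal (L (g n))) < outer A + ennreal (\<epsilon>/2)"
    by (rule outer_close[OF half_gt_zero[OF \<epsilon>]])
  note gc = coversD[OF g(1)]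
  define p where "p k x = min 1 (real k * infdist x C)" for k x
  have p0: "p 0 x = 0" for x by (simp add: p_def)
  have pinc: "p k x \<le> p (Suc k) x" for k x unfolding p_def by (rule infdist_approx_mono)
  have p01: "0 \<le> p k x" "p k x \<le> 1" for k x by (auto simp: p_def infdist_nonneg)
  have pc[continuous_intros]: "continuous_on UNIV (p k)" for k
    unfolding p_def by (rule continuous_infdist_approx)
  have pC: "p k x = 0" if "x \<in> C" for k x using that by (simp add: p_def)
  have plim: "(\<lambda>k. p k x) \<longlonglongrightarrow> 1" if "x \<notin> C" for x
    using infdist_approx_tendsto[OF C, of x] that by (simp add: p_def)
  define a where "a n k = L (\<lambda>x. g n x * p k x)" for n k
  have cgp: "continuous_on UNIV (\<lambda>x. g n x * p k x)" for n k
    using gc(1) by (intro continuous_intros)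
  have a_inc: "incseq (a n)" for n
    unfolding incseq_Suc_iff a_def
    by (intro allI L_mono cgp mult_left_mono pinc gc)
  have a_le: "a n k \<le> L (g n)" for n k
    unfolding a_def using mult_left_mono[OF p01(2) gc(2)] by (intro L_mono cgp gc(1)) simp
  have "\<exists>s. a n \<longlonglongrightarrow> s \<and> (\<forall>k. a n k \<le> s)" for n
    by (rule incseq_convergent[OF a_inc[of n], of "L (g n)"]) (simp_all add: a_le exI)
  then obtain s where s: "\<And>n. a n \<longlonglongrightarrow> s n" "\<And>n k. a n k \<le> s n" by metis
  have "\<exists>k. s n - \<epsilon>/2 * (1/2)^Suc n < a n k" for n
  proof -
    have "s n - \<epsilon>/2 * (1/2)^Suc n < s n" using \<epsilon> by simp
    from order_tendstoD(1)[OF s(1) this] show ?thesis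
      using eventually_sequentially by fastforce
  qed
  \<comment> \<open>An index for each \<open>n\<close> so late that stopping there loses at most a
    summable share of \<open>\<epsilon>/2\<close>.\<close>
  then obtain K where K: "\<And>n. s n - \<epsilon>/2 * (1/2)^Suc n < a n (K n)" by metis
  have "outer (A \<inter> C) \<le> (\<Sum>n. ennreal (L (\<lambda>x. g n x * (1 - p (K n) x))))"
    unfolding outer_def
  proof (rule INF_lower)
    show "(\<lambda>n x. g n x * (1 - p (K n) x)) \<in> covers (A \<inter> C)"
      using gc p01 by (auto simp: covers_def pC intro!: continuous_intros)
  qed
  also have "\<dots> = (\<Sum>n. ennreal (L (g n) - a n (K n)))"
    unfolding a_def by (subst L_diff[symmetric]) (auto simp: gc cgp algebra_simps)
  also have "\<dots> \<le> (\<Sum>n. ennreal (L (g n) - s n) + ennreal (\<epsilon>/2 * (1/2)^Suc n))"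
  proof (rule suminf_le)
    fix n
    have "s n \<le> L (g n)" using LIMSEQ_le_const2[OF s(1)] a_le by blast
    then have "ennreal (L (g n) - a n (K n)) \<le> ennreal ((L (g n) - s n) + \<epsilon>/2 * (1/2)^Suc n)"
      using K[of n] by (intro ennreal_leI) linarith
    also have "\<dots> = ennreal (L (g n) - s n) + ennreal (\<epsilon>/2 * (1/2)^Suc n)"
      using \<open>s n \<le> L (g n)\<close> \<epsilon> by (intro ennreal_plus) auto
    finally show "ennreal (L (g n) - a n (K n)) \<le> ennreal (L (g n) - s n) + ennreal (\<epsilon>/2 * (1/2)^Suc n)" .
  qed auto
  also have "\<dots> = (\<Sum>n. ennreal (L (g n) - s n)) + (\<Sum>n. ennreal (\<epsilon>/2 * (1/2)^Suc n))"
    by (rule suminf_add[symmetric]) auto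
  also have "(\<Sum>i. ennreal (\<epsilon>/2 * (1/2)^Suc i)) = ennreal (\<epsilon>/2)"
    using \<epsilon> sums_mult[OF power_half_series, of "\<epsilon>/2"] by (intro suminf_ennreal_eq) auto
  finally have 1: "outer (A \<inter> C) \<le> (\<Sum>n. ennreal (L (g n) - s n)) + ennreal (\<epsilon>/2)" .
  \<comment> \<open>A single \<open>g n * p k\<close> need not reach \<open>g n\<close> off
    \<open>C\<close>, but the increments sum to it, and their values under \<open>L\<close>
    telescope to the limit \<open>s n\<close>.\<close>
  let ?h = "\<lambda>n k x. g n x * (p (Suc k) x - p k x)"
  let ?H = "\<lambda>j. ?h (fst (prod_decode j)) (snd (prod_decode j))"
  have hs: "(\<Sum>k. ennreal (?h n k x)) = ennreal (g n x)" if "x \<notin> C" for n x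
  proof (rule suminf_ennreal_eq)
    show "0 \<le> ?h n k x" for k using gc pinc by simp
    have "(\<lambda>k. p (Suc k) x - p k x) sums (1 - p 0 x)"
      using telescope_sums[OF plim[OF that]] by simp
    from sums_mult[OF this, of "g n x"] show "(\<lambda>k. ?h n k x) sums g n x" by (simp add: p0)
  qed
  have "outer (A - C) \<le> (\<Sum>j. ennreal (L (?H j)))"
    unfolding outer_def
  proof (rule INF_lower)
    have "1 \<le> (\<Sum>j. ennreal (?H j x))" if "x \<in> A - C" for x
    proof -
      have "(\<Sum>j. ennreal (?H j x)) = (\<Sum>j. (\<lambda>(n,k). ennreal (?h n k x)) (prod_decode j))"
        by (simp add: case_prod_beta)
      also have "\<dots> = (\<Sum>n. \<Sum>k. ennreal (?h n k x))" by (rule suminf_ennreal_2dimen) simp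
      also have "\<dots> = (\<Sum>n. ennreal (g n x))" using hs that by simp
      finally show ?thesis using gc(3) that by simp
    qed
    then show "?H \<in> covers (A - C)"
      using gc pinc by (auto simp: covers_def intro!: continuous_intros)
  qed
  also have "\<dots> = (\<Sum>j. (\<lambda>(n,k). ennreal (L (?h n k))) (prod_decode j))"
    by (simp add: case_prod_beta)
  also have "\<dots> = (\<Sum>n. \<Sum>k. ennreal (L (?h n k)))" by (rule suminf_ennreal_2dimen) simp
  also have "\<dots> = (\<Sum>n. ennreal (s n))"
  proof (rule suminf_cong, rule suminf_ennreal_eq)
    fix n
    have e: "L (?h n k) = a n (Suc k) - a n k" for k
      unfolding a_def by (subst L_diff[symmetric]) (auto simp: cgp right_diff_distrib)
    show "0 \<le> L (?h n k)" for k unfolding e using incseq_SucD[OF a_inc[of n], of k] by simp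
    have "a n 0 = 0" by (simp add: a_def p0 L_const)
    then show "(\<lambda>k. L (?h n k)) sums s n" unfolding e using telescope_sums[OF s(1)[of n]] by simp
  qed
  finally have 2: "outer (A - C) \<le> (\<Sum>n. ennreal (s n))" .
  have sn: "s n \<ge> 0" for n
    using s(2)[of n 0] by (simp add: a_def p0 L_const)
  have sL: "s n \<le> L (g n)" for n using LIMSEQ_le_const2[OF s(1)] a_le by blast
  have "outer (A \<inter> C) + outer (A - C) \<le> (\<Sum>n. ennreal (L (g n) - s n)) + ennreal (\<epsilon>/2) + (\<Sum>n. ennreal (s n))"
    by (rule add_mono[OF 1 2])
  also have "\<dots> = (\<Sum>n. ennreal (L (g n) - s n) + ennreal (s n)) + ennreal (\<epsilon>/2)"
    by (subst suminf_add[symmetric]) (auto simp: ac_simps)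
  also have "(\<Sum>n. ennreal (L (g n) - s n) + ennreal (s n)) = (\<Sum>n. ennreal (L (g n)))"
    using sn sL by (intro suminf_cong) (simp add: ennreal_plus[symmetric] del: ennreal_plus)
  also have "\<dots> + ennreal (\<epsilon>/2) \<le> outer A + ennreal (\<epsilon>/2) + ennreal (\<epsilon>/2)"
    using g(2) by (intro add_right_mono) simp
  also have "\<dots> = outer A + ennreal \<epsilon>"
    using \<epsilon> by (simp add: add.assoc ennreal_plus[symmetric] del: ennreal_plus)
  finally show "outer (A \<inter> C) + outer (A - C) \<le> outer A + ennreal \<epsilon>" .
qed

section \<open>Caratheodory's extension and the representation of the functional\<close>

definition riesz_measure :: "'a measure" where
  "riesz_measure = measure_of UNIV (sets borel) outer"

text \<open>Closed sets split every set additively, so the Caratheodory sigma-algebra contains them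
  and hence all Borel sets.\<close>

lemma outer_measure_space_borel: "measure_space UNIV (sets borel) outer"
proof -
  interpret P: sigma_algebra UNIV "Pow UNIV :: 'a set set" by (rule sigma_algebra_Pow)
  let ?\<Lambda> = "lambda_system UNIV (Pow UNIV) outer"
  have "outer_measure_space (Pow UNIV) outer"
    by (auto simp: outer_measure_space_def positive_def increasing_def countably_subadditive_def
        outer_empty outer_mono outer_UN_le)
  from P.caratheodory_lemma[OF this] have ms: "measure_space UNIV ?\<Lambda> outer" .
  have "C \<in> ?\<Lambda>" if "closed C" for C
  proof (cases "C = {}")
    case True then show ?thesis by (auto simp: lambda_system_def outer_empty)
  next
    case False
    have "outer (A \<inter> C) + outer (A - C) = outer A" for A
    proof (rule antisym[OF outer_closed_split[OF that False]])
      show "outer A \<le> outer (A \<inter> C) + outer (A - C)"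
        using outer_Un_le[of "A \<inter> C" "A - C"] by (simp add: Int_Diff_Un)
    qed
    then show ?thesis unfolding P.lambda_system_eq by auto
  qed
  then have "sigma_sets UNIV (Collect closed) \<subseteq> ?\<Lambda>"
    using ms unfolding measure_space_def
    by (intro sigma_algebra.sigma_sets_subset) auto
  then have sub: "sets borel \<subseteq> ?\<Lambda>" by (simp add: borel_eq_closed)
  show ?thesis
    by (rule measure_down[OF ms _ sub]) (metis sets.sigma_algebra_axioms space_borel)
qed

lemma sets_riesz_measure: "sets riesz_measure = sets borel"
  unfolding riesz_measure_def by (metis sets.sets_measure_of_eq space_borel)

lemma emeasure_riesz_measure: "A \<in> sets borel \<Longrightarrow> emeasure riesz_measure A = outer A"
  using outer_measure_space_borel unfolding riesz_measure_def measure_space_def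
  by (intro emeasure_measure_of_sigma) (auto)

lemma riesz_measure_borel_prob: "riesz_measure \<in> borel_probs"
  using emeasure_riesz_measure[of UNIV] outer_UNIV sets_eq_imp_space_eq[OF sets_riesz_measure]
  by (auto simp: space_prob_algebra sets_riesz_measure intro!: prob_spaceI)

text \<open>\<open>h\<close> lies below the indicator of \<open>A\<close>, hence below every cover
  of \<open>A\<close>, and \<open>L_le_suminf\<close> compares the costs. This one-sided bound
  suffices, since the reverse estimate comes from changing the sign of the function that is
  represented.\<close>

lemma L_le_emeasure:
  assumes h: "continuous_on UNIV h" "\<And>x. h x \<le> 1" "\<And>x. x \<notin> A \<Longrightarrow> h x \<le> 0" and A: "A \<in> sets borel"
  shows "L h \<le> measure riesz_measure A"
proof -
  interpret prob_space riesz_measure using riesz_measure_borel_prob by (simp add: space_prob_algebra)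
  have "ennreal (L h) \<le> outer A"
    unfolding outer_def
  proof (rule INF_greatest)
    fix g assume g: "g \<in> covers A"
    show "ennreal (L h) \<le> (\<Sum>n. ennreal (L (g n)))"
    proof (rule L_le_suminf[OF h(1) coversD(1,2)[OF g]])
      fix x
      show "ennreal (h x) \<le> (\<Sum>n. ennreal (g n x))"
      proof (cases "x \<in> A")
        case True
        have "ennreal (h x) \<le> 1" using h(2) ennreal_leI by fastforce
        then show ?thesis using coversD(3)[OF g True] by (rule order_trans)
      next
        case False then show ?thesis using h(3)[OF False] by (simp add: ennreal_neg)
      qed
    qed
  qed
  then have "ennreal (L h) \<le> ennreal (measure riesz_measure A)"
    using emeasure_riesz_measure[OF A] by (simp only: emeasure_eq_measure)
  then show ?thesis by (subst (asm) ennreal_le_iff) auto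
qed

text \<open>A discrete layer-cake formula: \<open>g\<close> is cut into \<open>n\<close> horizontal
  slices, each at most \<open>1/n\<close> times the indicator of a superlevel set, and the previous
  bound applies to each slice.\<close>

lemma L_le_integral_unit:
  assumes g: "continuous_on UNIV g" "\<And>x. 0 \<le> g x" "\<And>x. g x \<le> 1"
  shows "L g \<le> (\<integral>x. g x \<partial>riesz_measure)"
proof (rule field_le_epsilon)
  fix \<epsilon> :: real assume \<epsilon>: "\<epsilon> > 0"
  interpret prob_space riesz_measure using riesz_measure_borel_prob by (simp add: space_prob_algebra)
  obtain n where n: "n > 0" "1 / real n < \<epsilon>"
    using \<epsilon> by (metis nat_approx_posE of_nat_Suc zero_less_Suc)
  \<comment> \<open>The part of \<open>g\<close> between the heights \<open>k/n\<close> and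
    \<open>(k+1)/n\<close>.\<close>
  define c where "c k x = max 0 (min (1/n) (g x - real k / n))" for k x
  have layer: "(\<Sum>k<m. c k x) = max 0 (min (real m/n) (g x))" for m x
  proof (induction m)
    case 0 then show ?case using g by simp
  next
    case (Suc m) then show ?case using n g(2,3)[of x] by (auto simp: c_def max_def min_def field_simps)
  qed
  have layer_n: "(\<Sum>k<n. c k x) = g x" for x
    unfolding layer using n g by simp
  have cc: "continuous_on UNIV (c k)" for k unfolding c_def using g(1) by (intro continuous_intros)
  define A where "A k = {x. g x > real k / n}" for k
  have Ab: "A k \<in> sets borel" for k
    unfolding A_def using g(1) by (intro borel_open open_Collect_less continuous_intros)
  have Am: "A k \<in> sets riesz_measure" for k using Ab sets_riesz_measure by simp
  have Lc: "L (c k) \<le> measure riesz_measure (A k) / n" for k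
  proof -
    have "L (\<lambda>x. real n * c k x) \<le> measure riesz_measure (A k)"
    proof (rule L_le_emeasure[OF _ _ _ Ab])
      show "continuous_on UNIV (\<lambda>x. real n * c k x)" by (intro continuous_intros cc)
      fix x
      have "c k x \<le> 1/n" by (simp add: c_def)
      from mult_left_mono[OF this, of "real n"] show "real n * c k x \<le> 1" using n by simp
      show "x \<notin> A k \<Longrightarrow> real n * c k x \<le> 0" by (auto simp: c_def A_def max_def)
    qed
    then have "real n * L (c k) \<le> measure riesz_measure (A k)" by (simp only: L_cmult[OF cc])
    then show ?thesis using n by (simp add: field_simps)
  qed
  have pt: "(\<Sum>k<n. indicator (A k) x / n) \<le> g x + 1/n" for x
  proof -
    have A_iff: "indicator (A k) x = (of_bool (real k < real n * g x) :: real)" for k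
      using n by (simp add: A_def indicator_def field_simps)
    \<comment> \<open>The sum counts the \<open>k\<close> below \<open>n g(x)\<close>; the extra 1
      allows for rounding.\<close>
    have "(\<Sum>k<m. indicator (A k) x) \<le> real n * g x + 1" for m
    proof (induction m)
      case (Suc m)
      have "(\<Sum>k<Suc m. indicator (A k) x) \<le> (\<Sum>k<Suc m. 1 :: real)"
        by (intro sum_mono) (simp add: indicator_def)
      then show ?case using Suc unfolding A_iff by (cases "real m < real n * g x") auto
    qed (use g in simp)
    from divide_right_mono[OF this[of n], of "real n"] show ?thesis
      using n by (simp add: sum_divide_distrib[symmetric] add_divide_distrib)
  qed
  have intA: "integrable riesz_measure (\<lambda>x. indicator (A k) x / real n)" for k
    using Am by (intro integrable_divide integrable_real_indicator) (auto simp: emeasure_eq_measure)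
  have "L g = (\<Sum>k<n. L (c k))" using L_sum[OF _ cc, of "{..<n}" "\<lambda>k. k"] layer_n by simp
  also have "\<dots> \<le> (\<Sum>k<n. measure riesz_measure (A k) / n)" by (intro sum_mono Lc)
  also have "\<dots> = (\<integral>x. (\<Sum>k<n. indicator (A k) x / n) \<partial>riesz_measure)"
    using Am sets_eq_imp_space_eq[OF sets_riesz_measure] by (subst Bochner_Integration.integral_sum) (auto intro: intA)
  also have "\<dots> \<le> (\<integral>x. g x + 1/n \<partial>riesz_measure)"
    using Am borel_prob_integrable[OF compact_UNIV riesz_measure_borel_prob g(1)]
    by (intro integral_mono pt) (auto intro!: Bochner_Integration.integrable_sum intA)
  also have "\<dots> = (\<integral>x. g x \<partial>riesz_measure) + 1/n"
    using borel_prob_integrable[OF compact_UNIV riesz_measure_borel_prob g(1)]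
    by (simp add: prob_space)
  finally show "L g \<le> (\<integral>x. g x \<partial>riesz_measure) + \<epsilon>" using n by simp
qed

text \<open>An affine change of scale extends the inequality from functions with values in
  \<open>[0, 1]\<close> to those with values in \<open>[-B, B]\<close>; applying it to
  \<open>-g\<close> gives the reverse.\<close>

theorem riesz_representation:
  assumes g: "continuous_on UNIV g"
  shows "(\<integral>x. g x \<partial>riesz_measure) = L g"
proof -
  interpret prob_space riesz_measure using riesz_measure_borel_prob by (simp add: space_prob_algebra)
  have int: "integrable riesz_measure h" if "continuous_on UNIV h" for h :: "'a \<Rightarrow> real"
    using that by (rule borel_prob_integrable[OF compact_UNIV riesz_measure_borel_prob])
  obtain B where B: "B > 0" "\<And>x. \<bar>g x\<bar> \<le> B" by (rule continuous_UNIV_bounded[OF compact_UNIV g]) blast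
  have 1: "L h \<le> (\<integral>x. h x \<partial>riesz_measure)" if h: "continuous_on UNIV h" "\<And>x. \<bar>h x\<bar> \<le> B" for h
  proof -
    let ?u = "\<lambda>x::'a. 1/(2*B) * h x + 1/2 :: real"
    have "L ?u \<le> (\<integral>x. ?u x \<partial>riesz_measure)"
    proof (rule L_le_integral_unit)
      show "continuous_on UNIV ?u" using h by (intro continuous_intros)
      fix x show "0 \<le> ?u x" "?u x \<le> 1" using h(2)[of x] B(1) by (auto simp: field_simps abs_le_iff)
    qed
    moreover have "L ?u = 1/(2*B) * L h + 1/2"
      using h by (subst L_add) (auto intro!: continuous_intros simp: L_const simp del: times_divide_eq_left simp: L_cmult)
    moreover have "(\<integral>x. ?u x \<partial>riesz_measure) = 1/(2*B) * (\<integral>x. h x \<partial>riesz_measure) + 1/2"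
      using int[OF h(1)] by (subst Bochner_Integration.integral_add) (auto simp: prob_space)
    ultimately show ?thesis using B(1) by (simp add: field_simps)
  qed
  have "L (\<lambda>x. -1 * g x) \<le> (\<integral>x. -1 * g x \<partial>riesz_measure)"
    by (rule 1) (use g B in \<open>auto intro!: continuous_intros\<close>)
  then have "(\<integral>x. g x \<partial>riesz_measure) \<le> L g" unfolding L_cmult[OF g] by simp
  with 1[OF g B(2)] show ?thesis by simp
qed

end

subsection \<open>Weak-star compactness\<close>

text \<open>The value 0 off the continuous functions makes the measure and its functional determine
  each other, and keeps the functional inside a product of compact sets.\<close>

definition integral_functional :: "'a::metric_space measure \<Rightarrow> ('a \<Rightarrow> real) \<Rightarrow> real" where
  "integral_functional M g = (if continuous_on UNIV g then \<integral>x. g x \<partial>M else 0)"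

definition riesz_functionals :: "(('a::metric_space \<Rightarrow> real) \<Rightarrow> real) set" where
  "riesz_functionals = {L. positive_functional L \<and> (\<forall>g. \<not> continuous_on UNIV g \<longrightarrow> L g = 0)}"

lemma integral_functional_mem:
  assumes c: "compact (UNIV :: 'a::metric_space set)" and M: "(M :: 'a measure) \<in> borel_probs"
  shows "integral_functional M \<in> riesz_functionals"
proof -
  interpret prob_space M using M by (simp add: space_prob_algebra)
  note int = borel_prob_integrable[OF c M]
  have "positive_functional (integral_functional M)"
    by unfold_locales
      (auto simp: integral_functional_def c int prob_space continuous_intros intro!: integral_nonneg)
  then show ?thesis by (simp add: riesz_functionals_def integral_functional_def)
qed

lemma riesz_functionals_bound:
  assumes "L \<in> riesz_functionals" "continuous_on UNIV g" "\<And>x. \<bar>g x\<bar> \<le> B"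
  shows "\<bar>L g\<bar> \<le> B"
proof -
  interpret positive_functional L using assms(1) by (simp add: riesz_functionals_def)
  have 1: "- B \<le> g x" "g x \<le> B" for x using assms(3)[of x] by (auto simp: abs_le_iff)
  have "L g \<le> B" using L_mono[OF assms(2) continuous_on_const 1(2)] by (simp add: L_const)
  moreover have "- B \<le> L g" using L_mono[OF continuous_on_const assms(2) 1(1)] by (simp add: L_const)
  ultimately show ?thesis by simp
qed

text \<open>Banach-Alaoglu by Tychonoff: linearity, positivity and normalization are closed
  conditions on finitely many coordinates at a time, inside a product of the intervals
  \<open>[-b g, b g]\<close>.\<close>

lemma compact_riesz_functionals:
  assumes c: "compact (UNIV :: 'a::metric_space set)"
  shows "compact (riesz_functionals :: (('a \<Rightarrow> real) \<Rightarrow> real) set)"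
proof -
  have "\<exists>B. continuous_on UNIV g \<longrightarrow> (\<forall>x. \<bar>g x\<bar> \<le> B)" for g :: "'a \<Rightarrow> real"
    using continuous_UNIV_bounded[OF c] by metis
  then obtain b where b: "\<And>(g :: 'a \<Rightarrow> real) x. continuous_on UNIV g \<Longrightarrow> \<bar>g x\<bar> \<le> b g" by metis
  let ?B = "PiE UNIV (\<lambda>g :: 'a \<Rightarrow> real. if continuous_on UNIV g then {- b g .. b g} else {0})"
  have "compactin (product_topology (\<lambda>_. euclideanreal) UNIV) ?B"
    unfolding compactin_PiE by auto
  then have cB: "compact ?B"
    by (simp add: euclidean_product_topology)
  have cont: "continuous_on UNIV (\<lambda>L :: ('a \<Rightarrow> real) \<Rightarrow> real. L g)" for g
    by (rule continuous_on_product_coordinates)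
  have eq: "riesz_functionals = {L :: ('a \<Rightarrow> real) \<Rightarrow> real.
     (\<forall>g h. continuous_on UNIV g \<longrightarrow> continuous_on UNIV h \<longrightarrow> L (\<lambda>x. g x + h x) = L g + L h) \<and>
     (\<forall>g c. continuous_on UNIV g \<longrightarrow> L (\<lambda>x. c * g x) = c * L g) \<and>
     (\<forall>g. continuous_on UNIV g \<longrightarrow> (\<forall>x. g x \<ge> 0) \<longrightarrow> 0 \<le> L g) \<and>
     L (\<lambda>_. 1) = 1 \<and> (\<forall>g. \<not> continuous_on UNIV g \<longrightarrow> L g = 0)}"
    using c by (auto simp: riesz_functionals_def positive_functional_def)
  have "closed (riesz_functionals :: (('a \<Rightarrow> real) \<Rightarrow> real) set)"
    unfolding eq
    by (intro closed_Collect_conj closed_Collect_all closed_Collect_imp open_Collect_const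
        closed_Collect_eq closed_Collect_le continuous_intros cont)
  moreover have "riesz_functionals \<subseteq> ?B"
    using riesz_functionals_bound[OF _ _ b] by (fastforce simp: riesz_functionals_def abs_le_iff minus_le_iff)
  ultimately have "compact (?B \<inter> riesz_functionals)" "?B \<inter> riesz_functionals = riesz_functionals"
    using compact_Int_closed[OF cB] by auto
  then show ?thesis by simp
qed

lemma integral_riesz_measure:
  assumes "L \<in> riesz_functionals"
  shows "positive_functional.riesz_measure L \<in> borel_probs"
    "integral_functional (positive_functional.riesz_measure L) = L"
proof -
  interpret positive_functional L using assms by (simp add: riesz_functionals_def)
  show "riesz_measure \<in> borel_probs" by (rule riesz_measure_borel_prob)
  show "integral_functional riesz_measure = L"
    using assms riesz_representation by (auto simp: integral_functional_def riesz_functionals_def)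
qed

text \<open>The filter \<open>F\<close>, finer than \<open>sequentially\<close>, replaces a
  convergent subsequence. The hypothesis asks for functionals and not for measures because it is
  applied to empirical averages.\<close>

lemma weak_star_cluster_point:
  assumes c: "compact (UNIV :: 'a::metric_space set)"
    and Ls: "\<And>n. positive_functional (Ls n :: ('a \<Rightarrow> real) \<Rightarrow> real)"
  obtains F M where "F \<noteq> bot" "F \<le> sequentially" "M \<in> borel_probs"
    "\<And>g. continuous_on UNIV g \<Longrightarrow> ((\<lambda>n. Ls n g) \<longlongrightarrow> (\<integral>x. g x \<partial>M)) F"
proof -
  define K where "K n g = (if continuous_on UNIV g then Ls n g else 0)" for n and g :: "'a \<Rightarrow> real"
  have K: "K n \<in> riesz_functionals" for n
  proof -
    interpret positive_functional "Ls n" by (rule Ls)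
    show ?thesis
      by (auto simp: riesz_functionals_def positive_functional_def K_def L_add L_cmult L_nonneg L_one c
          continuous_intros)
  qed
  let ?G = "filtermap K sequentially"
  have "?G \<noteq> bot" "eventually (\<lambda>L. L \<in> riesz_functionals) ?G"
    using K by (auto simp: filtermap_bot_iff eventually_filtermap)
  then obtain L where L: "L \<in> riesz_functionals" "inf (nhds L) ?G \<noteq> bot"
    using compact_riesz_functionals[OF c] unfolding compact_filter by blast
  \<comment> \<open>Indices \<open>n\<close> that are late and at which \<open>K n\<close> is near
    \<open>L\<close>; that such indices always exist is exactly the statement that \<open>L\<close>
    is a cluster point.\<close>
  define F where "F = inf sequentially (filtercomap K (nhds L))"
  have "F \<noteq> bot"
  proof
    assume "F = bot"
    then have "eventually (\<lambda>_. False) F" by simp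
    then obtain P Q where PQ: "eventually P sequentially" "eventually Q (nhds L)" "\<And>x. P x \<and> Q (K x) \<Longrightarrow> False"
      unfolding F_def eventually_inf eventually_filtercomap by metis
    have "eventually (\<lambda>y. \<not> Q y) ?G"
      unfolding eventually_filtermap using PQ(1) by eventually_elim (use PQ(3) in blast)
    with PQ(2) have "eventually (\<lambda>_. False) (inf (nhds L) ?G)"
      unfolding eventually_inf by blast
    with L(2) show False by (simp add: eventually_False)
  qed
  have "filterlim K (nhds L) F"
    unfolding F_def by (rule filterlim_mono[OF filterlim_filtercomap order_refl inf_le2])
  note KL = this
  have lim: "((\<lambda>n. K n g) \<longlongrightarrow> L g) F" for g
  proof -
    have "continuous_on UNIV (\<lambda>L :: ('a \<Rightarrow> real) \<Rightarrow> real. L g)" by (rule continuous_on_product_coordinates)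
    from continuous_on_tendsto_compose[OF this KL] show ?thesis by simp
  qed
  show ?thesis
  proof (rule that[OF \<open>F \<noteq> bot\<close>])
    show "F \<le> sequentially" unfolding F_def by simp
    show "positive_functional.riesz_measure L \<in> borel_probs" by (rule integral_riesz_measure[OF L(1)])
    fix g :: "'a \<Rightarrow> real" assume "continuous_on UNIV g"
    with lim[of g] fun_cong[OF integral_riesz_measure(2)[OF L(1)], of g]
    show "((\<lambda>n. Ls n g) \<longlongrightarrow> (\<integral>x. g x \<partial>positive_functional.riesz_measure L)) F"
      by (simp add: K_def integral_functional_def)
  qed
qed

lemma Union_weak_star_subbase:
  "\<Union> {{\<mu> \<in> borel_probs. integral\<^sup>L \<mu> g \<in> U} |g U. continuous_on UNIV (g :: 'a::metric_space \<Rightarrow> real) \<and> open U}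
    = borel_probs"
proof
  have "borel_probs \<in> {{\<mu> \<in> borel_probs. integral\<^sup>L \<mu> g \<in> U} |g U. continuous_on UNIV (g :: 'a \<Rightarrow> real) \<and> open U}"
    by (intro CollectI exI[of _ "\<lambda>_. 0::real"] exI[of _ UNIV]) simp
  then show "borel_probs \<subseteq> \<Union> {{\<mu> \<in> borel_probs. integral\<^sup>L \<mu> g \<in> U} |g U. continuous_on UNIV (g :: 'a \<Rightarrow> real) \<and> open U}"
    by (rule Union_upper)
qed blast

lemma topspace_weak_star: "topspace (weak_star_topology :: 'a::metric_space measure topology) = borel_probs"
  unfolding weak_star_topology_def topology_generated_by_topspace by (rule Union_weak_star_subbase)

text \<open>The Riesz map is continuous from functionals with coordinatewise convergence to
  measures, because the preimage of a subbasic set is a condition on one coordinate; the set in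
  question is the image of a compact one.\<close>

lemma compactin_weak_star:
  assumes c: "compact (UNIV :: 'a::metric_space set)" and C: "closed C"
  shows "compactin weak_star_topology {M :: 'a measure. M \<in> borel_probs \<and> integral_functional M \<in> C}"
proof -
  let ?K = "riesz_functionals \<inter> C"
  let ?R = "\<lambda>L :: ('a \<Rightarrow> real) \<Rightarrow> real. positive_functional.riesz_measure L"
  have "compact ?K" using compact_riesz_functionals[OF c] C by (rule compact_Int_closed)
  then have "compactin (top_of_set ?K) ?K" by (simp add: compactin_subtopology)
  moreover have "continuous_map (top_of_set ?K) weak_star_topology ?R"
    unfolding weak_star_topology_def continuous_on_generated_topo_iff
  proof (intro conjI allI impI)
    show "?R ` topspace (top_of_set ?K) \<subseteq> \<Union> {{\<mu> \<in> borel_probs. integral\<^sup>L \<mu> g \<in> U} |g U. continuous_on UNIV (g :: 'a \<Rightarrow> real) \<and> open U}"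
      unfolding Union_weak_star_subbase using integral_riesz_measure(1) by auto
    fix W assume "W \<in> {{\<mu> \<in> borel_probs. integral\<^sup>L \<mu> g \<in> U} |g U. continuous_on UNIV (g :: 'a \<Rightarrow> real) \<and> open U}"
    then obtain g :: "'a \<Rightarrow> real" and U where gU: "W = {\<mu> \<in> borel_probs. integral\<^sup>L \<mu> g \<in> U}" "continuous_on UNIV g" "open U"
      by (elim CollectE exE conjE)
    have "integral\<^sup>L (?R L) g = L g" if "L \<in> riesz_functionals" for L
      using fun_cong[OF integral_riesz_measure(2)[OF that], of g] gU(2) by (simp add: integral_functional_def)
    then have "?R -` W \<inter> topspace (top_of_set ?K) = ?K \<inter> (\<lambda>L. L g) -` U"
      using integral_riesz_measure(1) by (auto simp: gU(1))
    moreover have "openin (top_of_set ?K) (?K \<inter> (\<lambda>L. L g) -` U)"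
      using continuous_on_subset[OF continuous_on_product_coordinates] gU(3)
      by (intro continuous_openin_preimage_gen) auto
    ultimately show "openin (top_of_set ?K) (?R -` W \<inter> topspace (top_of_set ?K))" by simp
  qed
  ultimately have "compactin weak_star_topology (?R ` ?K)" by (rule image_compactin)
  moreover have "?R ` ?K = {M. M \<in> borel_probs \<and> integral_functional M \<in> C}"
  proof (intro equalityI subsetI)
    fix M assume "M \<in> ?R ` ?K"
    then obtain L where L: "M = ?R L" "L \<in> riesz_functionals" "L \<in> C" by auto
    then show "M \<in> {M. M \<in> borel_probs \<and> integral_functional M \<in> C}"
      using integral_riesz_measure(1)[OF L(2)] by (simp add: L(1) integral_riesz_measure(2)[OF L(2)])
  next
    fix M :: "'a measure" assume M: "M \<in> {M. M \<in> borel_probs \<and> integral_functional M \<in> C}"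
    let ?L = "integral_functional M"
    have L: "?L \<in> riesz_functionals" using integral_functional_mem[OF c] M by blast
    have "?R ?L = M"
    proof (rule borel_probs_eqI[OF c integral_riesz_measure(1)[OF L]])
      show "M \<in> borel_probs" using M by simp
      fix g :: "'a \<Rightarrow> real" assume "continuous_on UNIV g"
      then show "integral\<^sup>L (?R ?L) g = integral\<^sup>L M g"
        using fun_cong[OF integral_riesz_measure(2)[OF L], of g] by (simp add: integral_functional_def)
    qed
    then have "M = ?R ?L" by simp
    moreover have "?L \<in> ?K" using L M by simp
    ultimately show "M \<in> ?R ` ?K" unfolding image_iff by (rule bexI)
  qed
  ultimately show ?thesis by simp
qed

text \<open>Induction on the way an open set is generated from the subbase; filters allow finite
  intersections and arbitrary unions.\<close>

lemma limitin_weak_star: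
  assumes M: "M \<in> borel_probs" and Ms: "\<And>n. Ms n \<in> borel_probs"
    and lim: "\<And>g :: 'a::metric_space \<Rightarrow> real. continuous_on UNIV g \<Longrightarrow> ((\<lambda>n. \<integral>x. g x \<partial>Ms n) \<longlongrightarrow> (\<integral>x. g x \<partial>M)) F"
  shows "limitin weak_star_topology Ms M F"
  unfolding limitin_def topspace_weak_star
proof (intro conjI allI impI M)
  fix U :: "'a measure set" assume "openin weak_star_topology U \<and> M \<in> U"
  then have "generate_topology_on {{\<mu> \<in> borel_probs. integral\<^sup>L \<mu> g \<in> U} |g U. continuous_on UNIV (g :: 'a \<Rightarrow> real) \<and> open U} U" "M \<in> U"
    unfolding weak_star_topology_def openin_topology_generated_by_iff by auto
  then show "\<forall>\<^sub>F n in F. Ms n \<in> U"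
  proof (induction rule: generate_topology_on.induct)
    case Empty then show ?case by simp
  next
    case (Int a b) then show ?case by (auto intro: eventually_conj)
  next
    case (UN K)
    then obtain k where "k \<in> K" "M \<in> k" by blast
    with UN.IH have "\<forall>\<^sub>F n in F. Ms n \<in> k" by blast
    then show ?case by eventually_elim (use \<open>k \<in> K\<close> in blast)
  next
    case (Basis s)
    then obtain g :: "'a \<Rightarrow> real" and V where gV: "s = {\<mu> \<in> borel_probs. integral\<^sup>L \<mu> g \<in> V}" "continuous_on UNIV g" "open V"
      by (elim CollectE exE conjE)
    have "\<forall>\<^sub>F n in F. integral\<^sup>L (Ms n) g \<in> V"
      using topological_tendstoD[OF lim[OF gV(2)] gV(3)] Basis(2) unfolding gV(1) by blast
    then show ?case using Ms by (simp add: gV(1))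
  qed
qed

subsection \<open>Entropy of finite-valued random variables\<close>

text \<open>Entropy is attached to the fibres of a finite-valued map instead of to a partition:
  joins become pairs, coarser partitions become compositions, and monotonicity becomes data
  processing.\<close>

definition rv_entropy :: "'a measure \<Rightarrow> ('a \<Rightarrow> 'k) \<Rightarrow> real" where
  "rv_entropy M X = - (\<Sum>v\<in>range X. measure M (X -` {v}) * ln (measure M (X -` {v})))"

locale finite_rv_space = prob_space M for M :: "'a measure" +
  assumes space_UNIV: "space M = UNIV"
begin

lemma simple_iff: "simple_function M X \<longleftrightarrow> finite (range X) \<and> (\<forall>v. X -` {v} \<in> sets M)"
proof
  assume X: "simple_function M X"
  then show "finite (range X) \<and> (\<forall>v. X -` {v} \<in> sets M)"
    using simple_functionD[OF X] by (simp add: space_UNIV)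
qed (simp add: simple_function_def space_UNIV)

lemma information_space_exp: "information_space M (exp 1)"
  by (simp add: information_space_def prob_space_axioms information_space_axioms_def)

lemma rv_entropy_eq:
  assumes X: "simple_function M X"
  shows "rv_entropy M X = entropy (exp 1) (count_space (X ` space M)) X"
proof -
  interpret information_space M "exp 1" by (rule information_space_exp)
  have sd: "simple_distributed M X (\<lambda>v. measure M (X -` {v}))"
    by (rule simple_distributedI[OF X]) (auto simp: space_UNIV)
  show ?thesis
    unfolding entropy_simple_distributed[OF sd] rv_entropy_def by (simp add: space_UNIV log_def)
qed

lemma rv_entropy_nonneg: "0 \<le> rv_entropy M X"
proof -
  have "p * ln p \<le> 0" if "0 \<le> p" "p \<le> 1" for p :: real
    using that by (cases "p = 0") (auto intro!: mult_nonneg_nonpos)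
  then show ?thesis
    unfolding rv_entropy_def by (simp add: sum_nonpos)
qed

lemma rv_entropy_comp_le:
  assumes X: "simple_function M X"
  shows "rv_entropy M (\<lambda>x. h (X x)) \<le> rv_entropy M X"
proof -
  interpret information_space M "exp 1" by (rule information_space_exp)
  have hX: "simple_function M (h \<circ> X)" using X by (rule simple_function_compose)
  have "rv_entropy M (h \<circ> X) \<le> rv_entropy M X"
    unfolding rv_entropy_eq[OF X] rv_entropy_eq[OF hX] by (rule entropy_data_processing[OF X])
  then show ?thesis by (simp only: comp_def)
qed

lemma sum_marginal:
  assumes X: "simple_function M X"
  shows "(\<Sum>v\<in>range X. measure M (X -` {v}) * \<phi> (h v)) =
    (\<Sum>w\<in>range (\<lambda>x. h (X x)). measure M ((\<lambda>x. h (X x)) -` {w}) * (\<phi> w :: real))"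
proof -
  have fin: "finite (range X)" and m: "\<And>v. X -` {v} \<in> sets M" using X by (auto simp: simple_iff)
  have P: "measure M ((\<lambda>x. h (X x)) -` {w}) = (\<Sum>v\<in>{v\<in>range X. h v = w}. measure M (X -` {v}))" for w
  proof -
    have "(\<lambda>x. h (X x)) -` {w} = (\<Union>v\<in>{v\<in>range X. h v = w}. X -` {v})" by auto
    then show ?thesis
      using fin m by (simp add: finite_measure_finite_Union disjoint_family_on_def)
        (subst finite_measure_finite_Union, auto simp: disjoint_family_on_def)
  qed
  have "(\<Sum>w\<in>range (\<lambda>x. h (X x)). measure M ((\<lambda>x. h (X x)) -` {w}) * \<phi> w) =
    (\<Sum>w\<in>range (\<lambda>x. h (X x)). \<Sum>v\<in>{v\<in>range X. h v = w}. measure M (X -` {v}) * \<phi> (h v))"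
    unfolding P sum_distrib_right by (intro sum.cong) auto
  also have "\<dots> = (\<Sum>v\<in>range X. measure M (X -` {v}) * \<phi> (h v))"
  proof (rule sum.group)
    show "finite (range (\<lambda>x. h (X x)))"
      using finite_imageI[OF fin, of h] by (simp add: image_image)
  qed (use fin in auto)
  finally show ?thesis by simp
qed

lemma rv_entropy_pair_le:
  assumes X: "simple_function M X" and Y: "simple_function M Y"
  shows "rv_entropy M (\<lambda>x. (X x, Y x)) \<le> rv_entropy M X + rv_entropy M Y"
proof -
  interpret information_space M "exp 1" by (rule information_space_exp)
  have XY: "simple_function M (\<lambda>x. (X x, Y x))" using X Y by (rule simple_function_Pair)
  show ?thesis
    unfolding rv_entropy_eq[OF X] rv_entropy_eq[OF Y] rv_entropy_eq[OF XY]
    using entropy_chain_rule[OF X Y] conditional_entropy_less_eq_entropy[OF Y X] by simp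
qed

text \<open>Nonnegativity of the conditional mutual information of \<open>X\<close> and
  \<open>Y\<close> given \<open>Z\<close>, expanded into joint entropies. The logarithm of the
  quotient splits because every marginal is at least \<open>p t\<close>, hence positive where
  \<open>p t\<close> is.\<close>

lemma rv_entropy_submodular:
  assumes X: "simple_function M X" and Y: "simple_function M Y" and Z: "simple_function M Z"
  shows "rv_entropy M (\<lambda>x. (X x, Y x, Z x)) + rv_entropy M Z
    \<le> rv_entropy M (\<lambda>x. (X x, Z x)) + rv_entropy M (\<lambda>x. (Y x, Z x))"
proof -
  interpret information_space M "exp 1" by (rule information_space_exp)
  have XZ: "simple_function M (\<lambda>x. (X x, Z x))" using X Z by (rule simple_function_Pair)
  have YZ: "simple_function M (\<lambda>x. (Y x, Z x))" using Y Z by (rule simple_function_Pair)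
  have T: "simple_function M (\<lambda>x. (X x, Y x, Z x))" using X YZ by (rule simple_function_Pair)
  let ?T = "\<lambda>x. (X x, Y x, Z x)"
  define p where "p t = measure M (?T -` {t})" for t
  define pz where "pz z = measure M (Z -` {z})" for z
  define pxz where "pxz t = measure M ((\<lambda>x. (X x, Z x)) -` {t})" for t
  define pyz where "pyz t = measure M ((\<lambda>x. (Y x, Z x)) -` {t})" for t
  have sd: "simple_distributed M Z pz" "simple_distributed M (\<lambda>x. (Y x, Z x)) pyz"
     "simple_distributed M (\<lambda>x. (X x, Z x)) pxz" "simple_distributed M ?T p"
    by (rule simple_distributedI[OF Z] simple_distributedI[OF YZ] simple_distributedI[OF XZ] simple_distributedI[OF T];
        simp add: pz_def pyz_def pxz_def p_def space_UNIV)+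
  have meas: "\<And>v. (?T -` {v}) \<in> sets M" "\<And>v. Z -` {v} \<in> sets M" "\<And>v. (\<lambda>x. (X x, Z x)) -` {v} \<in> sets M"
    "\<And>v. (\<lambda>x. (Y x, Z x)) -` {v} \<in> sets M"
    using T Z XZ YZ by (auto simp: simple_iff)
  have summand: "p t * log (exp 1) (p t / (pxz (fst t, snd (snd t)) * (pyz (snd t) / pz (snd (snd t)))))
     = p t * ln (p t) - p t * ln (pxz (fst t, snd (snd t))) - p t * ln (pyz (snd t)) + p t * ln (pz (snd (snd t)))" for t
  proof (cases "p t = 0")
    case False
    then have 0: "p t > 0" by (simp add: p_def zero_less_measure_iff)
    have 1: "p t \<le> pz (snd (snd t))" "p t \<le> pxz (fst t, snd (snd t))" "p t \<le> pyz (snd t)"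
      unfolding p_def pz_def pxz_def pyz_def by (auto intro!: finite_measure_mono meas)
    then show ?thesis using 0
      by (simp add: log_def ln_div ln_mult algebra_simps)
  qed simp
  have "0 \<le> (\<Sum>t\<in>range ?T. p t * log (exp 1) (p t / (pxz (fst t, snd (snd t)) * (pyz (snd t) / pz (snd (snd t))))))"
    using conditional_mutual_information_nonneg[OF X Y Z] conditional_mutual_information_eq[OF sd]
    by (simp add: space_UNIV case_prod_beta)
  also have "\<dots> = (\<Sum>t\<in>range ?T. p t * ln (p t)) - (\<Sum>t\<in>range ?T. p t * ln (pxz (fst t, snd (snd t))))
     - (\<Sum>t\<in>range ?T. p t * ln (pyz (snd t))) + (\<Sum>t\<in>range ?T. p t * ln (pz (snd (snd t))))"
    unfolding summand by (simp add: sum.distrib sum_subtractf)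
  also have "(\<Sum>t\<in>range ?T. p t * ln (p t)) = - rv_entropy M ?T"
    by (simp add: rv_entropy_def p_def)
  also have "(\<Sum>t\<in>range ?T. p t * ln (pxz (fst t, snd (snd t)))) = - rv_entropy M (\<lambda>x. (X x, Z x))"
    using sum_marginal[OF T, of "\<lambda>v. ln (pxz v)" "\<lambda>t. (fst t, snd (snd t))"]
    by (simp add: rv_entropy_def p_def pxz_def)
  also have "(\<Sum>t\<in>range ?T. p t * ln (pyz (snd t))) = - rv_entropy M (\<lambda>x. (Y x, Z x))"
    using sum_marginal[OF T, of "\<lambda>v. ln (pyz v)" "\<lambda>t. snd t"]
    by (simp add: rv_entropy_def p_def pyz_def)
  also have "(\<Sum>t\<in>range ?T. p t * ln (pz (snd (snd t)))) = - rv_entropy M Z"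
    using sum_marginal[OF T, of "\<lambda>v. ln (pz v)" "\<lambda>t. snd (snd t)"]
    by (simp add: rv_entropy_def p_def pz_def)
  finally show ?thesis by simp
qed

lemma sum_prob_range: "simple_function M X \<Longrightarrow> (\<Sum>v\<in>range X. measure M (X -` {v})) = 1"
  using sum_marginal[where X=X and \<phi>="\<lambda>_. 1" and h="\<lambda>_. 0::nat"] prob_space
  by (simp add: space_UNIV vimage_const)

text \<open>Apply \<open>ln s \<le> s - 1\<close> to the ratio of the Gibbs weight
  \<open>exp (\<alpha> v) / Z\<close> to the probability of \<open>v\<close>, and average.\<close>

lemma gibbs_inequality:
  assumes X: "simple_function M X"
  shows "rv_entropy M X + (\<Sum>v\<in>range X. measure M (X -` {v}) * \<alpha> v) \<le> ln (\<Sum>v\<in>range X. exp (\<alpha> v))"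
proof -
  have fin: "finite (range X)" using X by (simp add: simple_iff)
  define p where "p v = measure M (X -` {v})" for v
  define Z where "Z = (\<Sum>v\<in>range X. exp (\<alpha> v))"
  have Z: "Z > 0" unfolding Z_def using fin by (intro sum_pos) auto
  have 1: "p v * \<alpha> v - p v * ln (p v) \<le> exp (\<alpha> v) / Z - p v + p v * ln Z" for v
  proof (cases "p v = 0")
    case True then show ?thesis using Z by simp
  next
    case False
    then have p: "p v > 0" by (simp add: p_def zero_less_measure_iff)
    have "ln (exp (\<alpha> v) / Z / p v) \<le> exp (\<alpha> v) / Z / p v - 1"
      using p Z by (intro ln_le_minus_one) simp
    then have "p v * ln (exp (\<alpha> v) / Z / p v) \<le> p v * (exp (\<alpha> v) / Z / p v - 1)"
      using p by (intro mult_left_mono) auto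
    also have "\<dots> = exp (\<alpha> v) / Z - p v" using p by (simp add: field_simps)
    also have "ln (exp (\<alpha> v) / Z / p v) = \<alpha> v - ln Z - ln (p v)" using p Z by (simp add: ln_div ln_mult)
    finally show ?thesis by (simp add: algebra_simps)
  qed
  have "rv_entropy M X + (\<Sum>v\<in>range X. p v * \<alpha> v) = (\<Sum>v\<in>range X. p v * \<alpha> v - p v * ln (p v))"
    by (simp add: rv_entropy_def p_def sum_subtractf)
  also have "\<dots> \<le> (\<Sum>v\<in>range X. exp (\<alpha> v) / Z - p v + p v * ln Z)" by (intro sum_mono 1)
  also have "\<dots> = (\<Sum>v\<in>range X. exp (\<alpha> v)) / Z - (\<Sum>v\<in>range X. p v) + (\<Sum>v\<in>range X. p v) * ln Z"
    by (simp add: sum.distrib sum_subtractf sum_divide_distrib sum_distrib_right)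
  also have "\<dots> = ln Z" using sum_prob_range[OF X] Z by (simp add: p_def Z_def)
  finally show ?thesis by (simp add: Z_def p_def)
qed

lemma rv_entropy_le_card: "simple_function M X \<Longrightarrow> rv_entropy M X \<le> ln (card (range X))"
  using gibbs_inequality[of X "\<lambda>_. 0"] by simp

end

subsection \<open>Itineraries\<close>

text \<open>The set of times is arbitrary, so that unions and shifts of blocks can be handled;
  \<open>restrict\<close> makes names with the same symbols on \<open>I\<close> equal.\<close>

definition itinerary :: "('a \<Rightarrow> 'a) \<Rightarrow> ('a \<Rightarrow> 'k) \<Rightarrow> nat set \<Rightarrow> 'a \<Rightarrow> nat \<Rightarrow> 'k" where
  "itinerary f X I x = (\<lambda>i\<in>I. X ((f ^^ i) x))"

lemma itinerary_eq_iff: "itinerary f X I x = itinerary f X I y \<longleftrightarrow> (\<forall>i\<in>I. X ((f ^^ i) x) = X ((f ^^ i) y))"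
  by (auto simp: itinerary_def fun_eq_iff restrict_def)

context finite_rv_space
begin

lemma simple_itinerary:
  assumes "finite I" "\<And>i. i \<in> I \<Longrightarrow> simple_function M (\<lambda>x. X ((f ^^ i) x))"
  shows "simple_function M (itinerary f X I)"
  using assms
proof (induction I rule: finite_induct)
  case empty
  have "itinerary f X {} = (\<lambda>_ _. undefined)" by (simp add: itinerary_def fun_eq_iff)
  then show ?case by simp
next
  case (insert i I)
  let ?h = "\<lambda>(v, a) j. if j = i then v else a j"
  have "itinerary f X (insert i I) = ?h \<circ> (\<lambda>x. (X ((f ^^ i) x), itinerary f X I x))"
    by (auto simp: itinerary_def fun_eq_iff restrict_def)
  moreover have "simple_function M (\<lambda>x. (X ((f ^^ i) x), itinerary f X I x))"
    using insert by (intro simple_function_Pair) auto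
  ultimately show ?case by (simp only: simple_function_compose)
qed

lemma rv_entropy_itinerary_mono:
  assumes "finite J" "\<And>i. i \<in> J \<Longrightarrow> simple_function M (\<lambda>x. X ((f ^^ i) x))" "I \<subseteq> J"
  shows "rv_entropy M (itinerary f X I) \<le> rv_entropy M (itinerary f X J)"
proof -
  have "itinerary f X I = (\<lambda>x. restrict (itinerary f X J x) I)"
    using assms(3) by (auto simp: itinerary_def fun_eq_iff restrict_def)
  then show ?thesis
    using rv_entropy_comp_le[OF simple_itinerary[OF assms(1,2)], of "\<lambda>a. restrict a I"] by simp
qed

lemma rv_entropy_itinerary_Un:
  assumes "finite I" "finite J" "\<And>i. i \<in> I \<union> J \<Longrightarrow> simple_function M (\<lambda>x. X ((f ^^ i) x))"
  shows "rv_entropy M (itinerary f X (I \<union> J)) \<le> rv_entropy M (itinerary f X I) + rv_entropy M (itinerary f X J)"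
proof -
  have I: "simple_function M (itinerary f X I)" and J: "simple_function M (itinerary f X J)"
    using assms by (auto intro!: simple_itinerary)
  let ?h = "\<lambda>(a,b) i. if i \<in> I then a i else b i"
  have "itinerary f X (I \<union> J) = (\<lambda>x. ?h (itinerary f X I x, itinerary f X J x))"
    by (auto simp: itinerary_def fun_eq_iff restrict_def)
  then show ?thesis
    using rv_entropy_comp_le[OF simple_function_Pair[OF I J], of ?h] rv_entropy_pair_le[OF I J] by simp
qed

lemma rv_entropy_itinerary_UN:
  assumes "finite A" "\<And>a. a \<in> A \<Longrightarrow> finite (I a)"
    "\<And>i. simple_function M (\<lambda>x. X ((f ^^ i) x))"
  shows "rv_entropy M (itinerary f X (\<Union>a\<in>A. I a)) \<le> (\<Sum>a\<in>A. rv_entropy M (itinerary f X (I a)))"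
  using assms(1,2)
proof (induction A rule: finite_induct)
  case empty
  have "itinerary f X {} = (\<lambda>_ _. undefined)" by (simp add: itinerary_def fun_eq_iff)
  then show ?case using prob_space by (simp add: rv_entropy_def space_UNIV)
next
  case (insert a A)
  have "rv_entropy M (itinerary f X (I a \<union> (\<Union>a\<in>A. I a)))
     \<le> rv_entropy M (itinerary f X (I a)) + rv_entropy M (itinerary f X (\<Union>a\<in>A. I a))"
    using insert by (intro rv_entropy_itinerary_Un assms(3)) auto
  then show ?case using insert by simp
qed

text \<open>Both sides carry the same symbols with relabelled times, so data processing in each
  direction gives equality. Invariance of the measure does not enter: the lemma also serves the
  non-invariant weights on separated sets.\<close>

lemma rv_entropy_itinerary_shift:
  assumes "finite I" "\<And>i. simple_function M (\<lambda>x. X ((f ^^ i) x))"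
  shows "rv_entropy M (itinerary f X ((+) j ` I)) = rv_entropy M (\<lambda>x. itinerary f X I ((f ^^ j) x))"
proof (rule antisym)
  let ?s = "\<lambda>a. (\<lambda>i\<in>(+) j ` I. a (i - j))" and ?t = "\<lambda>a. (\<lambda>i\<in>I. a (j + i))"
  have c: "(f ^^ (j + i)) x = (f ^^ i) ((f ^^ j) x)" for i x
    by (simp add: funpow_add add.commute[of j i] del: funpow.simps)
  have s: "itinerary f X ((+) j ` I) = (\<lambda>x. ?s (itinerary f X I ((f ^^ j) x)))"
    and t: "(\<lambda>x. itinerary f X I ((f ^^ j) x)) = (\<lambda>x. ?t (itinerary f X ((+) j ` I) x))"
    by (auto simp: itinerary_def fun_eq_iff restrict_def c)
  have J: "simple_function M (itinerary f X ((+) j ` I))" using assms by (intro simple_itinerary) auto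
  have I: "simple_function M (\<lambda>x. itinerary f X I ((f ^^ j) x))"
    unfolding t using simple_function_compose[OF J, of ?t] by (simp add: comp_def)
  show "rv_entropy M (itinerary f X ((+) j ` I)) \<le> rv_entropy M (\<lambda>x. itinerary f X I ((f ^^ j) x))"
    using rv_entropy_comp_le[OF I, of ?s] s by simp
  show "rv_entropy M (\<lambda>x. itinerary f X I ((f ^^ j) x)) \<le> rv_entropy M (itinerary f X ((+) j ` I))"
    using rv_entropy_comp_le[OF J, of ?t] t by simp
qed

lemma rv_entropy_itinerary_comp_le:
  assumes "finite I" "\<And>i. simple_function M (\<lambda>x. X ((f ^^ i) x))"
  shows "rv_entropy M (itinerary f (\<lambda>x. h (X x)) I) \<le> rv_entropy M (itinerary f X I)"
proof -
  have "itinerary f (\<lambda>x. h (X x)) I = (\<lambda>x. (\<lambda>a. \<lambda>i\<in>I. h (a i)) (itinerary f X I x))"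
    by (auto simp: itinerary_def fun_eq_iff restrict_def)
  then show ?thesis
    using rv_entropy_comp_le[OF simple_itinerary[OF assms], of "\<lambda>a. \<lambda>i\<in>I. h (a i)"] by simp
qed

end

text \<open>Fekete's argument: write \<open>n = k m + r\<close> with \<open>r < m\<close>, for an
  \<open>m\<close> at which \<open>a m / m\<close> is nearly the infimum; the remainder costs at
  most the constant \<open>C\<close>.\<close>

lemma subadditive_converges:
  fixes a :: "nat \<Rightarrow> real"
  assumes nn: "\<And>n. 0 \<le> a n" and sub: "\<And>m n. a (m + n) \<le> a m + a n"
  shows "convergent (\<lambda>n. a n / real n)"
proof -
  define l where "l = (INF n\<in>{1..}. a n / real n)"
  have bdd: "bdd_below ((\<lambda>n. a n / real n) ` {1..})" using nn by (intro bdd_belowI[of _ 0]) auto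
  \<comment> \<open>The case \<open>k = 0\<close> would say \<open>a 0 \<le> 0\<close>, which is not
    assumed.\<close>
  have mult: "a (k * n) \<le> real k * a n" if "k \<ge> 1" for k n
    using that
  proof (induction k rule: dec_induct)
    case (step k) then show ?case using sub[of n "k * n"] by (simp add: algebra_simps)
  qed simp
  have "(\<lambda>n. a n / real n) \<longlonglongrightarrow> l"
  proof (rule LIMSEQ_I)
    fix r :: real assume r: "r > 0"
    then have "l < l + r/2" by simp
    then obtain m where m: "m \<ge> 1" "a m / real m < l + r/2"
      unfolding l_def using bdd by (subst (asm) cINF_less_iff) auto
    define C where "C = (\<Sum>j<m. a j)"
    have C: "a j \<le> C" if "j < m" for j unfolding C_def using that nn by (intro member_le_sum) auto
    obtain N where N: "real N > 2 * C / r" using reals_Archimedean2 by blast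
    show "\<exists>no. \<forall>n\<ge>no. norm (a n / real n - l) < r"
    proof (intro exI allI impI)
      fix n assume n: "n \<ge> max (Suc N) m"
      then have n0: "n \<ge> 1" using m by simp
      have lower: "l \<le> a n / real n" unfolding l_def using bdd n0 by (intro cINF_lower) auto
      define k where "k = n div m"
      have k: "k \<ge> 1" unfolding k_def using n m by (simp add: div_greater_zero_iff Suc_le_eq)
      have "a n \<le> a (k * m) + a (n mod m)" using sub[of "k * m" "n mod m"] by (simp add: k_def)
      also have "\<dots> \<le> real k * a m + C"
        using mult[OF k] C[of "n mod m"] m by (intro add_mono) auto
      finally have "a n / real n \<le> real k * a m / real n + C / real n"
        using n0 by (simp add: divide_right_mono add_divide_distrib[symmetric])
      moreover have "real k * a m / real n \<le> a m / real m"
      proof -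
        have "real k * real m \<le> real n" unfolding k_def by (metis of_nat_le_iff of_nat_mult div_times_less_eq_dividend)
        then have "real k * real m * a m \<le> real n * a m" using nn by (intro mult_right_mono)
        then show ?thesis using n0 m by (simp add: field_simps)
      qed
      moreover have "C / real n < r / 2"
      proof -
        have "2 * C / r < real n" using N n by simp
        then show ?thesis using r n0 by (simp add: field_simps)
      qed
      ultimately have "a n / real n < l + r" using m(2) by linarith
      with lower show "norm (a n / real n - l) < r" by simp
    qed
  qed
  then show ?thesis by (auto simp: convergent_def)
qed

subsection \<open>Entropy of an invariant measure through finite-valued processes\<close>

lemma vimage_singleton_empty:
  assumes "v \<notin> range g"
  shows "g -` {v} = {}"
proof (rule equals0I)
  fix x assume "x \<in> g -` {v}"
  then have "v = g x" by simp
  with assms show False by simp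
qed

lemma measurable_funpow: "f \<in> M \<rightarrow>\<^sub>M M \<Longrightarrow> f ^^ i \<in> M \<rightarrow>\<^sub>M M"
  by (induction i) (auto intro: measurable_comp)

locale invariant_measure =
  fixes f :: "'a::topological_space \<Rightarrow> 'a" and M :: "'a measure"
  assumes f_measurable: "f \<in> borel \<rightarrow>\<^sub>M borel" and invariant: "M \<in> invariant_probs f"
begin

lemma borel_prob: "M \<in> borel_probs" and distr_eq: "distr M borel f = M"
  using invariant by (auto simp: invariant_probs_def)

lemma sets_eq: "sets M = sets borel"
  using borel_prob by (simp add: space_prob_algebra)

sublocale finite_rv_space M
proof -
  interpret prob_space M using borel_prob by (simp add: space_prob_algebra)
  show "finite_rv_space M"
    by unfold_locales (use sets_eq_imp_space_eq[OF sets_eq] in simp)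
qed

lemma funpow_measurable: "f ^^ i \<in> borel \<rightarrow>\<^sub>M borel"
  using f_measurable by (rule measurable_funpow)

lemma funpow_measurable': "f ^^ i \<in> M \<rightarrow>\<^sub>M borel"
  using funpow_measurable by (simp cong: measurable_cong_sets add: sets_eq)

lemma distr_funpow: "distr M borel (f ^^ i) = M"
proof (induction i)
  case 0
  show ?case
    by (rule measure_eqI) (auto simp: sets_eq emeasure_distr measurable_ident_sets space_UNIV)
next
  case (Suc i)
  have "distr M borel (f \<circ> f ^^ i) = distr (distr M borel (f ^^ i)) borel f"
    using f_measurable funpow_measurable' by (intro distr_distr[symmetric])
  then show ?case by (simp add: Suc distr_eq comp_def)
qed

lemma measure_funpow_vimage:
  assumes "A \<in> sets borel"
  shows "measure M ((f ^^ i) -` A) = measure M A"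
proof -
  have "measure (distr M borel (f ^^ i)) A = measure M ((f ^^ i) -` A)"
    using funpow_measurable' assms by (subst measure_distr) (auto simp: space_UNIV)
  then show ?thesis by (simp add: distr_funpow)
qed

lemma invariant_measure_funpow: "invariant_measure (f ^^ i) M"
  by unfold_locales (simp_all add: funpow_measurable invariant_probs_def borel_prob distr_funpow)

lemma simple_funpow:
  assumes X: "simple_function M X"
  shows "simple_function M (\<lambda>x. X ((f ^^ i) x))"
proof -
  have "finite (range (\<lambda>x. X ((f ^^ i) x)))"
    by (rule finite_subset[of _ "range X"]) (use X simple_iff in auto)
  moreover have "(\<lambda>x. X ((f ^^ i) x)) -` {v} \<in> sets M" for v
  proof -
    have "(\<lambda>x. X ((f ^^ i) x)) -` {v} = (f ^^ i) -` (X -` {v}) \<inter> space M"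
      by (auto simp: space_UNIV)
    then show ?thesis
      using X measurable_sets[OF funpow_measurable'] by (simp add: simple_iff sets_eq)
  qed
  ultimately show ?thesis by (simp add: simple_iff)
qed

lemma rv_entropy_funpow:
  assumes X: "simple_function M X"
  shows "rv_entropy M (\<lambda>x. X ((f ^^ i) x)) = rv_entropy M X"
proof -
  have eq: "measure M ((\<lambda>x. X ((f ^^ i) x)) -` {v}) = measure M (X -` {v})" for v
  proof -
    have "(\<lambda>x. X ((f ^^ i) x)) -` {v} = (f ^^ i) -` (X -` {v})" by auto
    then show ?thesis using X by (simp add: measure_funpow_vimage simple_iff sets_eq)
  qed
  have "(\<Sum>v\<in>range (\<lambda>x. X ((f ^^ i) x)). measure M (X -` {v}) * ln (measure M (X -` {v}))) =
     (\<Sum>v\<in>range X. measure M (X -` {v}) * ln (measure M (X -` {v})))"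
  proof (rule sum.mono_neutral_left)
    show "finite (range X)" using X by (simp add: simple_iff)
    show "\<forall>v\<in>range X - range (\<lambda>x. X ((f ^^ i) x)). measure M (X -` {v}) * ln (measure M (X -` {v})) = 0"
    proof
      fix v assume "v \<in> range X - range (\<lambda>x. X ((f ^^ i) x))"
      then have "(\<lambda>x. X ((f ^^ i) x)) -` {v} = {}" by (intro vimage_singleton_empty) simp
      then show "measure M (X -` {v}) * ln (measure M (X -` {v})) = 0" using eq[of v] by simp
    qed
  qed auto
  then show ?thesis by (simp add: rv_entropy_def eq)
qed

definition process_rate :: "('a \<Rightarrow> 'k) \<Rightarrow> real" where
  "process_rate X = lim (\<lambda>n. rv_entropy M (itinerary f X {..<n}) / real n)"

text \<open>A block of length \<open>m + n\<close> is a block of length \<open>m\<close> followed by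
  a shifted block of length \<open>n\<close>; invariance removes the shift, which gives
  subadditivity.\<close>

lemma process_rate_tendsto:
  assumes X: "simple_function M X"
  shows "(\<lambda>n. rv_entropy M (itinerary f X {..<n}) / real n) \<longlonglongrightarrow> process_rate X"
proof -
  have "rv_entropy M (itinerary f X {..<m + n}) \<le> rv_entropy M (itinerary f X {..<m}) + rv_entropy M (itinerary f X {..<n})" for m n
  proof -
    have "x \<in> {..<m} \<union> (+) m ` {..<n}" if "x < m + n" for x
      using that by (cases "x < m") (auto intro!: image_eqI[of _ _ "x - m"])
    then have "{..<m + n} = {..<m} \<union> (+) m ` {..<n}" by auto
    then have "rv_entropy M (itinerary f X {..<m + n}) \<le>
       rv_entropy M (itinerary f X {..<m}) + rv_entropy M (itinerary f X ((+) m ` {..<n}))"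
      using rv_entropy_itinerary_Un[of "{..<m}" "(+) m ` {..<n}" X f] simple_funpow[OF X] by simp
    also have "rv_entropy M (itinerary f X ((+) m ` {..<n})) = rv_entropy M (\<lambda>x. itinerary f X {..<n} ((f ^^ m) x))"
      using simple_funpow[OF X] by (intro rv_entropy_itinerary_shift) auto
    also have "\<dots> = rv_entropy M (itinerary f X {..<n})"
      using simple_funpow[OF X] by (intro rv_entropy_funpow simple_itinerary) auto
    finally show ?thesis .
  qed
  then have "convergent (\<lambda>n. rv_entropy M (itinerary f X {..<n}) / real n)"
    by (intro subadditive_converges rv_entropy_nonneg)
  then show ?thesis by (simp add: process_rate_def convergent_LIMSEQ_iff)
qed

lemma process_rate_nonneg: "simple_function M X \<Longrightarrow> 0 \<le> process_rate X"
  by (rule LIMSEQ_le_const[OF process_rate_tendsto])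
    (auto intro!: exI[of _ 0] divide_nonneg_nonneg rv_entropy_nonneg)

end

section \<open>Finite Borel partitions as finite-valued processes\<close>

definition cell :: "'a set set \<Rightarrow> 'a \<Rightarrow> 'a set" where
  "cell \<xi> x = (THE A. A \<in> \<xi> \<and> x \<in> A)"

lemma cell_eq:
  assumes "partition_on UNIV \<xi>"
  shows "cell \<xi> x \<in> \<xi>" "x \<in> cell \<xi> x" "A \<in> \<xi> \<Longrightarrow> x \<in> A \<longleftrightarrow> cell \<xi> x = A"
proof -
  have U: "\<Union>\<xi> = UNIV" and d: "\<And>A B. A \<in> \<xi> \<Longrightarrow> B \<in> \<xi> \<Longrightarrow> x \<in> A \<Longrightarrow> x \<in> B \<Longrightarrow> A = B" for x
    using assms by (auto simp: partition_on_def disjoint_def)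
  have "x \<in> \<Union>\<xi>" using U by simp
  then obtain B where B: "B \<in> \<xi>" "x \<in> B" by (rule UnionE)
  have "\<exists>!A. A \<in> \<xi> \<and> x \<in> A"
  proof (rule ex1I[of _ B])
    show "B \<in> \<xi> \<and> x \<in> B" using B by simp
    fix A assume "A \<in> \<xi> \<and> x \<in> A"
    then show "A = B" using d[OF _ B(1) _ B(2)] by simp
  qed
  from theI'[OF this] show c: "cell \<xi> x \<in> \<xi>" "x \<in> cell \<xi> x" by (simp_all add: cell_def)
  show "x \<in> A \<longleftrightarrow> cell \<xi> x = A" if "A \<in> \<xi>"
    using c(2) d[OF c(1) that c(2)] by metis
qed

text \<open>Prescribing the cells visited at the times below \<open>n\<close> prescribes an
  intersection, and the nonempty intersections are exactly the fibres over names that occur. Hence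
  removing \<open>{}\<close> in the definition of the join matches ranging over occurring
  names.\<close>

lemma iterated_join_eq:
  assumes "partition_on UNIV \<xi>"
  shows "iterated_join f \<xi> n = (\<lambda>v. itinerary f (cell \<xi>) {..<n} -` {v}) ` range (itinerary f (cell \<xi>) {..<n})"
proof -
  let ?Y = "itinerary f (cell \<xi>) {..<n}"
  have fib: "?Y -` {?Y x} = (\<Inter>i<n. (f ^^ i) -` A i)"
    if "\<forall>i<n. A i \<in> \<xi>" "x \<in> (\<Inter>i<n. (f ^^ i) -` A i)" for A x
  proof -
    have c: "(f ^^ i) y \<in> A i \<longleftrightarrow> cell \<xi> ((f ^^ i) y) = A i" if "i < n" for i y
      using \<open>\<forall>i<n. A i \<in> \<xi>\<close> that by (intro cell_eq(3)[OF assms]) simp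
    have "cell \<xi> ((f ^^ i) x) = A i" if "i < n" for i
      using \<open>x \<in> _\<close> c[OF that, of x] that by simp
    then show ?thesis by (intro set_eqI) (simp add: itinerary_eq_iff c)
  qed
  show ?thesis
  proof (intro equalityI subsetI)
    fix S assume "S \<in> iterated_join f \<xi> n"
    then obtain A x where A: "\<forall>i<n. A i \<in> \<xi>" "S = (\<Inter>i<n. (f ^^ i) -` A i)" "x \<in> S"
      unfolding iterated_join_def by auto
    then have "S = ?Y -` {?Y x}" using fib[of A x] by simp
    then show "S \<in> (\<lambda>v. ?Y -` {v}) ` range ?Y" by blast
  next
    fix S assume "S \<in> (\<lambda>v. ?Y -` {v}) ` range ?Y"
    then obtain x where x: "S = ?Y -` {?Y x}" by blast
    define A where "A i = cell \<xi> ((f ^^ i) x)" for i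
    have 1: "\<forall>i<n. A i \<in> \<xi>" and 2: "x \<in> (\<Inter>i<n. (f ^^ i) -` A i)"
      using cell_eq(1,2)[OF assms] by (auto simp: A_def)
    from fib[OF this] x have "S = (\<Inter>i<n. (f ^^ i) -` A i)" by simp
    with 1 2 show "S \<in> iterated_join f \<xi> n" unfolding iterated_join_def by blast
  qed
qed

lemma partition_entropy_iterated_join:
  assumes "partition_on UNIV \<xi>"
  shows "partition_entropy M (iterated_join f \<xi> n) = rv_entropy M (itinerary f (cell \<xi>) {..<n})"
proof -
  let ?Y = "itinerary f (cell \<xi>) {..<n}"
  have "inj_on (\<lambda>v. ?Y -` {v}) (range ?Y)" by (auto simp: inj_on_def)
  then show ?thesis
    unfolding partition_entropy_def rv_entropy_def iterated_join_eq[OF assms]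
    by (simp add: sum.reindex comp_def)
qed

context invariant_measure
begin

lemma simple_cell:
  assumes "borel_partition \<xi>"
  shows "simple_function M (cell \<xi>)"
proof -
  have p: "partition_on UNIV \<xi>" "finite \<xi>" "\<xi> \<subseteq> sets borel" using assms by (auto simp: borel_partition_def)
  have r: "range (cell \<xi>) \<subseteq> \<xi>" using cell_eq(1)[OF p(1)] by auto
  have "cell \<xi> -` {v} \<in> sets M" for v
  proof (cases "v \<in> \<xi>")
    case True
    then have "cell \<xi> -` {v} = v" by (intro set_eqI) (simp add: cell_eq(3)[OF p(1)])
    then show ?thesis using True p(3) by (simp add: sets_eq subset_iff)
  next
    case False
    then have "v \<notin> range (cell \<xi>)" using r by blast
    then show ?thesis by (simp add: vimage_singleton_empty)
  qed
  then show ?thesis unfolding simple_iff using finite_subset[OF r p(2)] by blast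
qed

text \<open>Processes with values in \<open>'a set\<close> suffice, because each partition enters
  through its cell map.\<close>

lemma measure_entropy_le:
  assumes "\<And>X :: 'a \<Rightarrow> 'a set. simple_function M X \<Longrightarrow> process_rate X \<le> c"
  shows "measure_entropy f M \<le> ereal c"
  unfolding measure_entropy_def
proof (rule SUP_least)
  fix \<xi> :: "'a set set" assume "\<xi> \<in> {\<xi>. borel_partition \<xi>}"
  then have \<xi>: "borel_partition \<xi>" by simp
  then have "lim (\<lambda>n. partition_entropy M (iterated_join f \<xi> n) / real n) = process_rate (cell \<xi>)"
    by (simp add: partition_entropy_iterated_join borel_partition_def process_rate_def)
  then show "ereal (lim (\<lambda>n. partition_entropy M (iterated_join f \<xi> n) / real n)) \<le> ereal c"
    using assms[OF simple_cell[OF \<xi>]] by simp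
qed

text \<open>The fibres of \<open>X\<close> form a Borel partition from whose cell map
  \<open>X\<close> can be recovered, so that partition has at least the entropy rate of
  \<open>X\<close>.\<close>

lemma measure_entropy_ge:
  assumes X: "simple_function M X"
  shows "ereal (process_rate X) \<le> measure_entropy f M"
proof -
  define \<xi> where "\<xi> = (\<lambda>v. X -` {v}) ` range X"
  have p: "partition_on UNIV \<xi>" by (auto simp: \<xi>_def partition_on_def disjoint_def)
  have bp: "borel_partition \<xi>"
    using X p by (auto simp: borel_partition_def \<xi>_def simple_iff sets_eq)
  have cell: "cell \<xi> x = X -` {X x}" for x
    using cell_eq(3)[OF p, of "X -` {X x}" x] by (auto simp: \<xi>_def)
  have le: "rv_entropy M (itinerary f X {..<n}) \<le> rv_entropy M (itinerary f (cell \<xi>) {..<n})" for n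
  proof -
    have "X x = X (SOME y. y \<in> cell \<xi> x)" for x
    proof -
      have "x \<in> cell \<xi> x" by (simp add: cell)
      then have "(SOME y. y \<in> cell \<xi> x) \<in> cell \<xi> x" by (rule someI)
      then show ?thesis by (simp add: cell)
    qed
    then have "X = (\<lambda>x. (\<lambda>A. X (SOME y. y \<in> A)) (cell \<xi> x))" by auto
    then show ?thesis
      using rv_entropy_itinerary_comp_le[of "{..<n}" "cell \<xi>" f "\<lambda>A. X (SOME y. y \<in> A)"]
        simple_funpow[OF simple_cell[OF bp]] by simp
  qed
  have "process_rate X \<le> process_rate (cell \<xi>)"
    using process_rate_tendsto[OF X] process_rate_tendsto[OF simple_cell[OF bp]]
    by (rule LIMSEQ_le) (auto intro!: exI[of _ 0] divide_right_mono le)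
  also have "process_rate (cell \<xi>) = lim (\<lambda>n. partition_entropy M (iterated_join f \<xi> n) / real n)"
    using p by (simp add: partition_entropy_iterated_join process_rate_def)
  also have "ereal \<dots> \<le> measure_entropy f M"
    unfolding measure_entropy_def using bp by (intro SUP_upper) simp
  finally show ?thesis by simp
qed

lemma measure_entropy_nonneg: "0 \<le> measure_entropy f M"
proof -
  have s: "simple_function M (\<lambda>_. 0::nat)" by simp
  have "ereal 0 \<le> ereal (process_rate (\<lambda>_. 0::nat))" using process_rate_nonneg[OF s] by simp
  also have "\<dots> \<le> measure_entropy f M" by (rule measure_entropy_ge[OF s])
  finally show ?thesis unfolding zero_ereal_def .
qed

lemma integral_comp_simple:
  fixes \<phi> :: "'k \<Rightarrow> real"
  assumes X: "simple_function M X"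
  shows "integrable M (\<lambda>x. \<phi> (X x))"
    "(\<integral>x. \<phi> (X x) \<partial>M) = (\<Sum>v\<in>range X. measure M (X -` {v}) * \<phi> v)"
proof -
  have fin: "finite (range X)" and m: "\<And>v. X -` {v} \<in> sets M" using X by (auto simp: simple_iff)
  have eq: "\<phi> (X x) = (\<Sum>v\<in>range X. \<phi> v * indicator (X -` {v}) x)" for x
  proof -
    have "(\<Sum>v\<in>range X. \<phi> v * indicator (X -` {v}) x) = (\<Sum>v\<in>range X. if v = X x then \<phi> v else 0)"
      by (intro sum.cong) (auto simp: indicator_def)
    also have "\<dots> = \<phi> (X x)" using fin by (subst sum.delta) auto
    finally show ?thesis by simp
  qed
  have i: "integrable M (\<lambda>x. indicator (X -` {v}) x :: real)" for v
    using m by (intro integrable_real_indicator) (auto simp: emeasure_eq_measure)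
  show "integrable M (\<lambda>x. \<phi> (X x))" unfolding eq by (intro Bochner_Integration.integrable_sum integrable_mult_right i)
  show "(\<integral>x. \<phi> (X x) \<partial>M) = (\<Sum>v\<in>range X. measure M (X -` {v}) * \<phi> v)"
    unfolding eq using m by (subst Bochner_Integration.integral_sum) (auto intro!: integrable_mult_right i simp: space_UNIV mult.commute)
qed

lemma integral_funpow:
  fixes g :: "'a \<Rightarrow> real"
  assumes "g \<in> borel_measurable borel"
  shows "(\<integral>x. g ((f ^^ i) x) \<partial>M) = (\<integral>x. g x \<partial>M)"
  using integral_distr[OF funpow_measurable'[of i] assms] by (simp add: distr_funpow)

end

subsection \<open>Entropy is bounded by the growth of spanning sets\<close>

text \<open>The sets with such a two-sided approximation form a sigma-algebra containing the closed
  sets. Inner and outer approximation are carried together because complementation exchanges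
  them.\<close>

lemma closed_inner_outer_regular:
  fixes M :: "'a::metric_space measure"
  assumes M: "M \<in> borel_probs" and A: "A \<in> sets borel" and e: "e > 0"
  shows "\<exists>C U. closed C \<and> open U \<and> C \<subseteq> A \<and> A \<subseteq> U \<and> measure M (U - C) < e"
proof -
  interpret prob_space M using M by (simp add: space_prob_algebra)
  have sM: "sets M = sets borel" using M by (simp add: space_prob_algebra)
  have op: "open U \<Longrightarrow> U \<in> sets M" and cl: "closed C \<Longrightarrow> C \<in> sets M" for U C by (simp_all add: sM)
  have "A \<in> sigma_sets UNIV (Collect closed)" using A by (simp add: borel_eq_closed)
  then have "\<forall>e>0. \<exists>C U. closed C \<and> open U \<and> C \<subseteq> A \<and> A \<subseteq> U \<and> measure M (U - C) < e"
  proof (induction rule: sigma_sets.induct)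
    case (Basic C)
    then have C: "closed C" by simp
    show ?case
    proof (intro allI impI)
      fix e :: real assume e: "e > 0"
      show "\<exists>K U. closed K \<and> open U \<and> K \<subseteq> C \<and> C \<subseteq> U \<and> measure M (U - K) < e"
      proof (cases "C = {}")
        case True
        then show ?thesis using e by (intro exI[of _ "{}"]) simp
      next
        case False
        \<comment> \<open>Open neighbourhoods shrinking to the closed set \<open>C\<close>, so that
          the excess measure tends to 0.\<close>
        define U where "U k = {x. infdist x C < 1 / Suc k}" for k
        have U: "open (U k)" for k unfolding U_def by (intro open_Collect_less continuous_intros)
        have sub: "C \<subseteq> U k" for k by (auto simp: U_def)
        have le: "1 / real (Suc (Suc k)) \<le> 1 / real (Suc k)" for k by (intro frac_le) auto
        have dec: "decseq (\<lambda>k. U k - C)"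
          by (rule decseq_SucI) (auto simp: U_def simp del: of_nat_Suc intro: less_le_trans[OF _ le])
        have emp: "(\<Inter>k. U k - C) = {}"
        proof (rule equals0I)
          fix x assume x: "x \<in> (\<Inter>k. U k - C)"
          then have "infdist x C > 0" using infdist_pos_not_in_closed[OF C False, of x] by simp
          then obtain k where "1 / Suc k < infdist x C" by (rule nat_approx_posE)
          moreover have "infdist x C < 1 / Suc k" using x by (auto simp: U_def)
          ultimately show False by simp
        qed
        have r: "range (\<lambda>k. U k - C) \<subseteq> sets M" using op[OF U] cl[OF C] by auto
        have "(\<lambda>k. measure M (U k - C)) \<longlonglongrightarrow> 0"
          using finite_Lim_measure_decseq[OF r dec] unfolding emp by simp
        from order_tendstoD(2)[OF this e] obtain k where "measure M (U k - C) < e"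
          by (auto simp: eventually_sequentially)
        then show ?thesis using C U[of k] sub[of k] by (intro exI[of _ C] exI[of _ "U k"]) simp
      qed
    qed
  next
    case Empty
    then show ?case by (auto intro!: exI[of _ "{}"])
  next
    case (Compl A)
    show ?case
    proof (intro allI impI)
      fix e :: real assume "e > 0"
      from Compl.IH[rule_format, OF this]
      obtain C U where CU: "closed C" "open U" "C \<subseteq> A" "A \<subseteq> U" "measure M (U - C) < e"
        by (elim exE conjE)
      moreover have "- C - - U = U - C" by auto
      ultimately show "\<exists>C U. closed C \<and> open U \<and> C \<subseteq> UNIV - A \<and> UNIV - A \<subseteq> U \<and> measure M (U - C) < e"
        by (intro exI[of _ "- U"] exI[of _ "- C"]) (simp add: closed_Compl open_Compl Compl_eq_Diff_UNIV[symmetric])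
    qed
  next
    case (Union A)
    show ?case
    proof (intro allI impI)
      fix e :: real assume e: "e > 0"
      have "\<exists>C U. closed C \<and> open U \<and> C \<subseteq> A i \<and> A i \<subseteq> U \<and> measure M (U - C) < e/2 * (1/2)^Suc i" for i
        using e by (intro Union.IH[rule_format]) simp
      then obtain C U where CU: "\<And>i. closed (C i)" "\<And>i. open (U i)" "\<And>i. C i \<subseteq> A i" "\<And>i. A i \<subseteq> U i"
        "\<And>i. measure M (U i - C i) < e/2 * (1/2)^Suc i" by metis
      \<comment> \<open>An infinite union of closed sets need not be closed; a finite one is, and
        for large \<open>n\<close> it loses less than \<open>e/2\<close>.\<close>
      define D where "D n = (\<Union>i<n. C i)" for n :: nat
      let ?U = "\<Union>i. U i" and ?C = "\<Union>i. C i"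
      have cD: "closed (D n)" for n unfolding D_def using CU(1) by (intro closed_UN) auto
      have mC: "?C \<in> sets M" "?U \<in> sets M" using cl[OF CU(1)] op[OF CU(2)] by auto
      have "incseq D" unfolding D_def by (intro incseq_SucI UN_mono) auto
      moreover have UD: "(\<Union>n. D n) = ?C" using UN_UN_finite_eq[of C] by (simp add: D_def atLeast0LessThan)
      moreover have "range D \<subseteq> sets M" using cl[OF cD] by auto
      ultimately have lim: "(\<lambda>n. measure M (D n)) \<longlonglongrightarrow> measure M ?C"
        using finite_Lim_measure_incseq[of D] by simp
      have "\<forall>\<^sub>F n in sequentially. measure M ?C - e/2 < measure M (D n)"
        using e by (intro order_tendstoD(1)[OF lim]) simp
      from eventually_happens[OF this] obtain n where n: "measure M ?C - e/2 < measure M (D n)" by auto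
      have DC: "D n \<subseteq> ?C" unfolding D_def by auto
      have 1: "measure M (?C - D n) < e/2"
        using n finite_measure_Diff[OF mC(1) cl[OF cD] DC] by simp
      have s: "(\<lambda>i. e/2 * (1/2)^Suc i) sums (e/2)" using sums_mult[OF power_half_series, of "e/2"] by simp
      have sm: "summable (\<lambda>i. measure M (U i - C i))"
        using CU(5) by (intro summable_comparison_test'[OF sums_summable[OF s], of 0]) (auto intro: less_imp_le)
      have "measure M (\<Union>i. U i - C i) \<le> (\<Sum>i. measure M (U i - C i))"
        using op[OF CU(2)] cl[OF CU(1)] sm by (intro finite_measure_subadditive_countably) auto
      also have "\<dots> \<le> (\<Sum>i. e/2 * (1/2)^Suc i)"
        using CU(5) by (intro suminf_le sm sums_summable[OF s]) (auto intro: less_imp_le)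
      also have "\<dots> = e/2" using s by (rule sums_unique[symmetric])
      finally have 2: "measure M (\<Union>i. U i - C i) \<le> e/2" .
      have "?U - D n \<subseteq> (?C - D n) \<union> (\<Union>i. U i - C i)"
      proof
        fix x assume x: "x \<in> ?U - D n"
        then obtain i where i: "x \<in> U i" by auto
        show "x \<in> (?C - D n) \<union> (\<Union>i. U i - C i)"
        proof (cases "x \<in> C i")
          case True then show ?thesis using x by (intro UnI1) auto
        next
          case False then show ?thesis using i by (intro UnI2) auto
        qed
      qed
      then have "measure M (?U - D n) \<le> measure M ((?C - D n) \<union> (\<Union>i. U i - C i))"
        using op[OF CU(2)] cl[OF CU(1)] cl[OF cD] by (intro finite_measure_mono) auto
      also have "\<dots> \<le> measure M (?C - D n) + measure M (\<Union>i. U i - C i)"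
        using op[OF CU(2)] cl[OF CU(1)] cl[OF cD] by (intro measure_Un_le) auto
      also have "\<dots> < e" using 1 2 by simp
      finally have "measure M (?U - D n) < e" .
      moreover have "D n \<subseteq> (\<Union>i. A i)" unfolding D_def using CU(3) by (intro UN_mono) auto
      moreover have "(\<Union>i. A i) \<subseteq> ?U" using CU(4) by (intro UN_mono) auto
      moreover have "open ?U" using CU(2) by (intro open_UN) simp
      ultimately show "\<exists>C U. closed C \<and> open U \<and> C \<subseteq> (\<Union>i. A i) \<and> (\<Union>i. A i) \<subseteq> U \<and> measure M (U - C) < e"
        using cD[of n] by (intro exI[of _ "D n"] exI[of _ ?U] conjI)
    qed
  qed
  from this[rule_format, OF e] show ?thesis .
qed

text \<open>Disjoint nonempty closed subsets of a compact space are at positive distance, and there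
  are finitely many pairs.\<close>

lemma disjoint_closed_separated:
  fixes B :: "'k \<Rightarrow> 'a::metric_space set"
  assumes c: "compact (UNIV :: 'a set)" and V: "finite V" "\<And>v. v \<in> V \<Longrightarrow> closed (B v)"
    and disj: "\<And>v w. v \<in> V \<Longrightarrow> w \<in> V \<Longrightarrow> v \<noteq> w \<Longrightarrow> B v \<inter> B w = {}"
  obtains d where "d > 0" "\<And>v w x y. \<lbrakk>v \<in> V; w \<in> V; v \<noteq> w; x \<in> B v; y \<in> B w\<rbrakk> \<Longrightarrow> d \<le> dist x y"
proof -
  let ?D = "{p \<in> V \<times> V. fst p \<noteq> snd p}"
  have "\<forall>p\<in>?D. \<exists>d. d > 0 \<and> (\<forall>x\<in>B (fst p). \<forall>y\<in>B (snd p). d \<le> dist x y)"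
  proof
    fix p assume "p \<in> ?D"
    then have p: "fst p \<in> V" "snd p \<in> V" "fst p \<noteq> snd p" by (simp_all add: mem_Times_iff)
    show "\<exists>d. d > 0 \<and> (\<forall>x\<in>B (fst p). \<forall>y\<in>B (snd p). d \<le> dist x y)"
    proof (cases "B (fst p) = {} \<or> B (snd p) = {}")
      case True
      then show ?thesis by (intro exI[of _ 1]) (elim disjE; simp)
    next
      case False
      have "compact (B (fst p))" using compact_Int_closed[OF c V(2)[OF p(1)]] by (simp only: Int_UNIV_left)
      then have "setdist (B (fst p)) (B (snd p)) > 0"
        using False disj[OF p] V(2)[OF p(2)] setdist_gt_0_compact_closed[of "B (fst p)" "B (snd p)"] by simp
      then show ?thesis by (intro exI[of _ "setdist (B (fst p)) (B (snd p))"]) (simp add: setdist_le_dist)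
    qed
  qed
  from bchoice[OF this] obtain d where
    dd: "\<forall>p\<in>?D. d p > 0 \<and> (\<forall>x\<in>B (fst p). \<forall>y\<in>B (snd p). d p \<le> dist x y)" by (elim exE)
  have d: "d p > 0" if "p \<in> ?D" for p
    using bspec[OF dd that] by (rule conjunct1)
  have d': "d p \<le> dist x y" if "p \<in> ?D" "x \<in> B (fst p)" "y \<in> B (snd p)" for p x y
    using conjunct2[OF bspec[OF dd that(1)], THEN bspec, OF that(2), THEN bspec, OF that(3)] .
  \<comment> \<open>The element 1 keeps the minimum defined when there are no pairs.\<close>
  let ?S = "insert 1 (d ` (?D))"
  have fin: "finite ?S" using V(1) by simp
  show ?thesis
  proof (rule that[of "Min ?S"])
    show "Min ?S > 0" using fin d by (subst Min_gr_iff) auto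
    fix v w x y assume *: "v \<in> V" "w \<in> V" "v \<noteq> w" "x \<in> B v" "y \<in> B w"
    have "Min ?S \<le> d (v, w)" using fin * by (intro Min_le) auto
    also have "\<dots> \<le> dist x y" using d'[of "(v, w)" x y] * by simp
    finally show "Min ?S \<le> dist x y" .
  qed
qed

text \<open>Apply \<open>ln s \<le> s - 1\<close> to \<open>1 / sqrt t\<close>. The bound tells how
  small a set must be for its entropy term to be negligible, and gives continuity of
  \<open>t ln t\<close> at 0.\<close>

lemma neg_mult_ln_le_sqrt:
  fixes t :: real
  assumes "0 \<le> t"
  shows "- (t * ln t) \<le> 2 * sqrt t"
proof (cases "t = 0")
  case False
  then have t: "t > 0" using assms by simp
  have "ln (1 / sqrt t) \<le> 1 / sqrt t - 1" using t by (intro ln_le_minus_one) simp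
  then have "- ln t \<le> 2 * (1 / sqrt t)" using t by (simp add: ln_div ln_sqrt)
  then have "t * (- ln t) \<le> t * (2 * (1 / sqrt t))" using t by (intro mult_left_mono) auto
  also have "\<dots> = 2 * (t / sqrt t)" by simp
  also have "t / sqrt t = sqrt t" using assms by (rule real_div_sqrt)
  finally show ?thesis by simp
qed simp

context finite_rv_space
begin

lemma rv_entropy_superset:
  assumes "finite S" "range X \<subseteq> S"
  shows "rv_entropy M X = - (\<Sum>v\<in>S. measure M (X -` {v}) * ln (measure M (X -` {v})))"
  unfolding rv_entropy_def neg_equal_iff_equal using assms
  by (intro sum.mono_neutral_left) (auto simp: vimage_singleton_empty)

text \<open>The inequality \<open>H(A,B|C,D) \<le> H(A|C) + H(B|D)\<close> with conditional
  entropies written as differences: three uses of submodularity discard the surplus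
  conditioning.\<close>

lemma rv_entropy_conditional_pair:
  assumes A: "simple_function M A" and B: "simple_function M B" and C: "simple_function M C" and D: "simple_function M D"
  shows "rv_entropy M (\<lambda>x. (A x, B x, C x, D x)) \<le>
    rv_entropy M (\<lambda>x. (A x, C x)) - rv_entropy M C + (rv_entropy M (\<lambda>x. (B x, D x)) - rv_entropy M D)
     + rv_entropy M (\<lambda>x. (C x, D x))"
proof -
  have CD: "simple_function M (\<lambda>x. (C x, D x))" using C D by (rule simple_function_Pair)
  have "rv_entropy M (\<lambda>x. (A x, B x, C x, D x)) + rv_entropy M (\<lambda>x. (C x, D x))
     \<le> rv_entropy M (\<lambda>x. (A x, C x, D x)) + rv_entropy M (\<lambda>x. (B x, C x, D x))"
    by (rule rv_entropy_submodular[OF A B CD])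
  moreover have "rv_entropy M (\<lambda>x. (A x, D x, C x)) + rv_entropy M C
     \<le> rv_entropy M (\<lambda>x. (A x, C x)) + rv_entropy M (\<lambda>x. (D x, C x))"
    by (rule rv_entropy_submodular[OF A D C])
  moreover have "rv_entropy M (\<lambda>x. (B x, C x, D x)) + rv_entropy M D
     \<le> rv_entropy M (\<lambda>x. (B x, D x)) + rv_entropy M (\<lambda>x. (C x, D x))"
    by (rule rv_entropy_submodular[OF B C D])
  moreover have "rv_entropy M (\<lambda>x. (A x, C x, D x)) \<le> rv_entropy M (\<lambda>x. (A x, D x, C x))"
    using rv_entropy_comp_le[OF simple_function_Pair[OF A simple_function_Pair[OF D C]], of "\<lambda>(a,d,c). (a,c,d)"]
    by simp
  moreover have "rv_entropy M (\<lambda>x. (D x, C x)) \<le> rv_entropy M (\<lambda>x. (C x, D x))"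
    using rv_entropy_comp_le[OF CD, of "\<lambda>(c,d). (d,c)"] by simp
  ultimately show ?thesis by linarith
qed

end

context invariant_measure
begin

text \<open>By induction, the entropy of the \<open>Y\<close>-name given the \<open>Z\<close>-name
  grows per step by at most the conditional entropy of \<open>Y\<close> given \<open>Z\<close>,
  which by invariance is the same at every time and hence at most \<open>c\<close>.\<close>

lemma rv_entropy_itinerary_conditional:
  assumes Y: "simple_function M Y" and Z: "simple_function M Z"
    and c: "rv_entropy M (\<lambda>x. (Y x, Z x)) \<le> rv_entropy M Z + c"
  shows "rv_entropy M (itinerary f Y {..<n}) \<le> rv_entropy M (itinerary f Z {..<n}) + real n * c"
proof -
  let ?Y = "\<lambda>n. itinerary f Y {..<n}" and ?Z = "\<lambda>n. itinerary f Z {..<n}"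
  have sY: "simple_function M (?Y n)" and sZ: "simple_function M (?Z n)" for n
    using simple_funpow[OF Y] simple_funpow[OF Z] by (auto intro!: simple_itinerary)
  have YZ: "simple_function M (\<lambda>x. (Y x, Z x))" using Y Z by (rule simple_function_Pair)
  have "rv_entropy M (\<lambda>x. (?Y n x, ?Z n x)) \<le> rv_entropy M (?Z n) + real n * c"
  proof (induction n)
    case 0
    have "(\<lambda>x. (?Y 0 x, ?Z 0 x)) = (\<lambda>_. (\<lambda>_. undefined, \<lambda>_. undefined))"
      by (simp add: itinerary_def fun_eq_iff)
    moreover have "?Z 0 = (\<lambda>_. \<lambda>_. undefined)"
      by (simp add: itinerary_def fun_eq_iff)
    ultimately show ?case using prob_space by (simp add: rv_entropy_def space_UNIV)
  next
    case (Suc n)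
    let ?y = "\<lambda>x. Y ((f ^^ n) x)" and ?z = "\<lambda>x. Z ((f ^^ n) x)"
    have sy: "simple_function M ?y" and sz: "simple_function M ?z"
      using simple_funpow[OF Y] simple_funpow[OF Z] by auto
    \<comment> \<open>Extends a name of length \<open>n\<close> by the symbol at time
      \<open>n\<close>, with \<open>undefined\<close> beyond it as \<open>restrict\<close>
      prescribes.\<close>
    let ?e = "\<lambda>a v i. if i < n then a i else if i = n then v else undefined"
    have eY: "?Y (Suc n) x = ?e (?Y n x) (?y x)" and eZ: "?Z (Suc n) x = ?e (?Z n x) (?z x)" for x
      by (auto simp: itinerary_def fun_eq_iff restrict_def less_Suc_eq)
    have "rv_entropy M (\<lambda>x. (?Y (Suc n) x, ?Z (Suc n) x)) \<le> rv_entropy M (\<lambda>x. (?Y n x, ?y x, ?Z n x, ?z x))"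
    proof -
      let ?h = "\<lambda>(a, v, b, w). (?e a v, ?e b w)"
      have "simple_function M (\<lambda>x. (?Y n x, ?y x, ?Z n x, ?z x))"
        by (intro simple_function_Pair sY sy sZ sz)
      then have "rv_entropy M (\<lambda>x. ?h (?Y n x, ?y x, ?Z n x, ?z x)) \<le> rv_entropy M (\<lambda>x. (?Y n x, ?y x, ?Z n x, ?z x))"
        by (rule rv_entropy_comp_le)
      then show ?thesis by (simp only: eY eZ prod.case)
    qed
    also have "\<dots> \<le> rv_entropy M (\<lambda>x. (?Y n x, ?Z n x)) - rv_entropy M (?Z n)
       + (rv_entropy M (\<lambda>x. (?y x, ?z x)) - rv_entropy M ?z) + rv_entropy M (\<lambda>x. (?Z n x, ?z x))"
      by (rule rv_entropy_conditional_pair[OF sY sy sZ sz])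
    also have "rv_entropy M (\<lambda>x. (?y x, ?z x)) = rv_entropy M (\<lambda>x. (Y x, Z x))"
      by (rule rv_entropy_funpow[OF YZ])
    also have "rv_entropy M ?z = rv_entropy M Z" by (rule rv_entropy_funpow[OF Z])
    also have "rv_entropy M (\<lambda>x. (?Z n x, ?z x)) \<le> rv_entropy M (?Z (Suc n))"
    proof -
      have "(\<lambda>x. (?Z n x, ?z x)) = (\<lambda>x. (\<lambda>a. (restrict a {..<n}, a n)) (?Z (Suc n) x))"
        by (simp add: itinerary_def fun_eq_iff restrict_def)
      then show ?thesis
        using rv_entropy_comp_le[OF sZ[of "Suc n"], of "\<lambda>a. (restrict a {..<n}, a n)"] by (simp only:)
    qed
    finally show ?case using Suc c by (simp add: algebra_simps)
  qed
  moreover have "rv_entropy M (?Y n) \<le> rv_entropy M (\<lambda>x. (?Y n x, ?Z n x))"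
    using rv_entropy_comp_le[OF simple_function_Pair[OF sY sZ], of fst n n] by simp
  ultimately show ?thesis by linarith
qed

end

context finite_rv_space
begin

lemma gibbs_integral:
  fixes S :: "'a \<Rightarrow> real"
  assumes W: "simple_function M W" and S: "integrable M S" and le: "\<And>x. S x \<le> \<alpha> (W x)"
    and int: "integrable M (\<lambda>x. \<alpha> (W x))"
      "(\<integral>x. \<alpha> (W x) \<partial>M) = (\<Sum>v\<in>range W. measure M (W -` {v}) * \<alpha> v)"
  shows "rv_entropy M W + (\<integral>x. S x \<partial>M) \<le> ln (\<Sum>v\<in>range W. exp (\<alpha> v))"
proof -
  have "(\<integral>x. S x \<partial>M) \<le> (\<integral>x. \<alpha> (W x) \<partial>M)" by (rule integral_mono[OF S int(1) le])
  then show ?thesis using gibbs_inequality[OF W, of \<alpha>] int(2) by linarith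
qed

end

lemma mult_ln_nonpos:
  fixes t :: real
  assumes "0 \<le> t" "t \<le> 1"
  shows "t * ln t \<le> 0"
  using assms by (cases "t = 0") (auto intro!: mult_nonneg_nonpos)

text \<open>The new variable agrees with \<open>Y\<close> on closed subsets \<open>B v\<close> of
  its fibres and is \<open>None\<close> on what is left. Knowing it, \<open>Y\<close> is uncertain
  only on the remainder, which is so small that the conditional entropy is at most 1.\<close>

lemma (in invariant_measure) closed_approximation:
  fixes Y :: "'a \<Rightarrow> 'k"
  assumes reg: "\<And>A e. A \<in> sets borel \<Longrightarrow> e > 0 \<Longrightarrow> \<exists>C. closed C \<and> C \<subseteq> A \<and> measure M (A - C) < e"
    and Y: "simple_function M Y"
  obtains B where "\<And>v. v \<in> range Y \<Longrightarrow> closed (B v)" "\<And>v. v \<in> range Y \<Longrightarrow> B v \<subseteq> Y -` {v}"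
    "simple_function M (\<lambda>x. if x \<in> B (Y x) then Some (Y x) else None)"
    "rv_entropy M (\<lambda>x. (Y x, if x \<in> B (Y x) then Some (Y x) else None))
      \<le> rv_entropy M (\<lambda>x. if x \<in> B (Y x) then Some (Y x) else None) + 1"
proof -
  define V where "V = range Y"
  have V: "finite V" "V \<noteq> {}" using Y by (auto simp: V_def simple_iff)
  define K where "K = real (card V)"
  have K: "K \<ge> 1" using V by (simp add: K_def Suc_le_eq card_gt_0_iff)
  \<comment> \<open>Then \<open>2 * sqrt \<eta> = 1 / K\<close>, so by
    \<open>neg_mult_ln_le_sqrt\<close> the \<open>K\<close> remainders contribute at most 1 in
    all.\<close>
  define \<eta> where "\<eta> = 1 / (4 * K^2)"
  have \<eta>: "\<eta> > 0" using K by (simp add: \<eta>_def)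
  have mY: "Y -` {v} \<in> sets borel" for v using Y by (simp add: simple_iff sets_eq)
  have "\<forall>v\<in>V. \<exists>C. closed C \<and> C \<subseteq> Y -` {v} \<and> measure M (Y -` {v} - C) < \<eta>"
    using reg[OF mY \<eta>] by simp
  from bchoice[OF this] obtain B where
    BB: "\<forall>v\<in>V. closed (B v) \<and> B v \<subseteq> Y -` {v} \<and> measure M (Y -` {v} - B v) < \<eta>" by (elim exE)
  have B: "closed (B v)" "B v \<subseteq> Y -` {v}" "measure M (Y -` {v} - B v) < \<eta>" if "v \<in> V" for v
    using bspec[OF BB that] by simp_all
  define Z where "Z x = (if x \<in> B (Y x) then Some (Y x) else None)" for x
  have YV: "Y x \<in> V" for x by (simp add: V_def)
  have inB: "x \<in> B v \<longleftrightarrow> Z x = Some v" if "v \<in> V" for x v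
  proof -
    have "Y x = v" if "x \<in> B v" using subsetD[OF B(2)[OF \<open>v \<in> V\<close>] that] by simp
    then show ?thesis by (auto simp: Z_def)
  qed
  have ZY: "Z x = Some v \<Longrightarrow> Y x = v" for x v by (simp add: Z_def split: if_splits)
  have fibS: "Z -` {Some v} = B v" if "v \<in> V" for v
    using inB[OF that] by (intro set_eqI) simp
  have rZ: "range Z \<subseteq> insert None (Some ` V)"
    by (intro image_subsetI) (simp add: Z_def YV)
  have fin2: "finite (insert None (Some ` V))" using V by simp
  have mB: "B v \<in> sets M" if "v \<in> V" for v using B(1)[OF that] by (simp add: sets_eq)
  have sZ: "simple_function M Z"
    unfolding simple_iff
  proof (intro conjI allI)
    show "finite (range Z)" using finite_subset[OF rZ fin2] .
    fix u
    show "Z -` {u} \<in> sets M"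
    proof (cases "u = None")
      case True
      have "Z -` {None} = UNIV - (\<Union>v\<in>V. B v)"
      proof (intro set_eqI)
        fix x
        have "Z x = None \<longleftrightarrow> (\<forall>v\<in>V. Z x \<noteq> Some v)"
          using YV by (auto simp: Z_def)
        then show "x \<in> Z -` {None} \<longleftrightarrow> x \<in> UNIV - (\<Union>v\<in>V. B v)" by (simp add: inB)
      qed
      moreover have "(\<Union>v\<in>V. B v) \<in> sets M" using V mB by (intro sets.finite_UN) auto
      ultimately show ?thesis using True sets.compl_sets[of "\<Union>v\<in>V. B v" M] by (simp add: space_UNIV)
    next
      case False
      then obtain v where v: "u = Some v" by auto
      show ?thesis
      proof (cases "v \<in> V")
        case True then show ?thesis using mB by (simp add: v fibS)
      next
        case False
        then have "u \<notin> range Z" using rZ v by auto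
        then show ?thesis by (simp add: vimage_singleton_empty)
      qed
    qed
  qed
  let ?T = "\<lambda>x. (Y x, Z x)"
  let ?S1 = "(\<lambda>v. (v, Some v)) ` V" and ?S2 = "(\<lambda>v. (v, None)) ` V"
  define \<phi> :: "real \<Rightarrow> real" where "\<phi> t = t * ln t" for t
  have rT: "range ?T \<subseteq> ?S1 \<union> ?S2"
    by (intro image_subsetI) (auto simp: Z_def YV)
  have f1: "?T -` {(v, Some v)} = Z -` {Some v}" for v
    using ZY by (intro set_eqI) auto
  have f2: "?T -` {(v, None)} = Y -` {v} - B v" for v
    by (intro set_eqI) (auto simp: Z_def split: if_splits)
  have "rv_entropy M ?T = - (\<Sum>t\<in>?S1 \<union> ?S2. \<phi> (measure M (?T -` {t})))"
    unfolding \<phi>_def using V rT by (intro rv_entropy_superset) auto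
  also have "(\<Sum>t\<in>?S1 \<union> ?S2. \<phi> (measure M (?T -` {t}))) =
     (\<Sum>t\<in>?S1. \<phi> (measure M (?T -` {t}))) + (\<Sum>t\<in>?S2. \<phi> (measure M (?T -` {t})))"
    using V by (intro sum.union_disjoint) auto
  also have "(\<Sum>t\<in>?S1. \<phi> (measure M (?T -` {t}))) = (\<Sum>v\<in>V. \<phi> (measure M (Z -` {Some v})))"
    by (subst sum.reindex) (auto simp: inj_on_def f1)
  also have "(\<Sum>t\<in>?S2. \<phi> (measure M (?T -` {t}))) = (\<Sum>v\<in>V. \<phi> (measure M (Y -` {v} - B v)))"
    by (subst sum.reindex) (auto simp: inj_on_def f2)
  finally have HT: "rv_entropy M ?T = - ((\<Sum>v\<in>V. \<phi> (measure M (Z -` {Some v}))) + (\<Sum>v\<in>V. \<phi> (measure M (Y -` {v} - B v))))" .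
  have "rv_entropy M Z = - (\<Sum>t\<in>insert None (Some ` V). \<phi> (measure M (Z -` {t})))"
    unfolding \<phi>_def by (rule rv_entropy_superset[OF fin2 rZ])
  also have "(\<Sum>t\<in>insert None (Some ` V). \<phi> (measure M (Z -` {t}))) =
     \<phi> (measure M (Z -` {None})) + (\<Sum>v\<in>V. \<phi> (measure M (Z -` {Some v})))"
    using V by (subst sum.insert) (auto simp: sum.reindex inj_on_def)
  finally have HZ: "rv_entropy M Z = - (\<phi> (measure M (Z -` {None})) + (\<Sum>v\<in>V. \<phi> (measure M (Z -` {Some v}))))" .
  have "- \<phi> (measure M (Y -` {v} - B v)) \<le> 1 / K" if "v \<in> V" for v
  proof -
    have "- \<phi> (measure M (Y -` {v} - B v)) \<le> 2 * sqrt (measure M (Y -` {v} - B v))"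
      unfolding \<phi>_def by (rule neg_mult_ln_le_sqrt) simp
    also have "\<dots> \<le> 2 * sqrt \<eta>" using B(3)[OF that] by simp
    also have "sqrt \<eta> = 1 / (2 * K)" using K by (simp add: \<eta>_def real_sqrt_divide real_sqrt_mult)
    finally show ?thesis by simp
  qed
  then have "(\<Sum>v\<in>V. - \<phi> (measure M (Y -` {v} - B v))) \<le> (\<Sum>v\<in>V. 1 / K)" by (rule sum_mono)
  also have "\<dots> = 1" using K by (simp add: K_def)
  finally have d1: "- (\<Sum>v\<in>V. \<phi> (measure M (Y -` {v} - B v))) \<le> 1" by (simp add: sum_negf)
  \<comment> \<open>The term of the \<open>None\<close> fibre only adds to the entropy of
    \<open>Z\<close>, so it may be dropped.\<close>
  have d2: "\<phi> (measure M (Z -` {None})) \<le> 0" unfolding \<phi>_def by (rule mult_ln_nonpos) auto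
  have arith: "hT \<le> hZ + 1" if "hT = - (a + b)" "hZ = - (c + a)" "- b \<le> 1" "c \<le> 0" for hT hZ a b c :: real
    using that by linarith
  have le: "rv_entropy M ?T \<le> rv_entropy M Z + 1" by (rule arith[OF HT HZ d1 d2])
  show ?thesis
    by (rule that[OF B(1,2)[folded V_def] sZ[unfolded Z_def] le[unfolded Z_def]]) (simp_all add: V_def)
qed

text \<open>The time \<open>t\<close> splits as \<open>N * (t div N) + t mod N\<close>, so a long
  name under \<open>f\<close> is a recoding of a name under \<open>f ^^ N\<close> whose symbols are
  words of length \<open>N\<close>.\<close>

lemma itinerary_block:
  assumes "N > 0"
  shows "itinerary f X {..<n * N} x =
    (\<lambda>t\<in>{..<n * N}. itinerary (f ^^ N) (itinerary f X {..<N}) {..<n} x (t div N) (t mod N))"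
proof
  fix t
  show "itinerary f X {..<n * N} x t =
    (\<lambda>t\<in>{..<n * N}. itinerary (f ^^ N) (itinerary f X {..<N}) {..<n} x (t div N) (t mod N)) t"
  proof (cases "t < n * N")
    case True
    then have "t div N < n" using assms by (simp add: less_mult_imp_div_less)
    moreover have "(f ^^ (t mod N)) (((f ^^ N) ^^ (t div N)) x) = (f ^^ t) x"
    proof -
      have "(f ^^ (t mod N)) (((f ^^ N) ^^ (t div N)) x) = (f ^^ (t mod N + N * (t div N))) x"
        by (simp only: funpow_mult funpow_add comp_apply)
      then show ?thesis by simp
    qed
    ultimately show ?thesis using True assms by (simp add: itinerary_def)
  qed (simp add: itinerary_def)
qed

lemma bowen_dist_leD:
  assumes "bowen_dist f n x y \<le> \<epsilon>" "i < n"
  shows "dist ((f ^^ i) x) ((f ^^ i) y) \<le> \<epsilon>"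
proof -
  have "dist ((f ^^ i) x) ((f ^^ i) y) \<le> bowen_dist f n x y"
    unfolding bowen_dist_def using assms(2) by (intro Max_ge) auto
  then show ?thesis using assms(1) by simp
qed

lemma birkhoff_sum_close:
  assumes "\<And>i. i < n \<Longrightarrow> dist ((f ^^ i) x) ((f ^^ i) y) \<le> \<epsilon>"
    and "\<And>x y. dist x y \<le> \<epsilon> \<Longrightarrow> \<bar>\<Phi> x - \<Phi> y\<bar> \<le> v"
  shows "\<bar>birkhoff_sum f \<Phi> n x - birkhoff_sum f \<Phi> n y\<bar> \<le> real n * v"
proof -
  have "\<bar>birkhoff_sum f \<Phi> n x - birkhoff_sum f \<Phi> n y\<bar> = \<bar>\<Sum>i<n. \<Phi> ((f ^^ i) x) - \<Phi> ((f ^^ i) y)\<bar>"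
    by (simp add: birkhoff_sum_def sum_subtractf)
  also have "\<dots> \<le> (\<Sum>i<n. \<bar>\<Phi> ((f ^^ i) x) - \<Phi> ((f ^^ i) y)\<bar>)" by (rule sum_abs)
  also have "\<dots> \<le> (\<Sum>i<n. v)" using assms by (intro sum_mono) simp
  finally show ?thesis by simp
qed

text \<open>Each name is represented by a point of its fibre, and that point by a member of the
  spanning set. Points with different symbols other than \<open>None\<close> are at least
  \<open>d\<close> apart and \<open>2 * \<epsilon> < d\<close>, so names that share a spanning point
  can show, at each of the \<open>n\<close> times, only \<open>None\<close> or one fixed symbol: at
  most \<open>2 ^ n\<close> names per spanning point.\<close>

lemma spanning_cell_count:
  fixes Z :: "'a::metric_space \<Rightarrow> 'k option"
  assumes sep: "\<And>x y. Z x \<noteq> None \<Longrightarrow> Z y \<noteq> None \<Longrightarrow> Z x \<noteq> Z y \<Longrightarrow> d \<le> dist x y"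
    and \<epsilon>: "2 * \<epsilon> < d" and N: "N > 0"
    and F: "finite F" "spanning f (n * N) \<epsilon> UNIV F"
    and var: "\<And>x y. dist x y \<le> \<epsilon> \<Longrightarrow> \<bar>\<Phi> x - \<Phi> y\<bar> \<le> v"
    and bdd: "\<And>x. birkhoff_sum f \<Phi> (n * N) x \<le> b"
    and R: "finite (range (itinerary (f ^^ N) Z {..<n}))"
  obtains \<alpha> where "\<And>x. birkhoff_sum f \<Phi> (n * N) x \<le> \<alpha> (itinerary (f ^^ N) Z {..<n} x)"
    "(\<Sum>z\<in>range (itinerary (f ^^ N) Z {..<n}). exp (\<alpha> z))
      \<le> exp (real (n * N) * v + 1) * (2 ^ n * (\<Sum>x\<in>F. exp (birkhoff_sum f \<Phi> (n * N) x)))"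
proof -
  let ?W = "itinerary (f ^^ N) Z {..<n}" and ?S = "birkhoff_sum f \<Phi> (n * N)"
  let ?R = "range ?W"
  have "\<forall>z\<in>?R. \<exists>x. ?W x = z \<and> (\<forall>y. ?W y = z \<longrightarrow> ?S y \<le> ?S x + 1)"
  proof
    fix z assume "z \<in> ?R"
    then have ne: "?S ` {x. ?W x = z} \<noteq> {}" by auto
    have bd: "bdd_above (?S ` {x. ?W x = z})" using bdd by (intro bdd_aboveI[of _ b]) auto
    \<comment> \<open>The fibre of a name need not be closed, so the supremum of the Birkhoff sum
      may not be attained; a point within 1 of it is taken, whence the \<open>+ 1\<close> in the
      exponent.\<close>
    have "Sup (?S ` {x. ?W x = z}) - 1 < Sup (?S ` {x. ?W x = z})" by simp
    then obtain s where s: "s \<in> ?S ` {x. ?W x = z}" "Sup (?S ` {x. ?W x = z}) - 1 < s"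
      using less_cSup_iff[OF ne bd] by auto
    then obtain x where x: "?W x = z" "s = ?S x" by auto
    have "?S y \<le> ?S x + 1" if "?W y = z" for y
    proof -
      have "?S y \<le> Sup (?S ` {x. ?W x = z})" using that by (intro cSup_upper bd) auto
      then show ?thesis using s(2) x(2) by linarith
    qed
    then show "\<exists>x. ?W x = z \<and> (\<forall>y. ?W y = z \<longrightarrow> ?S y \<le> ?S x + 1)" using x(1) by (intro exI[of _ x]) simp
  qed
  from bchoice[OF this] obtain X where XX: "\<forall>z\<in>?R. ?W (X z) = z \<and> (\<forall>y. ?W y = z \<longrightarrow> ?S y \<le> ?S (X z) + 1)"
    by (elim exE)
  have X: "?W (X z) = z" "?W y = z \<Longrightarrow> ?S y \<le> ?S (X z) + 1" if "z \<in> ?R" for z y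
    using bspec[OF XX that] by simp_all
  have "\<forall>z\<in>?R. \<exists>y. y \<in> F \<and> bowen_dist f (n * N) y (X z) \<le> \<epsilon>"
    using F(2) unfolding spanning_def by auto
  from bchoice[OF this] obtain y where yy: "\<forall>z\<in>?R. y z \<in> F \<and> bowen_dist f (n * N) (y z) (X z) \<le> \<epsilon>"
    by (elim exE)
  have yF: "y z \<in> F" and yd: "bowen_dist f (n * N) (y z) (X z) \<le> \<epsilon>" if "z \<in> ?R" for z
    using bspec[OF yy that] by simp_all
  define \<alpha> where "\<alpha> z = ?S (X z) + 1" for z
  have 1: "?S x \<le> \<alpha> (?W x)" for x unfolding \<alpha>_def by (rule X(2)) auto
  have card: "card {z \<in> ?R. y z = p} \<le> 2 ^ n" for p
  proof -
    \<comment> \<open>The one symbol other than \<open>None\<close> that these names can show at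
      time \<open>i\<close>; if they show none, the choice is arbitrary and
      \<open>{None, u i}\<close> still contains their symbol.\<close>
    define u where "u i = (SOME w. w \<noteq> None \<and> (\<exists>z\<in>?R. y z = p \<and> z i = w))" for i
    have "z i \<in> {None, u i}" if z: "z \<in> ?R" "y z = p" and i: "i < n" for z i
    proof (cases "z i = None")
      case False
      then have "\<exists>w. w \<noteq> None \<and> (\<exists>z\<in>?R. y z = p \<and> z i = w)"
        using z by (intro exI[of _ "z i"] conjI bexI[of _ z]) simp_all
      from someI_ex[OF this] have "u i \<noteq> None \<and> (\<exists>z'\<in>?R. y z' = p \<and> z' i = u i)"
        unfolding u_def .
      then obtain z' where z': "u i \<noteq> None" "z' \<in> ?R" "y z' = p" "z' i = u i" by (elim conjE bexE)
      have ev: "t i = Z ((f ^^ (N * i)) (X t))" if "t \<in> ?R" for t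
      proof -
        have "t i = ?W (X t) i" using X(1)[OF that] by simp
        then show ?thesis using i by (simp add: itinerary_def funpow_mult)
      qed
      have Ni: "N * i < n * N" using i N by (simp add: mult.commute)
      have "dist ((f ^^ (N * i)) p) ((f ^^ (N * i)) (X z)) \<le> \<epsilon>"
        using bowen_dist_leD[OF yd[OF z(1)] Ni] z(2) by simp
      moreover have "dist ((f ^^ (N * i)) p) ((f ^^ (N * i)) (X z')) \<le> \<epsilon>"
        using bowen_dist_leD[OF yd[OF z'(2)] Ni] z'(3) by simp
      ultimately have "dist ((f ^^ (N * i)) (X z)) ((f ^^ (N * i)) (X z')) \<le> 2 * \<epsilon>"
        using dist_triangle3[of "(f ^^ (N * i)) (X z)" "(f ^^ (N * i)) (X z')" "(f ^^ (N * i)) p"] by linarith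
      then have nd: "\<not> d \<le> dist ((f ^^ (N * i)) (X z)) ((f ^^ (N * i)) (X z'))" using \<epsilon> by linarith
      have n1: "Z ((f ^^ (N * i)) (X z)) \<noteq> None" using False ev[OF z(1)] by simp
      have n2: "Z ((f ^^ (N * i)) (X z')) \<noteq> None" using z'(1,4) ev[OF z'(2)] by simp
      have "Z ((f ^^ (N * i)) (X z)) = Z ((f ^^ (N * i)) (X z'))"
        by (rule ccontr) (rule notE[OF nd sep[OF n1 n2]])
      then show ?thesis using ev[OF z(1)] ev[OF z'(2)] z'(4) by simp
    qed simp
    moreover have "z \<in> extensional {..<n}" if "z \<in> ?R" for z
    proof -
      have "?W (X z) \<in> extensional {..<n}" unfolding itinerary_def by (rule restrict_extensional)
      then show ?thesis using X(1)[OF that] by simp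
    qed
    ultimately have sub: "{z \<in> ?R. y z = p} \<subseteq> PiE {..<n} (\<lambda>i. {None, u i})"
      by (intro subsetI) (simp add: PiE_iff)
    have "card {z \<in> ?R. y z = p} \<le> card (PiE {..<n} (\<lambda>i. {None, u i}))"
      by (rule card_mono[OF _ sub]) (auto intro: finite_PiE)
    also have "\<dots> = (\<Prod>i<n. card {None, u i})" by (simp add: card_PiE)
    also have "\<dots> \<le> (\<Prod>i<n. 2)" by (intro prod_mono) (simp add: card_insert_le_m1)
    finally show ?thesis by simp
  qed
  have "(\<Sum>z\<in>?R. exp (?S (y z))) = (\<Sum>p\<in>F. \<Sum>z\<in>{z \<in> ?R. y z = p}. exp (?S (y z)))"
    using R F(1) yF by (intro sum.group[symmetric]) (simp_all add: image_subset_iff)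
  also have "\<dots> = (\<Sum>p\<in>F. real (card {z \<in> ?R. y z = p}) * exp (?S p))" by (intro sum.cong) simp_all
  also have "\<dots> \<le> (\<Sum>p\<in>F. 2 ^ n * exp (?S p))"
  proof (intro sum_mono mult_right_mono)
    fix p show "real (card {z \<in> ?R. y z = p}) \<le> 2 ^ n"
      using of_nat_mono[OF card[of p], where 'a=real] by simp
  qed simp
  finally have 2: "(\<Sum>z\<in>?R. exp (?S (y z))) \<le> 2 ^ n * (\<Sum>p\<in>F. exp (?S p))" by (simp add: sum_distrib_left)
  have "exp (\<alpha> z) \<le> exp (real (n * N) * v + 1) * exp (?S (y z))" if "z \<in> ?R" for z
  proof -
    have "\<bar>?S (y z) - ?S (X z)\<bar> \<le> real (n * N) * v"
      by (rule birkhoff_sum_close[OF bowen_dist_leD[OF yd[OF that]] var])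
    then have "\<alpha> z \<le> real (n * N) * v + 1 + ?S (y z)" unfolding \<alpha>_def by linarith
    then show ?thesis by (simp flip: exp_add)
  qed
  then have 3: "(\<Sum>z\<in>?R. exp (\<alpha> z)) \<le> (\<Sum>z\<in>?R. exp (real (n * N) * v + 1) * exp (?S (y z)))"
    by (rule sum_mono)
  have "exp (real (n * N) * v + 1) * (\<Sum>z\<in>?R. exp (?S (y z)))
      \<le> exp (real (n * N) * v + 1) * (2 ^ n * (\<Sum>p\<in>F. exp (?S p)))"
    using 2 by (rule mult_left_mono) simp
  then show ?thesis by (intro that[OF 1] order_trans[OF 3]) (simp only: sum_distrib_left)
qed

lemma uniformly_continuous_UNIV:
  fixes \<Phi> :: "'a::metric_space \<Rightarrow> real"
  assumes "compact (UNIV :: 'a set)" "continuous_on UNIV \<Phi>" "r > 0"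
  obtains \<delta> where "\<delta> > 0" "\<And>x y. dist x y \<le> \<delta> \<Longrightarrow> \<bar>\<Phi> x - \<Phi> y\<bar> \<le> r"
proof -
  have "uniformly_continuous_on UNIV \<Phi>" using assms by (intro compact_uniformly_continuous)
  from uniformly_continuous_onE[OF this assms(3)] obtain d
    where d: "d > 0" "\<And>x y. dist y x < d \<Longrightarrow> dist (\<Phi> y) (\<Phi> x) < r" by (metis UNIV_I)
  show ?thesis
  proof (rule that[of "d/2"])
    show "d/2 > 0" using d by simp
    fix x y :: 'a assume "dist x y \<le> d/2"
    then have "dist x y < d" using d(1) by linarith
    from d(2)[OF this] show "\<bar>\<Phi> x - \<Phi> y\<bar> \<le> r" by (simp add: dist_real_def)
  qed
qed

lemma continuous_funpow:
  assumes "continuous_on UNIV (f :: 'a::topological_space \<Rightarrow> 'a)"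
  shows "continuous_on UNIV (f ^^ i)"
proof (induction i)
  case 0 then show ?case by (simp add: continuous_on_id)
next
  case (Suc i)
  have "continuous_on UNIV (f \<circ> f ^^ i)"
    using Suc continuous_on_subset[OF assms] by (intro continuous_on_compose) auto
  then show ?case by simp
qed

lemma continuous_comp_funpow:
  assumes "continuous_on UNIV (f :: 'a::topological_space \<Rightarrow> 'a)" "continuous_on UNIV \<Phi>"
  shows "continuous_on UNIV (\<lambda>x. \<Phi> ((f ^^ i) x))"
  using continuous_on_compose2[OF assms(2) continuous_funpow[OF assms(1)]] by simp

lemma continuous_birkhoff_sum:
  fixes \<Phi> :: "'a::topological_space \<Rightarrow> real"
  assumes "continuous_on UNIV f" "continuous_on UNIV \<Phi>"
  shows "continuous_on UNIV (birkhoff_sum f \<Phi> n)"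
  unfolding birkhoff_sum_def using continuous_comp_funpow[OF assms] by (intro continuous_on_sum)

locale compact_invariant_measure = invariant_measure f M
  for f :: "'a::metric_space \<Rightarrow> 'a" and M +
  assumes compact_UNIV: "compact (UNIV :: 'a set)" and f_continuous: "continuous_on UNIV f"
begin

lemma integral_birkhoff_sum:
  assumes \<Phi>: "continuous_on UNIV \<Phi>"
  shows "(\<integral>x. birkhoff_sum f \<Phi> n x \<partial>M) = real n * (\<integral>x. \<Phi> x \<partial>M)"
proof -
  have "(\<integral>x. birkhoff_sum f \<Phi> n x \<partial>M) = (\<Sum>i<n. \<integral>x. \<Phi> ((f ^^ i) x) \<partial>M)"
    unfolding birkhoff_sum_def
    by (intro Bochner_Integration.integral_sum borel_prob_integrable[OF compact_UNIV borel_prob]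
        continuous_comp_funpow[OF f_continuous \<Phi>])
  also have "\<dots> = (\<Sum>i<n. \<integral>x. \<Phi> x \<partial>M)"
    by (intro sum.cong refl integral_funpow borel_measurable_continuous_onI \<Phi>)
  finally show ?thesis by simp
qed

text \<open>The partition into names of length \<open>N\<close> is replaced by disjoint closed cells plus one small remainder;
  an orbit piece then meets at most two cells per step, whose cost \<open>ln 2\<close> is divided by \<open>N\<close>.\<close>

lemma process_rate_block_bound:
  fixes X :: "'a \<Rightarrow> 'k" and N :: nat
  assumes \<Phi>: "continuous_on UNIV \<Phi>" and X: "simple_function M X" and N: "N > 0" and r: "r > 0"
    and span: "\<exists>\<epsilon>0>0. \<forall>\<epsilon>. 0 < \<epsilon> \<and> \<epsilon> \<le> \<epsilon>0 \<longrightarrow> (\<exists>C. \<forall>\<^sub>F n in sequentially. \<exists>F. finite F \<and>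
      spanning f n \<epsilon> UNIV F \<and> (\<Sum>x\<in>F. exp (birkhoff_sum f \<Phi> n x)) \<le> exp (C + r * real n))"
  shows "process_rate X + (\<integral>x. \<Phi> x \<partial>M) \<le> (1 + ln 2) / N + 2 * r"
proof -
  interpret g: invariant_measure "f ^^ N" M by (rule invariant_measure_funpow)
  define Y where "Y = itinerary f X {..<N}"
  have Y: "simple_function M Y"
    unfolding Y_def using simple_funpow[OF X] by (intro simple_itinerary) auto
  have reg: "\<exists>C. closed C \<and> C \<subseteq> A \<and> measure M (A - C) < e" if A: "A \<in> sets borel" and "e > 0" for A e
  proof -
    from closed_inner_outer_regular[OF borel_prob that]
    obtain C U where CU: "closed C" "open U" "C \<subseteq> A" "A \<subseteq> U" "measure M (U - C) < e" by (elim exE conjE)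
    have "measure M (A - C) \<le> measure M (U - C)"
      using CU by (intro finite_measure_mono) (auto simp: sets_eq)
    then show ?thesis using CU by (intro exI[of _ C]) simp
  qed
  obtain B where B: "\<And>v. v \<in> range Y \<Longrightarrow> closed (B v)" "\<And>v. v \<in> range Y \<Longrightarrow> B v \<subseteq> Y -` {v}"
    and sZ: "simple_function M (\<lambda>x. if x \<in> B (Y x) then Some (Y x) else None)"
    and HZ: "rv_entropy M (\<lambda>x. (Y x, if x \<in> B (Y x) then Some (Y x) else None))
      \<le> rv_entropy M (\<lambda>x. if x \<in> B (Y x) then Some (Y x) else None) + 1"
    by (rule closed_approximation[OF reg Y]) blast+
  define Z where "Z x = (if x \<in> B (Y x) then Some (Y x) else None)" for x
  note sZ = sZ[folded Z_def] and HZ = HZ[folded Z_def]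
  have finV: "finite (range Y)" using Y by (simp add: simple_iff)
  have disj: "B v \<inter> B w = {}" if "v \<in> range Y" "w \<in> range Y" "v \<noteq> w" for v w
  proof (rule equals0I)
    fix x assume "x \<in> B v \<inter> B w"
    then have "x \<in> Y -` {v}" "x \<in> Y -` {w}" using B(2)[OF that(1)] B(2)[OF that(2)] by (meson IntD1 IntD2 subsetD)+
    then show False using that(3) by simp
  qed
  obtain d where d: "d > 0"
    "\<And>v w x y. \<lbrakk>v \<in> range Y; w \<in> range Y; v \<noteq> w; x \<in> B v; y \<in> B w\<rbrakk> \<Longrightarrow> d \<le> dist x y"
    by (rule disjoint_closed_separated[OF compact_UNIV finV B(1) disj]) blast+
  have sep: "d \<le> dist x y" if "Z x \<noteq> None" "Z y \<noteq> None" "Z x \<noteq> Z y" for x y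
    using that by (intro d(2)[of "Y x" "Y y"]) (simp_all add: Z_def split: if_splits)
  obtain \<delta> where \<delta>: "\<delta> > 0" "\<And>x y. dist x y \<le> \<delta> \<Longrightarrow> \<bar>\<Phi> x - \<Phi> y\<bar> \<le> r"
    by (rule uniformly_continuous_UNIV[OF compact_UNIV \<Phi> r]) blast
  from span obtain \<epsilon>0 where \<epsilon>0: "\<epsilon>0 > 0" "\<forall>\<epsilon>. 0 < \<epsilon> \<and> \<epsilon> \<le> \<epsilon>0 \<longrightarrow> (\<exists>C. \<forall>\<^sub>F n in sequentially. \<exists>F. finite F \<and>
      spanning f n \<epsilon> UNIV F \<and> (\<Sum>x\<in>F. exp (birkhoff_sum f \<Phi> n x)) \<le> exp (C + r * real n))"
    by (elim exE conjE)
  \<comment> \<open>\<open>\<epsilon>0\<close> gives the growth bound, \<open>d/3\<close> yields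
    \<open>2 * \<epsilon> < d\<close> for the separation of the closed cells, and
    \<open>\<delta>\<close> controls the variation of \<open>\<Phi>\<close>.\<close>
  define \<epsilon> where "\<epsilon> = min \<epsilon>0 (min (d/3) \<delta>)"
  have \<epsilon>: "\<epsilon> > 0" "\<epsilon> \<le> \<epsilon>0" "2 * \<epsilon> < d" "\<epsilon> \<le> \<delta>" using \<epsilon>0(1) d(1) \<delta>(1) by (auto simp: \<epsilon>_def)
  from \<epsilon>0(2)[rule_format, OF conjI[OF \<epsilon>(1) \<epsilon>(2)]] obtain C where C: "\<forall>\<^sub>F n in sequentially. \<exists>F. finite F \<and>
      spanning f n \<epsilon> UNIV F \<and> (\<Sum>x\<in>F. exp (birkhoff_sum f \<Phi> n x)) \<le> exp (C + r * real n)"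
    by (rule exE)
  let ?W = "\<lambda>n. itinerary (f ^^ N) Z {..<n}"
  have sW: "simple_function M (?W n)" for n using g.simple_funpow[OF sZ] by (intro simple_itinerary) auto
  \<comment> \<open>Per block of length \<open>N\<close> there is a cost 1 for replacing
    \<open>Y\<close> by \<open>Z\<close> and \<open>ln 2\<close> for the count of names; per unit of
    time a cost \<open>r\<close> for the variation of \<open>\<Phi>\<close> and another
    \<open>r\<close> for the spanning sums.\<close>
  have main: "rv_entropy M (itinerary f X {..<n * N}) + real (n * N) * (\<integral>x. \<Phi> x \<partial>M)
      \<le> real n * (1 + ln 2) + 2 * r * real (n * N) + 1 + C"
    if F: "finite F" "spanning f (n * N) \<epsilon> UNIV F"
      "(\<Sum>x\<in>F. exp (birkhoff_sum f \<Phi> (n * N) x)) \<le> exp (C + r * real (n * N))" for n F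
  proof -
    let ?S = "birkhoff_sum f \<Phi> (n * N)"
    have cS: "continuous_on UNIV ?S" by (rule continuous_birkhoff_sum[OF f_continuous \<Phi>])
    obtain b where b: "\<And>x. \<bar>?S x\<bar> \<le> b" by (rule continuous_UNIV_bounded[OF compact_UNIV cS]) blast
    have bb: "?S x \<le> b" for x using b[of x] by simp
    have var: "\<bar>\<Phi> x - \<Phi> y\<bar> \<le> r" if "dist x y \<le> \<epsilon>" for x y using that \<epsilon>(4) by (intro \<delta>(2)) simp
    have fR: "finite (range (?W n))" using sW by (simp add: simple_iff)
    obtain \<alpha> where \<alpha>: "\<And>x. ?S x \<le> \<alpha> (?W n x)"
      "(\<Sum>z\<in>range (?W n). exp (\<alpha> z)) \<le> exp (real (n * N) * r + 1) * (2 ^ n * (\<Sum>x\<in>F. exp (?S x)))"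
      by (rule spanning_cell_count[OF sep \<epsilon>(3) N F(1,2) var bb fR]) blast+
    have pos: "(\<Sum>z\<in>range (?W n). exp (\<alpha> z)) > 0" using fR by (intro sum_pos) auto
    have "(\<Sum>z\<in>range (?W n). exp (\<alpha> z)) \<le> exp (real (n * N) * r + 1) * (2 ^ n * exp (C + r * real (n * N)))"
      using F(3) by (intro order_trans[OF \<alpha>(2)] mult_left_mono) auto
    also have "\<dots> = exp (real (n * N) * r + 1 + (real n * ln 2 + (C + r * real (n * N))))"
    proof -
      have "2 ^ n = exp (real n * ln 2)" by (simp add: exp_of_nat_mult)
      then show ?thesis by (simp only: exp_add[symmetric])
    qed
    finally have le: "(\<Sum>z\<in>range (?W n). exp (\<alpha> z)) \<le> exp (real (n * N) * r + 1 + (real n * ln 2 + (C + r * real (n * N))))" .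
    have "ln (\<Sum>z\<in>range (?W n). exp (\<alpha> z)) \<le> real (n * N) * r + 1 + (real n * ln 2 + (C + r * real (n * N)))"
      using iffD2[OF ln_le_cancel_iff[OF pos exp_gt_zero] le] by (simp only: ln_exp)
    moreover have "rv_entropy M (?W n) + (\<integral>x. ?S x \<partial>M) \<le> ln (\<Sum>z\<in>range (?W n). exp (\<alpha> z))"
      by (rule gibbs_integral[OF sW borel_prob_integrable[OF compact_UNIV borel_prob cS] \<alpha>(1) integral_comp_simple[OF sW]])
    moreover have "rv_entropy M (itinerary (f ^^ N) Y {..<n}) \<le> rv_entropy M (?W n) + real n * 1"
      by (rule g.rv_entropy_itinerary_conditional[OF Y sZ HZ])
    moreover have "rv_entropy M (itinerary f X {..<n * N}) \<le> rv_entropy M (itinerary (f ^^ N) Y {..<n})"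
    proof -
      have sYn: "simple_function M (itinerary (f ^^ N) Y {..<n})"
        using g.simple_funpow[OF Y] by (intro simple_itinerary) auto
      have "itinerary f X {..<n * N} = (\<lambda>x. (\<lambda>a. \<lambda>t\<in>{..<n * N}. a (t div N) (t mod N)) (itinerary (f ^^ N) Y {..<n} x))"
        by (intro ext) (simp only: itinerary_block[OF N] Y_def)
      then show ?thesis
        using rv_entropy_comp_le[OF sYn, of "\<lambda>a. \<lambda>t\<in>{..<n * N}. a (t div N) (t mod N)"] by (simp only:)
    qed
    ultimately show ?thesis unfolding integral_birkhoff_sum[OF \<Phi>] by (simp add: algebra_simps)
  qed
  have flim: "filterlim (\<lambda>n. n * N) sequentially sequentially"
    using N by (intro filterlim_subseq) (simp add: strict_mono_def)
  have ev: "\<forall>\<^sub>F n in sequentially. rv_entropy M (itinerary f X {..<n * N}) / real (n * N) + (\<integral>x. \<Phi> x \<partial>M)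
      \<le> ((1 + ln 2) / N + 2 * r) + (1 + C) / N * (1 / real n)"
    using filterlim_iff[THEN iffD1, OF flim, rule_format, OF C] eventually_gt_at_top[of 0]
  proof eventually_elim
    case (elim n)
    then obtain F where F: "finite F" "spanning f (n * N) \<epsilon> UNIV F"
      "(\<Sum>x\<in>F. exp (birkhoff_sum f \<Phi> (n * N) x)) \<le> exp (C + r * real (n * N))" by (elim exE conjE)
    have p: "real n > 0" "real N > 0" using elim(2) N by auto
    have "rv_entropy M (itinerary f X {..<n * N}) / real (n * N) + (\<integral>x. \<Phi> x \<partial>M)
        = (rv_entropy M (itinerary f X {..<n * N}) + real (n * N) * (\<integral>x. \<Phi> x \<partial>M)) / real (n * N)"
      using p by (simp add: add_divide_distrib)
    also have "\<dots> \<le> (real n * (1 + ln 2) + 2 * r * real (n * N) + 1 + C) / real (n * N)"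
      by (rule divide_right_mono[OF main[OF F]]) simp
    also have "\<dots> = ((1 + ln 2) / N + 2 * r) + (1 + C) / N * (1 / real n)"
      using p by (simp add: add_divide_distrib mult.commute)
    finally show ?case .
  qed
  have lim1: "(\<lambda>n. rv_entropy M (itinerary f X {..<n * N}) / real (n * N) + (\<integral>x. \<Phi> x \<partial>M))
      \<longlonglongrightarrow> process_rate X + (\<integral>x. \<Phi> x \<partial>M)"
    by (rule tendsto_add[OF filterlim_compose[OF process_rate_tendsto[OF X] flim] tendsto_const])
  have lim2: "(\<lambda>n. ((1 + ln 2) / N + 2 * r) + (1 + C) / N * (1 / real n))
      \<longlonglongrightarrow> ((1 + ln 2) / N + 2 * r) + (1 + C) / N * 0"
    by (rule tendsto_add[OF tendsto_const tendsto_mult[OF tendsto_const lim_1_over_n]])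
  from tendsto_le[OF sequentially_bot lim2 lim1 ev] show ?thesis by simp
qed

text \<open>The cost per block does not depend on the block length, so long blocks together with
  small \<open>r\<close> remove both error terms.\<close>

theorem process_rate_le_spanning_growth:
  fixes X :: "'a \<Rightarrow> 'k"
  assumes \<Phi>: "continuous_on UNIV \<Phi>" and X: "simple_function M X"
    and span: "\<And>r. r > 0 \<Longrightarrow> \<exists>\<epsilon>0>0. \<forall>\<epsilon>. 0 < \<epsilon> \<and> \<epsilon> \<le> \<epsilon>0 \<longrightarrow> (\<exists>C. \<forall>\<^sub>F n in sequentially. \<exists>F. finite F \<and>
      spanning f n \<epsilon> UNIV F \<and> (\<Sum>x\<in>F. exp (birkhoff_sum f \<Phi> n x)) \<le> exp (C + r * real n))"
  shows "process_rate X + (\<integral>x. \<Phi> x \<partial>M) \<le> 0"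
proof (rule field_le_epsilon)
  fix e :: real assume e: "e > 0"
  obtain N where N: "real N > (1 + ln 2) / (e/2)" using reals_Archimedean2 by blast
  have "(1 + ln 2) / (e/2) > 0" using e by (intro divide_pos_pos add_pos_pos) auto
  then have N0: "real N > 0" using N by linarith
  have "process_rate X + (\<integral>x. \<Phi> x \<partial>M) \<le> (1 + ln 2) / N + 2 * (e/4)"
    using N0 e by (intro process_rate_block_bound[OF \<Phi> X _ _ span]) auto
  moreover have "(1 + ln 2) / N \<le> e/2"
    using N N0 e by (simp add: field_simps)
  ultimately show "process_rate X + (\<integral>x. \<Phi> x \<partial>M) \<le> 0 + e" by linarith
qed

end

subsection \<open>Empirical measures of separated sets\<close>

lemma invariant_probsI:
  fixes f :: "'a::metric_space \<Rightarrow> 'a"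
  assumes c: "compact (UNIV :: 'a set)" and f: "continuous_on UNIV f" and M: "M \<in> borel_probs"
    and eq: "\<And>g :: 'a \<Rightarrow> real. continuous_on UNIV g \<Longrightarrow> (\<integral>x. g (f x) \<partial>M) = (\<integral>x. g x \<partial>M)"
  shows "M \<in> invariant_probs f"
proof -
  have sM: "sets M = sets borel" using M by (simp add: space_prob_algebra)
  have fm: "f \<in> M \<rightarrow>\<^sub>M borel"
    using borel_measurable_continuous_onI[OF f] sM by (simp cong: measurable_cong_sets)
  interpret prob_space M using M by (simp add: space_prob_algebra)
  have D: "distr M borel f \<in> borel_probs" using prob_space_distr[OF fm] by (simp add: space_prob_algebra)
  have "distr M borel f = M"
  proof (rule borel_probs_eqI[OF c D M])
    fix g :: "'a \<Rightarrow> real" assume g: "continuous_on UNIV g"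
    have "(\<integral>x. g x \<partial>distr M borel f) = (\<integral>x. g (f x) \<partial>M)"
      by (rule integral_distr[OF fm borel_measurable_continuous_onI[OF g]])
    then show "(\<integral>x. g x \<partial>distr M borel f) = (\<integral>x. g x \<partial>M)" using eq[OF g] by simp
  qed
  then show ?thesis using M by (simp add: invariant_probs_def)
qed

text \<open>Stands for a set with \<open>M\<close>-null boundary, encoded by continuous bounds from
  both sides: convergence of functionals on continuous functions then passes to the indicator by
  squeezing, with no Borel measures behind the approximants.\<close>

definition jordan_set :: "'a::topological_space measure \<Rightarrow> 'a set \<Rightarrow> bool" where
  "jordan_set M A \<longleftrightarrow> A \<in> sets borel \<and> (\<forall>e>0. \<exists>g h :: 'a \<Rightarrow> real. continuous_on UNIV g \<and> continuous_on UNIV h \<and>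
     (\<forall>x. g x \<le> indicator A x \<and> indicator A x \<le> h x) \<and> (\<integral>x. h x \<partial>M) - (\<integral>x. g x \<partial>M) < e)"

lemma jordan_set_borel: "jordan_set M A \<Longrightarrow> A \<in> sets borel"
  by (simp add: jordan_set_def)

lemma jordan_setE:
  assumes "jordan_set M A" "e > 0"
  obtains g h :: "'a::topological_space \<Rightarrow> real" where "continuous_on UNIV g" "continuous_on UNIV h"
    "\<And>x. g x \<le> indicator A x" "\<And>x. indicator A x \<le> h x" "(\<integral>x. h x \<partial>M) - (\<integral>x. g x \<partial>M) < e"
proof -
  have "\<exists>g h :: 'a \<Rightarrow> real. continuous_on UNIV g \<and> continuous_on UNIV h \<and>
     (\<forall>x. g x \<le> indicator A x \<and> indicator A x \<le> h x) \<and> (\<integral>x. h x \<partial>M) - (\<integral>x. g x \<partial>M) < e"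
    using assms by (simp add: jordan_set_def)
  then show ?thesis using that by (elim exE conjE) simp
qed

lemma jordan_setI:
  assumes "A \<in> sets borel" "\<And>e. e > 0 \<Longrightarrow> \<exists>g h :: 'a::topological_space \<Rightarrow> real. continuous_on UNIV g \<and> continuous_on UNIV h \<and>
     (\<forall>x. g x \<le> indicator A x \<and> indicator A x \<le> h x) \<and> (\<integral>x. h x \<partial>M) - (\<integral>x. g x \<partial>M) < e"
  shows "jordan_set M A"
  using assms by (simp add: jordan_set_def)

context
  fixes M :: "'a::metric_space measure"
  assumes c: "compact (UNIV :: 'a set)" and M: "M \<in> borel_probs"
begin

lemma prob_space_M: "prob_space M" using M by (simp add: space_prob_algebra)

lemma integrable_M: "continuous_on UNIV g \<Longrightarrow> integrable M (g :: 'a \<Rightarrow> real)"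
  by (rule borel_prob_integrable[OF c M])

lemma jordan_set_empty: "jordan_set M {}"
  by (rule jordan_setI) (auto intro!: exI[of _ "\<lambda>_. 0"])

lemma jordan_set_Compl:
  assumes A: "jordan_set M A"
  shows "jordan_set M (- A)"
proof (rule jordan_setI)
  show "- A \<in> sets borel" using A by (simp add: jordan_set_def borel_comp)
  interpret prob_space M by (rule prob_space_M)
  fix e :: real assume "e > 0"
  from A this obtain g h :: "'a \<Rightarrow> real" where gh: "continuous_on UNIV g" "continuous_on UNIV h"
    "\<And>x. g x \<le> indicator A x" "\<And>x. indicator A x \<le> h x" "(\<integral>x. h x \<partial>M) - (\<integral>x. g x \<partial>M) < e"
    by (rule jordan_setE) blast
  have i: "(indicator (- A) x :: real) = 1 - indicator A x" for x by (simp add: indicator_def)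
  have "(\<integral>x. 1 - g x \<partial>M) = 1 - (\<integral>x. g x \<partial>M)" "(\<integral>x. 1 - h x \<partial>M) = 1 - (\<integral>x. h x \<partial>M)"
    using integrable_M[OF gh(1)] integrable_M[OF gh(2)] by (simp_all add: prob_space)
  then show "\<exists>g h :: 'a \<Rightarrow> real. continuous_on UNIV g \<and> continuous_on UNIV h \<and>
     (\<forall>x. g x \<le> indicator (- A) x \<and> indicator (- A) x \<le> h x) \<and> (\<integral>x. h x \<partial>M) - (\<integral>x. g x \<partial>M) < e"
    using gh by (intro exI[of _ "\<lambda>x. 1 - h x"] exI[of _ "\<lambda>x. 1 - g x"])
      (simp add: i continuous_on_diff continuous_on_const)
qed

text \<open>The minima of the bounds are bounds for the intersection, and their gap is at most the
  sum of the two gaps.\<close>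

lemma jordan_set_Int:
  assumes A: "jordan_set M A" and B: "jordan_set M B"
  shows "jordan_set M (A \<inter> B)"
proof (rule jordan_setI)
  show "A \<inter> B \<in> sets borel" by (rule sets.Int[OF jordan_set_borel[OF A] jordan_set_borel[OF B]])
  fix e :: real assume "e > 0"
  then have e2: "e / 2 > 0" by simp
  from A e2 obtain g h :: "'a \<Rightarrow> real" where gh: "continuous_on UNIV g" "continuous_on UNIV h"
    "\<And>x. g x \<le> indicator A x" "\<And>x. indicator A x \<le> h x" "(\<integral>x. h x \<partial>M) - (\<integral>x. g x \<partial>M) < e / 2"
    by (rule jordan_setE) blast
  from B e2 obtain g' h' :: "'a \<Rightarrow> real" where gh': "continuous_on UNIV g'" "continuous_on UNIV h'"
    "\<And>x. g' x \<le> indicator B x" "\<And>x. indicator B x \<le> h' x" "(\<integral>x. h' x \<partial>M) - (\<integral>x. g' x \<partial>M) < e / 2"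
    by (rule jordan_setE) blast
  let ?g = "\<lambda>x. min (g x) (g' x)" and ?h = "\<lambda>x. min (h x) (h' x)"
  have cg: "continuous_on UNIV ?g" and ch: "continuous_on UNIV ?h"
    by (intro continuous_on_min gh gh')+
  have "(\<integral>x. ?h x \<partial>M) - (\<integral>x. ?g x \<partial>M) = (\<integral>x. ?h x - ?g x \<partial>M)"
    by (rule Bochner_Integration.integral_diff[symmetric]) (rule integrable_M cg ch)+
  also have "\<dots> \<le> (\<integral>x. (h x - g x) + (h' x - g' x) \<partial>M)"
  proof (rule integral_mono)
    show "integrable M (\<lambda>x. ?h x - ?g x)" by (intro Bochner_Integration.integrable_diff integrable_M cg ch)
    show "integrable M (\<lambda>x. (h x - g x) + (h' x - g' x))"
      by (intro Bochner_Integration.integrable_diff Bochner_Integration.integrable_add integrable_M gh gh')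
    fix x
    have "g x \<le> h x" "g' x \<le> h' x" using gh(3,4)[of x] gh'(3,4)[of x] by linarith+
    then show "?h x - ?g x \<le> (h x - g x) + (h' x - g' x)" by (simp add: min_def)
  qed
  also have "\<dots> = ((\<integral>x. h x \<partial>M) - (\<integral>x. g x \<partial>M)) + ((\<integral>x. h' x \<partial>M) - (\<integral>x. g' x \<partial>M))"
    using integrable_M[OF gh(1)] integrable_M[OF gh(2)] integrable_M[OF gh'(1)] integrable_M[OF gh'(2)] by simp
  also have "\<dots> < e" using gh(5) gh'(5) by linarith
  finally have lt: "(\<integral>x. ?h x \<partial>M) - (\<integral>x. ?g x \<partial>M) < e" .
  have b: "?g x \<le> indicator (A \<inter> B) x \<and> indicator (A \<inter> B) x \<le> ?h x" for x
    using gh(3,4)[of x] gh'(3,4)[of x] by (cases "x \<in> A"; cases "x \<in> B") (auto simp: min_def)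
  show "\<exists>g h :: 'a \<Rightarrow> real. continuous_on UNIV g \<and> continuous_on UNIV h \<and>
     (\<forall>x. g x \<le> indicator (A \<inter> B) x \<and> indicator (A \<inter> B) x \<le> h x) \<and> (\<integral>x. h x \<partial>M) - (\<integral>x. g x \<partial>M) < e"
    by (rule exI[of _ ?g], rule exI[of _ ?h]) (intro conjI cg ch allI lt b[THEN conjunct1] b[THEN conjunct2])
qed

lemma jordan_set_UNIV: "jordan_set M UNIV"
  using jordan_set_Compl[OF jordan_set_empty] by simp

lemma jordan_set_INT:
  assumes "finite I" "\<And>i. i \<in> I \<Longrightarrow> jordan_set M (A i)"
  shows "jordan_set M (\<Inter>i\<in>I. A i)"
  using assms by (induction I rule: finite_induct) (simp_all add: jordan_set_UNIV jordan_set_Int)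

text \<open>The spheres around \<open>x\<close> are disjoint, so only countably many carry mass and
  some radius below \<open>r\<close> has a null sphere. Ramps in \<open>dist x\<close> then squeeze
  the indicator of the ball, and their difference tends to the indicator of that sphere.\<close>

lemma ball_jordan_radius:
  assumes "0 < r"
  obtains s where "0 < s" "s < r" "jordan_set M (ball x s)"
proof -
  interpret prob_space M by (rule prob_space_M)
  have sM: "sets M = sets borel" using M by (simp add: space_prob_algebra)
  have UM: "space M = UNIV" using M by (rule space_borel_prob)
  have dm: "dist x \<in> M \<rightarrow>\<^sub>M borel"
    using borel_measurable_continuous_onI[of "dist x"] sM by (simp cong: measurable_cong_sets add: continuous_on_dist)
  interpret D: prob_space "distr M borel (dist x)" by (rule prob_space_distr[OF dm])
  have "countable {s. measure (distr M borel (dist x)) {s} \<noteq> 0}" by (rule D.countable_support)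
  then have "\<not> {0<..<r} \<subseteq> {s. measure (distr M borel (dist x)) {s} \<noteq> 0}"
    using uncountable_open_interval[of 0 r] assms countable_subset by blast
  then have "\<exists>s. s \<in> {0<..<r} \<and> measure (distr M borel (dist x)) {s} = 0"
    by (simp only: subset_eq Ball_def mem_Collect_eq not_all not_imp not_not)
  then obtain s where s: "s \<in> {0<..<r}" "measure (distr M borel (dist x)) {s} = 0" by (elim exE conjE)
  have sph: "measure M {y. dist x y = s} = 0"
  proof -
    have "dist x -` {s} = {y. dist x y = s}" by auto
    then show ?thesis using s(2) measure_distr[OF dm, of "{s}"] by (simp add: UM)
  qed
  have "jordan_set M (ball x s)"
  proof (rule jordan_setI)
    fix e :: real assume e: "e > 0"
    define g where "g k y = min 1 (real k * max 0 (s - dist x y))" for k y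
    define h where "h k y = 1 - min 1 (real k * max 0 (dist x y - s))" for k y
    have cg: "continuous_on UNIV (g k)" and ch: "continuous_on UNIV (h k)" for k
      unfolding g_def h_def by (intro continuous_intros)+
    have gle: "g k y \<le> indicator (ball x s) y" for k y
      by (cases "dist x y < s") (simp_all add: g_def)
    have hge: "indicator (ball x s) y \<le> h k y" for k y
      by (cases "dist x y < s") (simp_all add: h_def)
    have bnd: "norm (h k y - g k y) \<le> 1" for k y
    proof -
      have "0 \<le> g k y" "h k y \<le> 1" by (simp_all add: g_def h_def)
      then show ?thesis using gle[of k y] hge[of y k] by simp
    qed
    have arch: "\<forall>\<^sub>F k in sequentially. min 1 (real k * t) = 1" if t: "t > 0" for t :: real
    proof -
      obtain m where m: "real m * t > 1" using reals_Archimedean3[OF t] by auto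
      show ?thesis using eventually_ge_at_top[of m]
      proof eventually_elim
        case (elim k)
        have "real m * t \<le> real k * t" using elim t by (intro mult_right_mono) auto
        then show ?case using m by simp
      qed
    qed
    have lim: "(\<lambda>k. h k y - g k y) \<longlonglongrightarrow> indicator {y. dist x y = s} y" for y
    proof (cases "dist x y" s rule: linorder_cases)
      case less
      then have "max 0 (s - dist x y) > 0" by simp
      from arch[OF this] have "\<forall>\<^sub>F k in sequentially. h k y - g k y = 0"
        by eventually_elim (use less in \<open>simp add: g_def h_def\<close>)
      then show ?thesis using less by (simp add: tendsto_eventually)
    next
      case equal
      then have "h k y - g k y = 1" for k by (simp add: g_def h_def)
      then show ?thesis using equal by simp
    next
      case greater
      then have "max 0 (dist x y - s) > 0" by simp
      from arch[OF this] have "\<forall>\<^sub>F k in sequentially. h k y - g k y = 0"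
        by eventually_elim (use greater in \<open>simp add: g_def h_def\<close>)
      then show ?thesis using greater by (simp add: tendsto_eventually)
    qed
    have cl: "{y. dist x y = s} \<in> sets M"
      unfolding sM by (intro borel_closed closed_Collect_eq continuous_intros)
    have "(\<lambda>k. \<integral>y. h k y - g k y \<partial>M) \<longlonglongrightarrow> (\<integral>y. indicator {y. dist x y = s} y \<partial>M)"
    proof (rule integral_dominated_convergence[where w="\<lambda>_. 1"])
      show "AE y in M. (\<lambda>k. h k y - g k y) \<longlonglongrightarrow> indicator {y. dist x y = s} y" by (rule AE_I2) (rule lim)
      show "(\<lambda>y. indicator {y. dist x y = s} y :: real) \<in> borel_measurable M" using cl by simp
      show "(\<lambda>y. h k y - g k y) \<in> borel_measurable M" for k
        by (intro borel_measurable_integrable Bochner_Integration.integrable_diff integrable_M cg ch)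
      show "AE y in M. norm (h k y - g k y) \<le> 1" for k by (rule AE_I2) (rule bnd)
    qed simp
    moreover have "(\<integral>y. indicator {y. dist x y = s} y \<partial>M) = (0::real)" using cl sph by (simp add: UM)
    ultimately have "(\<lambda>k. \<integral>y. h k y - g k y \<partial>M) \<longlonglongrightarrow> 0" by (simp only:)
    from eventually_happens[OF order_tendstoD(2)[OF this e]] obtain k where k: "(\<integral>y. h k y - g k y \<partial>M) < e" by auto
    have "(\<integral>y. h k y - g k y \<partial>M) = (\<integral>y. h k y \<partial>M) - (\<integral>y. g k y \<partial>M)"
      by (rule Bochner_Integration.integral_diff) (rule integrable_M cg ch)+
    then show "\<exists>g h :: 'a \<Rightarrow> real. continuous_on UNIV g \<and> continuous_on UNIV h \<and>
     (\<forall>y. g y \<le> indicator (ball x s) y \<and> indicator (ball x s) y \<le> h y) \<and> (\<integral>x. h x \<partial>M) - (\<integral>x. g x \<partial>M) < e"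
      using cg[of k] ch[of k] k gle[of k] hge[of _ k] by (intro exI[of _ "g k"] exI[of _ "h k"]) simp
  qed simp
  then show ?thesis using s(1) by (intro that[of s]) simp_all
qed

text \<open>Compactness gives a finite cover by Jordan balls of radius below
  \<open>\<epsilon>/2\<close>; sending a point to the first ball that contains it makes the cells
  Boolean combinations of Jordan sets.\<close>

lemma jordan_partition:
  assumes "\<epsilon> > 0"
  obtains X :: "'a \<Rightarrow> nat" where "finite (range X)" "\<And>x y. X x = X y \<Longrightarrow> dist x y \<le> \<epsilon>"
    "\<And>v. jordan_set M (X -` {v})"
proof -
  have "\<forall>x. \<exists>s. 0 < s \<and> s < \<epsilon>/2 \<and> jordan_set M (ball x s)"
  proof
    fix x
    have "\<epsilon>/2 > 0" using assms by simp
    then obtain s where "0 < s" "s < \<epsilon>/2" "jordan_set M (ball x s)" by (rule ball_jordan_radius)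
    then show "\<exists>s. 0 < s \<and> s < \<epsilon>/2 \<and> jordan_set M (ball x s)" by (intro exI[of _ s]) simp
  qed
  from choice[OF this] obtain s where ss: "\<forall>x. 0 < s x \<and> s x < \<epsilon>/2 \<and> jordan_set M (ball x (s x))" by (elim exE)
  then have s: "0 < s x" "s x < \<epsilon>/2" "jordan_set M (ball x (s x))" for x by simp_all
  have "UNIV \<subseteq> (\<Union>x\<in>UNIV. ball x (s x))" using s(1) by auto
  from compactE_image[OF c open_ball this] obtain D where D: "finite D" "UNIV \<subseteq> (\<Union>x\<in>D. ball x (s x))"
    by metis
  obtain xs where xs: "set xs = D" using finite_list[OF D(1)] by auto
  define U where "U i = ball (xs ! i) (s (xs ! i))" for i
  define X where "X y = (LEAST i. i < length xs \<and> y \<in> U i)" for y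
  have X: "X y < length xs \<and> y \<in> U (X y)" for y
    unfolding X_def
  proof (rule LeastI_ex)
    have "y \<in> (\<Union>x\<in>D. ball x (s x))" by (rule subsetD[OF D(2) UNIV_I])
    then obtain z where "z \<in> set xs" "y \<in> ball z (s z)" unfolding xs by (rule UN_E)
    then show "\<exists>i. i < length xs \<and> y \<in> U i" by (auto simp: in_set_conv_nth U_def)
  qed
  have Xiff: "X y = v \<longleftrightarrow> v < length xs \<and> y \<in> U v \<and> (\<forall>i<v. y \<notin> U i)" for y v
  proof
    assume e: "X y = v"
    have "y \<notin> U i" if "i < v" for i
    proof
      assume "y \<in> U i"
      then have "X y \<le> i" unfolding X_def using X[of y] e that by (intro Least_le) simp
      then show False using e that by simp
    qed
    then show "v < length xs \<and> y \<in> U v \<and> (\<forall>i<v. y \<notin> U i)" using X[of y] e by simp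
  next
    assume v: "v < length xs \<and> y \<in> U v \<and> (\<forall>i<v. y \<notin> U i)"
    then have "X y \<le> v" unfolding X_def by (intro Least_le) simp
    moreover have "\<not> X y < v" using v X[of y] by auto
    ultimately show "X y = v" by simp
  qed
  show ?thesis
  proof (rule that[of X])
    show "finite (range X)" by (rule finite_subset[of _ "{..<length xs}"]) (use X in auto)
    fix x y assume "X x = X y"
    then have "x \<in> U (X x)" "y \<in> U (X x)" using X[of x] X[of y] by simp_all
    then have "dist (xs ! X x) x < \<epsilon>/2" "dist (xs ! X x) y < \<epsilon>/2"
      using s(2)[of "xs ! X x"] by (simp_all add: U_def)
    then show "dist x y \<le> \<epsilon>" using dist_triangle3[of x y "xs ! X x"] by linarith
  next
    fix v
    have J: "jordan_set M (U i)" for i unfolding U_def by (rule s(3))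
    show "jordan_set M (X -` {v})"
    proof (cases "v < length xs")
      case True
      then have "X -` {v} = U v \<inter> (\<Inter>i\<in>{..<v}. - U i)"
      proof (intro set_eqI)
        fix y show "y \<in> X -` {v} \<longleftrightarrow> y \<in> U v \<inter> (\<Inter>i\<in>{..<v}. - U i)"
          using Xiff[of y v] True by auto
      qed
      then show ?thesis
        using J by (simp only: jordan_set_Int jordan_set_INT jordan_set_Compl finite_lessThan)
    next
      case False
      then have "X -` {v} = {}" by (intro equals0I) (simp add: Xiff)
      then show ?thesis by (simp add: jordan_set_empty)
    qed
  qed
qed

end

text \<open>Both bounds are composed with the iterate; invariance of \<open>M\<close> preserves the
  gap between their integrals.\<close>

lemma jordan_set_vimage_funpow:
  assumes "compact_invariant_measure f M" and A: "jordan_set M A"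
  shows "jordan_set M ((f ^^ i) -` A)"
proof -
  interpret compact_invariant_measure f M by fact
  show ?thesis
  proof (rule jordan_setI)
    show "(f ^^ i) -` A \<in> sets borel"
      using measurable_sets[OF funpow_measurable, of A i] A by (simp add: jordan_set_def)
    fix e :: real assume "e > 0"
    from A this obtain g h :: "'a \<Rightarrow> real" where gh: "continuous_on UNIV g" "continuous_on UNIV h"
      "\<And>x. g x \<le> indicator A x" "\<And>x. indicator A x \<le> h x" "(\<integral>x. h x \<partial>M) - (\<integral>x. g x \<partial>M) < e"
      by (rule jordan_setE) blast
    have ig: "(\<integral>x. g ((f ^^ i) x) \<partial>M) = (\<integral>x. g x \<partial>M)" and ih: "(\<integral>x. h ((f ^^ i) x) \<partial>M) = (\<integral>x. h x \<partial>M)"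
      by (intro integral_funpow borel_measurable_continuous_onI gh)+
    have "(indicator ((f ^^ i) -` A) x :: real) = indicator A ((f ^^ i) x)" for x by (simp add: indicator_def)
    then show "\<exists>g h :: 'a \<Rightarrow> real. continuous_on UNIV g \<and> continuous_on UNIV h \<and>
     (\<forall>x. g x \<le> indicator ((f ^^ i) -` A) x \<and> indicator ((f ^^ i) -` A) x \<le> h x) \<and> (\<integral>x. h x \<partial>M) - (\<integral>x. g x \<partial>M) < e"
      using gh(3,4,5) continuous_comp_funpow[OF f_continuous gh(1)] continuous_comp_funpow[OF f_continuous gh(2)]
      by (intro exI[of _ "\<lambda>x. g ((f ^^ i) x)"] exI[of _ "\<lambda>x. h ((f ^^ i) x)"]) (simp add: ig ih)
  qed
qed

text \<open>Convexity of \<open>t ln t\<close> in the form of the tangent line at the mean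
  \<open>a\<close>, namely \<open>t ln a + (t - a) \<le> t ln t\<close>, summed over
  \<open>i\<close>; the terms \<open>t i - a\<close> cancel.\<close>

lemma jensen_mult_ln:
  fixes t :: "nat \<Rightarrow> real"
  assumes t: "\<And>i. 0 \<le> t i" and n: "n > 0"
  shows "real n * ((\<Sum>i<n. t i) / n * ln ((\<Sum>i<n. t i) / n)) \<le> (\<Sum>i<n. t i * ln (t i))"
proof -
  define a where "a = (\<Sum>i<n. t i) / n"
  have na: "(\<Sum>i<n. t i) = real n * a" using n by (simp add: a_def)
  have a: "a \<ge> 0" using t by (simp add: a_def sum_nonneg)
  show ?thesis
  proof (cases "a = 0")
    case True
    then have "(\<Sum>i<n. t i) = 0" using na by simp
    then have "\<forall>i\<in>{..<n}. t i = 0" using t by (subst (asm) sum_nonneg_eq_0_iff) auto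
    then have "(\<Sum>i<n. t i * ln (t i)) = 0" by (intro sum.neutral) simp
    then show ?thesis using True by (simp add: a_def[symmetric])
  next
    case False
    then have a0: "a > 0" using a by simp
    have "t i * ln a + (t i - a) \<le> t i * ln (t i)" for i
    proof (cases "t i = 0")
      case True then show ?thesis using a by simp
    next
      case False
      then have ti: "t i > 0" using t[of i] by simp
      have "ln (a / t i) \<le> a / t i - 1" using ti a0 by (intro ln_le_minus_one) simp
      then have "t i * (ln a - ln (t i)) \<le> t i * (a / t i - 1)"
        using ti a0 by (intro mult_left_mono) (simp_all add: ln_div)
      then show ?thesis using ti by (simp add: algebra_simps)
    qed
    then have "(\<Sum>i<n. t i * ln a + (t i - a)) \<le> (\<Sum>i<n. t i * ln (t i))" by (intro sum_mono)
    moreover have "(\<Sum>i<n. t i * ln a + (t i - a)) = real n * a * ln a"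
      by (simp add: sum.distrib sum_subtractf sum_distrib_right[symmetric] na)
    ultimately show ?thesis by (simp add: a_def[symmetric])
  qed
qed

text \<open>The starting points \<open>i\<close> of the blocks run over one residue class modulo \<open>q\<close>.\<close>

lemma residue_blocks_cover:
  assumes "j < q"
  shows "{..<n} \<subseteq> {..<q} \<union> (\<Union>i\<in>{i\<in>{..<n}. i mod q = j}. (+) i ` {..<q :: nat})"
proof
  fix t assume "t \<in> {..<n}"
  then have t: "t < n" by simp
  show "t \<in> {..<q} \<union> (\<Union>i\<in>{i\<in>{..<n}. i mod q = j}. (+) i ` {..<q})"
  proof (cases "t < q")
    case False
    define s where "s = (t - j) mod q"
    define i where "i = j + q * ((t - j) div q)"
    have "t = j + (t - j)" using False assms by simp
    also have "t - j = q * ((t - j) div q) + s" by (simp add: s_def)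
    finally have ts: "t = i + s" by (simp add: i_def)
    have "s < q" using assms by (simp add: s_def)
    moreover have "i mod q = j" using assms by (simp add: i_def)
    moreover have "i < n" using ts t by simp
    ultimately show ?thesis by (intro UnI2 UN_I[of i]) (simp_all add: ts)
  qed simp
qed

text \<open>A functional rather than a Borel measure: a \<open>pmf\<close> measures all subsets, so
  indicators of arbitrary fibres can be inserted, and limits are taken through
  \<open>positive_functional\<close>.\<close>

definition empirical_average :: "('a \<Rightarrow> 'a) \<Rightarrow> 'a pmf \<Rightarrow> nat \<Rightarrow> ('a \<Rightarrow> real) \<Rightarrow> real" where
  "empirical_average f \<sigma> n g = (\<Sum>i<n. measure_pmf.expectation \<sigma> (\<lambda>x. g ((f ^^ i) x))) / real n"

lemma finite_rv_space_pmf: "finite_rv_space (measure_pmf \<sigma>)"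
  by unfold_locales simp

lemma simple_function_pmf: "simple_function (measure_pmf \<sigma>) Y" if "finite (range Y)"
  using that finite_rv_space.simple_iff[OF finite_rv_space_pmf, of \<sigma> Y] by simp

lemma finite_range_itinerary:
  assumes "finite (range X)" "finite I"
  shows "finite (range (itinerary f X I))"
proof (rule finite_subset)
  show "range (itinerary f X I) \<subseteq> PiE I (\<lambda>_. range X)"
    by (intro image_subsetI) (simp add: itinerary_def)
  show "finite (PiE I (\<lambda>_. range X))" using assms by (intro finite_PiE)
qed

lemma empirical_average_indicator:
  "empirical_average f \<sigma> n (indicator (Y -` {v})) = (\<Sum>i<n. measure (measure_pmf \<sigma>) ((\<lambda>x. Y ((f ^^ i) x)) -` {v})) / n"
proof -
  have "measure_pmf.expectation \<sigma> (\<lambda>x. indicator (Y -` {v}) ((f ^^ i) x)) =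
      measure (measure_pmf \<sigma>) ((\<lambda>x. Y ((f ^^ i) x)) -` {v})" for i
  proof -
    have "(\<lambda>x. indicator (Y -` {v}) ((f ^^ i) x) :: real) = indicator ((\<lambda>x. Y ((f ^^ i) x)) -` {v})"
      by (auto simp: indicator_def fun_eq_iff)
    then show ?thesis by simp
  qed
  then show ?thesis by (simp add: empirical_average_def)
qed

lemma expectation_birkhoff_sum:
  assumes fin: "finite (set_pmf \<sigma>)" and n: "n > 0"
  shows "measure_pmf.expectation \<sigma> (birkhoff_sum f \<Phi> n) = real n * empirical_average f \<sigma> n \<Phi>"
proof -
  have "measure_pmf.expectation \<sigma> (birkhoff_sum f \<Phi> n) = (\<Sum>i<n. measure_pmf.expectation \<sigma> (\<lambda>x. \<Phi> ((f ^^ i) x)))"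
    unfolding birkhoff_sum_def
    by (rule Bochner_Integration.integral_sum) (rule integrable_measure_pmf_finite[OF fin])
  then show ?thesis using n by (simp add: empirical_average_def)
qed

text \<open>Gibbs weights give equality in the Gibbs inequality: the logarithm of each weight is
  \<open>S x - ln Z\<close>, and by injectivity a fibre of \<open>Y\<close> carries the weight of at
  most one point.\<close>

lemma gibbs_pmf_entropy:
  assumes fin: "finite (set_pmf \<sigma>)" "finite (range Y)" and inj: "inj_on Y (set_pmf \<sigma>)"
    and w: "\<And>x. x \<in> set_pmf \<sigma> \<Longrightarrow> pmf \<sigma> x = exp (S x) / Z" and Z: "Z > 0"
  shows "ln Z = rv_entropy (measure_pmf \<sigma>) Y + measure_pmf.expectation \<sigma> S"
proof -
  let ?E = "set_pmf \<sigma>" and ?\<mu> = "measure (measure_pmf \<sigma>)"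
  have m: "?\<mu> (Y -` {Y x}) = pmf \<sigma> x" if "x \<in> ?E" for x
  proof -
    have "Y -` {Y x} \<inter> ?E = {x}" using inj that by (auto simp: inj_on_def)
    then show ?thesis using measure_Int_set_pmf[of \<sigma> "Y -` {Y x}"] by (simp add: measure_pmf_single)
  qed
  have "(\<Sum>v\<in>range Y. ?\<mu> (Y -` {v}) * ln (?\<mu> (Y -` {v}))) = (\<Sum>v\<in>Y ` ?E. ?\<mu> (Y -` {v}) * ln (?\<mu> (Y -` {v})))"
  proof (rule sum.mono_neutral_right)
    show "\<forall>v\<in>range Y - Y ` ?E. ?\<mu> (Y -` {v}) * ln (?\<mu> (Y -` {v})) = 0"
    proof
      fix v assume v: "v \<in> range Y - Y ` ?E"
      have "?E \<inter> Y -` {v} = {}"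
      proof (rule equals0I)
        fix x assume "x \<in> ?E \<inter> Y -` {v}"
        then have "x \<in> ?E" "v = Y x" by simp_all
        then have "v \<in> Y ` ?E" by (simp only: imageI)
        then show False using v by simp
      qed
      then have "?\<mu> (Y -` {v}) = 0" by (simp add: measure_pmf_zero_iff)
      then show "?\<mu> (Y -` {v}) * ln (?\<mu> (Y -` {v})) = 0" by simp
    qed
  qed (use fin in auto)
  also have "\<dots> = (\<Sum>x\<in>?E. pmf \<sigma> x * ln (pmf \<sigma> x))"
    using m by (subst sum.reindex[OF inj]) (simp add: comp_def)
  also have "\<dots> = (\<Sum>x\<in>?E. S x * pmf \<sigma> x - pmf \<sigma> x * ln Z)"
  proof (rule sum.cong[OF refl])
    fix x assume "x \<in> ?E"
    then have "ln (pmf \<sigma> x) = S x - ln Z" using w Z by (simp add: ln_div)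
    then show "pmf \<sigma> x * ln (pmf \<sigma> x) = S x * pmf \<sigma> x - pmf \<sigma> x * ln Z"
      by (simp only: right_diff_distrib mult.commute[of "pmf \<sigma> x" "S x"])
  qed
  also have "\<dots> = (\<Sum>x\<in>?E. S x * pmf \<sigma> x) - ln Z"
    using sum_pmf_eq_1[OF fin(1) subset_refl] by (simp add: sum_subtractf sum_distrib_right[symmetric])
  also have "(\<Sum>x\<in>?E. S x * pmf \<sigma> x) = measure_pmf.expectation \<sigma> S"
    using fin(1) by (intro integral_measure_pmf_real[symmetric]) auto
  finally show ?thesis by (simp add: rv_entropy_def)
qed

text \<open>Cutting \<open>{..<n}\<close> into blocks of length \<open>q\<close> can start in
  \<open>q\<close> ways. Summing over all of them uses every \<open>i < n\<close> as a starting
  point exactly once, which produces the average that Jensen's inequality compares with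
  \<open>empirical_average\<close>; the initial piece costs at most the logarithm of the number of
  names.\<close>

lemma misiurewicz_inequality:
  fixes X :: "'a \<Rightarrow> 'k"
  assumes fin: "finite (set_pmf \<sigma>)" "finite (range X)" and n: "n > 0" and q: "q > 0"
    and inj: "inj_on (itinerary f X {..<n}) (set_pmf \<sigma>)"
    and w: "\<And>x. x \<in> set_pmf \<sigma> \<Longrightarrow> pmf \<sigma> x = exp (birkhoff_sum f \<Phi> n x) / Z" and Z: "Z > 0"
  shows "ln Z \<le> real n / real q * (- (\<Sum>v\<in>range (itinerary f X {..<q}).
        empirical_average f \<sigma> n (indicator (itinerary f X {..<q} -` {v})) *
        ln (empirical_average f \<sigma> n (indicator (itinerary f X {..<q} -` {v})))))
      + ln (card (range (itinerary f X {..<q}))) + real n * empirical_average f \<sigma> n \<Phi>"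
proof -
  interpret finite_rv_space "measure_pmf \<sigma>" by (rule finite_rv_space_pmf)
  let ?H = "\<lambda>I. rv_entropy (measure_pmf \<sigma>) (itinerary f X I)"
  let ?Y = "itinerary f X {..<q}"
  let ?V = "range ?Y"
  let ?p = "\<lambda>v. empirical_average f \<sigma> n (indicator (?Y -` {v}))"
  have sX: "simple_function (measure_pmf \<sigma>) (\<lambda>x. X ((f ^^ i) x))" for i
    by (rule simple_function_pmf, rule finite_subset[OF _ fin(2)]) auto
  have finV: "finite ?V" by (rule finite_range_itinerary[OF fin(2)]) simp
  have sY: "simple_function (measure_pmf \<sigma>) ?Y" by (rule simple_function_pmf[OF finV])
  let ?h = "\<lambda>i. rv_entropy (measure_pmf \<sigma>) (\<lambda>x. ?Y ((f ^^ i) x))"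
  have one: "?H {..<n} \<le> ?H {..<q} + (\<Sum>i\<in>{i\<in>{..<n}. i mod q = j}. ?h i)" if j: "j < q" for j
  proof -
    let ?B = "\<Union>i\<in>{i\<in>{..<n}. i mod q = j}. (+) i ` {..<q}"
    \<comment> \<open>The last block may run past \<open>n\<close>; surplus times can only enlarge
      the entropy.\<close>
    have "?H {..<n} \<le> ?H ({..<q} \<union> ?B)"
      by (rule rv_entropy_itinerary_mono[OF _ sX residue_blocks_cover[OF j]]) simp
    also have "\<dots> \<le> ?H {..<q} + ?H ?B"
      by (rule rv_entropy_itinerary_Un[OF _ _ sX]) simp_all
    also have "?H ?B \<le> (\<Sum>i\<in>{i\<in>{..<n}. i mod q = j}. ?H ((+) i ` {..<q}))"
      by (rule rv_entropy_itinerary_UN[OF _ _ sX]) simp_all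
    also have "\<dots> = (\<Sum>i\<in>{i\<in>{..<n}. i mod q = j}. ?h i)"
      by (rule sum.cong[OF refl]) (rule rv_entropy_itinerary_shift[OF _ sX], simp)
    finally show ?thesis by simp
  qed
  have "(\<Sum>j<q. ?H {..<n}) \<le> (\<Sum>j<q. ?H {..<q} + (\<Sum>i\<in>{i\<in>{..<n}. i mod q = j}. ?h i))"
    by (rule sum_mono) (rule one, simp)
  also have "\<dots> = real q * ?H {..<q} + (\<Sum>j<q. \<Sum>i\<in>{i\<in>{..<n}. i mod q = j}. ?h i)"
    by (simp add: sum.distrib)
  also have "(\<Sum>j<q. \<Sum>i\<in>{i\<in>{..<n}. i mod q = j}. ?h i) = (\<Sum>i<n. ?h i)"
    using q by (intro sum.group) auto
  finally have 1: "real q * ?H {..<n} \<le> real q * ?H {..<q} + (\<Sum>i<n. ?h i)" by simp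
  let ?t = "\<lambda>v i. measure (measure_pmf \<sigma>) ((\<lambda>x. ?Y ((f ^^ i) x)) -` {v})"
  have hi: "?h i = - (\<Sum>v\<in>?V. ?t v i * ln (?t v i))" for i
    by (rule rv_entropy_superset[OF finV]) auto
  have p: "?p v = (\<Sum>i<n. ?t v i) / n" for v by (rule empirical_average_indicator)
  have "real n * (\<Sum>v\<in>?V. ?p v * ln (?p v)) = (\<Sum>v\<in>?V. real n * (?p v * ln (?p v)))"
    by (rule sum_distrib_left)
  also have "\<dots> \<le> (\<Sum>v\<in>?V. \<Sum>i<n. ?t v i * ln (?t v i))"
    unfolding p by (rule sum_mono) (rule jensen_mult_ln[OF measure_nonneg n])
  also have "\<dots> = (\<Sum>i<n. \<Sum>v\<in>?V. ?t v i * ln (?t v i))" by (rule sum.swap)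
  also have "\<dots> = - (\<Sum>i<n. ?h i)" unfolding hi by (simp add: sum_negf)
  finally have 2: "(\<Sum>i<n. ?h i) \<le> real n * (- (\<Sum>v\<in>?V. ?p v * ln (?p v)))" by simp
  have 3: "?H {..<q} \<le> ln (card ?V)" by (rule rv_entropy_le_card[OF sY])
  have "real q * ?H {..<n} \<le> real q * ln (card ?V) + real n * (- (\<Sum>v\<in>?V. ?p v * ln (?p v)))"
    using 1 2 mult_left_mono[OF 3, of "real q"] by linarith
  then have "?H {..<n} \<le> (real q * ln (card ?V) + real n * (- (\<Sum>v\<in>?V. ?p v * ln (?p v)))) / real q"
    using q by (subst pos_le_divide_eq) (simp_all add: mult.commute)
  also have "\<dots> = real n / real q * (- (\<Sum>v\<in>?V. ?p v * ln (?p v))) + ln (card ?V)"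
    using q by (simp add: add_divide_distrib diff_divide_distrib)
  finally have 4: "?H {..<n} \<le> real n / real q * (- (\<Sum>v\<in>?V. ?p v * ln (?p v))) + ln (card ?V)" .
  have "ln Z = ?H {..<n} + measure_pmf.expectation \<sigma> (birkhoff_sum f \<Phi> n)"
    by (rule gibbs_pmf_entropy[OF fin(1) finite_range_itinerary[OF fin(2)] inj w Z]) simp_all
  then show ?thesis using 4 expectation_birkhoff_sum[OF fin(1) n, of f \<Phi>] by linarith
qed

lemma gibbs_pmf_exists:
  fixes w :: "'a \<Rightarrow> real"
  assumes E: "finite E" "E \<noteq> {}" and w: "\<And>x. w x > 0"
  obtains \<sigma> where "set_pmf \<sigma> = E" "\<And>x. x \<in> E \<Longrightarrow> pmf \<sigma> x = w x / (\<Sum>x\<in>E. w x)"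
proof -
  define Z where "Z = (\<Sum>x\<in>E. w x)"
  have Z: "Z > 0" unfolding Z_def using E w by (intro sum_pos)
  define p where "p x = (if x \<in> E then w x / Z else 0)" for x
  have p0: "0 \<le> p x" for x using w[of x] Z by (simp add: p_def)
  have "(\<integral>\<^sup>+x. ennreal (p x) \<partial>count_space UNIV) = (\<Sum>x\<in>E. ennreal (p x))"
    using E by (intro nn_integral_count_space') (auto simp: p_def)
  also have "\<dots> = ennreal (\<Sum>x\<in>E. p x)" using p0 by (simp add: sum_ennreal)
  also have "(\<Sum>x\<in>E. p x) = 1" using Z by (simp add: p_def sum_divide_distrib[symmetric] Z_def[symmetric])
  finally have 1: "(\<integral>\<^sup>+x. ennreal (p x) \<partial>count_space UNIV) = 1" by simp
  have pm: "pmf (embed_pmf p) x = p x" for x by (rule pmf_embed_pmf[OF p0 1])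
  show ?thesis
  proof (rule that[of "embed_pmf p"])
    show "set_pmf (embed_pmf p) = E"
    proof (intro set_eqI)
      fix x
      have "w x \<noteq> 0" using w[of x] by simp
      then show "x \<in> set_pmf (embed_pmf p) \<longleftrightarrow> x \<in> E" using Z by (simp add: set_pmf_iff pm p_def)
    qed
    show "\<And>x. x \<in> E \<Longrightarrow> pmf (embed_pmf p) x = w x / (\<Sum>x\<in>E. w x)" by (simp add: pm p_def Z_def)
  qed
qed

lemma empirical_average_mono:
  assumes "finite (set_pmf \<sigma>)" "\<And>x. g x \<le> h x"
  shows "empirical_average f \<sigma> n g \<le> empirical_average f \<sigma> n h"
  unfolding empirical_average_def
  by (intro divide_right_mono sum_mono integral_mono integrable_measure_pmf_finite assms) simp

lemma positive_functional_empirical_average: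
  assumes c: "compact (UNIV :: 'a::metric_space set)" and fin: "finite (set_pmf \<sigma>)" and n: "n > 0"
  shows "positive_functional (empirical_average f (\<sigma> :: 'a pmf) n)"
proof
  show "compact (UNIV :: 'a set)" by (rule c)
  note int = integrable_measure_pmf_finite[OF fin]
  fix g h :: "'a \<Rightarrow> real" and r :: real
  show "empirical_average f \<sigma> n (\<lambda>x. g x + h x) = empirical_average f \<sigma> n g + empirical_average f \<sigma> n h"
    unfolding empirical_average_def
    by (simp add: Bochner_Integration.integral_add[OF int int] sum.distrib add_divide_distrib)
  show "empirical_average f \<sigma> n (\<lambda>x. r * g x) = r * empirical_average f \<sigma> n g"
    unfolding empirical_average_def by (simp add: sum_distrib_left)
  show "0 \<le> empirical_average f \<sigma> n g" if "\<And>x. 0 \<le> g x"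
    unfolding empirical_average_def using that
    by (intro divide_nonneg_nonneg sum_nonneg Bochner_Integration.integral_nonneg) simp_all
  show "empirical_average f \<sigma> n (\<lambda>_. 1) = 1"
    unfolding empirical_average_def using n by simp
qed

text \<open>Shifting the window of times by one step telescopes, so only the two end terms
  survive.\<close>

lemma empirical_average_almost_invariant:
  assumes fin: "finite (set_pmf \<sigma>)" and B: "\<And>x. \<bar>g x\<bar> \<le> B" and n: "n > 0"
  shows "\<bar>empirical_average f \<sigma> n (\<lambda>x. g (f x)) - empirical_average f \<sigma> n g\<bar> \<le> 2 * B / real n"
proof -
  define a where "a i = measure_pmf.expectation \<sigma> (\<lambda>x. g ((f ^^ i) x))" for i
  have ab: "\<bar>a i\<bar> \<le> B" for i
  proof -
    have "\<bar>a i\<bar> \<le> measure_pmf.expectation \<sigma> (\<lambda>x. \<bar>g ((f ^^ i) x)\<bar>)"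
      unfolding a_def by (rule integral_abs_bound)
    also have "\<dots> \<le> measure_pmf.expectation \<sigma> (\<lambda>_. B)"
      by (intro integral_mono integrable_measure_pmf_finite[OF fin] B)
    finally show ?thesis by simp
  qed
  have "(\<Sum>i<n. a (Suc i)) - (\<Sum>i<n. a i) = a n - a 0"
    by (simp only: sum_subtractf[symmetric] sum_lessThan_telescope)
  moreover have "empirical_average f \<sigma> n (\<lambda>x. g (f x)) = (\<Sum>i<n. a (Suc i)) / n"
    by (simp add: empirical_average_def a_def)
  moreover have "empirical_average f \<sigma> n g = (\<Sum>i<n. a i) / n"
    by (simp add: empirical_average_def a_def)
  ultimately have "empirical_average f \<sigma> n (\<lambda>x. g (f x)) - empirical_average f \<sigma> n g = (a n - a 0) / n"
    by (simp add: diff_divide_distrib[symmetric])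
  moreover have "\<bar>a n - a 0\<bar> \<le> 2 * B" using ab[of n] ab[of 0] by linarith
  ultimately show ?thesis using n by (simp add: divide_right_mono)
qed

text \<open>Only the limit 0 is delicate: there \<open>t ln t\<close> is squeezed by
  \<open>2 sqrt t + t^2\<close>, a bound valid for all nonnegative \<open>t\<close>.\<close>

lemma tendsto_mult_ln:
  fixes p :: "'b \<Rightarrow> real"
  assumes p: "(p \<longlongrightarrow> a) F" and nn: "\<And>k. 0 \<le> p k"
  shows "((\<lambda>k. p k * ln (p k)) \<longlongrightarrow> a * ln a) F"
proof (cases "a = 0")
  case False
  then show ?thesis by (intro tendsto_mult tendsto_ln p)
next
  case True
  have lim: "((\<lambda>k. 2 * sqrt (p k) + (p k)^2) \<longlongrightarrow> 2 * sqrt 0 + 0^2) F"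
    using p unfolding True by (intro tendsto_add tendsto_mult tendsto_const tendsto_real_sqrt tendsto_power)
  have bound: "\<bar>t * ln t\<bar> \<le> 2 * sqrt t + t^2" if "0 \<le> t" for t :: real
  proof (cases "t \<le> 1")
    case True
    then show ?thesis using neg_mult_ln_le_sqrt[OF that] mult_ln_nonpos[OF that True] zero_le_power2[of t] by linarith
  next
    case False
    then have "ln t \<le> t - 1" "0 \<le> ln t" by (auto intro: ln_le_minus_one)
    then have "t * ln t \<le> t * t" "0 \<le> t * ln t" using that False by (auto intro!: mult_left_mono)
    moreover have "0 \<le> sqrt t" using that by simp
    ultimately show ?thesis unfolding power2_eq_square by linarith
  qed
  have "((\<lambda>k. p k * ln (p k)) \<longlongrightarrow> 0) F"
  proof (rule Lim_null_comparison)
    show "\<forall>\<^sub>F k in F. norm (p k * ln (p k)) \<le> 2 * sqrt (p k) + (p k)^2"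
      using bound[OF nn] by (intro always_eventually allI) simp
    show "((\<lambda>k. 2 * sqrt (p k) + (p k)^2) \<longlongrightarrow> 0) F" using lim by simp
  qed
  then show ?thesis using True by simp
qed

text \<open>Misiurewicz's construction: every weak-star limit of the Gibbs-weighted empirical measures works.\<close>

theorem separated_sets_entropy:
  fixes f :: "'a::metric_space \<Rightarrow> 'a" and \<Phi> :: "'a \<Rightarrow> real"
  assumes c: "compact (UNIV :: 'a set)" and f: "continuous_on UNIV f" and \<Phi>: "continuous_on UNIV \<Phi>"
    and \<epsilon>: "\<epsilon> > 0" and m: "filterlim m sequentially sequentially" "\<And>k. m k > 0"
    and E: "\<And>k. finite (E k)" "\<And>k. E k \<noteq> {}"
    and sep: "\<And>k x y. x \<in> E k \<Longrightarrow> y \<in> E k \<Longrightarrow> x \<noteq> y \<Longrightarrow> \<exists>i<m k. \<epsilon> < dist ((f ^^ i) x) ((f ^^ i) y)"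
    and lower: "\<And>k. exp (- C) \<le> (\<Sum>x\<in>E k. exp (birkhoff_sum f \<Phi> (m k) x))"
  obtains M where "M \<in> invariant_probs f" "ereal (- (\<integral>x. \<Phi> x \<partial>M)) \<le> measure_entropy f M"
proof -
  define Z where "Z k = (\<Sum>x\<in>E k. exp (birkhoff_sum f \<Phi> (m k) x))" for k
  have Zlow: "exp (- C) \<le> Z k" for k unfolding Z_def by (rule lower)
  have Z: "Z k > 0" for k using Zlow[of k] exp_gt_zero[of "- C"] by linarith
  have "\<forall>k. \<exists>\<sigma>. set_pmf \<sigma> = E k \<and> (\<forall>x\<in>E k. pmf \<sigma> x = exp (birkhoff_sum f \<Phi> (m k) x) / Z k)"
  proof
    fix k
    obtain \<sigma> where "set_pmf \<sigma> = E k"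
      "\<And>x. x \<in> E k \<Longrightarrow> pmf \<sigma> x = exp (birkhoff_sum f \<Phi> (m k) x) / (\<Sum>x\<in>E k. exp (birkhoff_sum f \<Phi> (m k) x))"
      by (rule gibbs_pmf_exists[OF E, of "\<lambda>x. exp (birkhoff_sum f \<Phi> (m k) x)" k]) (simp, blast)
    then show "\<exists>\<sigma>. set_pmf \<sigma> = E k \<and> (\<forall>x\<in>E k. pmf \<sigma> x = exp (birkhoff_sum f \<Phi> (m k) x) / Z k)"
      by (intro exI[of _ \<sigma>]) (simp add: Z_def)
  qed
  from choice[OF this] obtain \<sigma> where
    \<sigma>\<sigma>: "\<forall>k. set_pmf (\<sigma> k) = E k \<and> (\<forall>x\<in>E k. pmf (\<sigma> k) x = exp (birkhoff_sum f \<Phi> (m k) x) / Z k)" by (elim exE)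
  have \<sigma>E: "set_pmf (\<sigma> k) = E k" for k using \<sigma>\<sigma> by simp
  have \<sigma>w: "pmf (\<sigma> k) x = exp (birkhoff_sum f \<Phi> (m k) x) / Z k" if "x \<in> set_pmf (\<sigma> k)" for k x
    using \<sigma>\<sigma> that by simp
  have fin: "finite (set_pmf (\<sigma> k))" for k by (simp add: \<sigma>E E)
  let ?L = "\<lambda>k. empirical_average f (\<sigma> k) (m k)"
  have pf: "positive_functional (?L k)" for k
    by (rule positive_functional_empirical_average[OF c fin m(2)])
  obtain F M where F: "F \<noteq> bot" "F \<le> sequentially" and M: "M \<in> borel_probs"
    and lim: "\<And>g. continuous_on UNIV g \<Longrightarrow> ((\<lambda>k. ?L k g) \<longlongrightarrow> (\<integral>x. g x \<partial>M)) F"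
    by (rule weak_star_cluster_point[OF c, where Ls = ?L, OF pf]) blast
  have mF: "filterlim (\<lambda>k. real (m k)) at_infinity F"
    using filterlim_compose[OF filterlim_real_sequentially filterlim_mono[OF m(1) order_refl F(2)]]
    by (rule filterlim_at_top_imp_at_infinity)
  have dm: "((\<lambda>k. a / real (m k)) \<longlongrightarrow> 0) F" for a
    by (rule tendsto_divide_0[OF tendsto_const mF])
  have inv: "(\<integral>x. g (f x) \<partial>M) = (\<integral>x. g x \<partial>M)" if g: "continuous_on UNIV g" for g :: "'a \<Rightarrow> real"
  proof -
    obtain B where B: "\<And>x. \<bar>g x\<bar> \<le> B" by (rule continuous_UNIV_bounded[OF c g]) blast
    have gf: "continuous_on UNIV (\<lambda>x. g (f x))" using continuous_comp_funpow[OF f g, of 1] by simp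
    have "((\<lambda>k. ?L k (\<lambda>x. g (f x)) - ?L k g) \<longlongrightarrow> 0) F"
    proof (rule Lim_null_comparison)
      show "\<forall>\<^sub>F k in F. norm (?L k (\<lambda>x. g (f x)) - ?L k g) \<le> 2 * B / real (m k)"
        using empirical_average_almost_invariant[OF fin B m(2)] by (intro always_eventually allI) simp
    qed (rule dm)
    from tendsto_unique[OF F(1) this tendsto_diff[OF lim[OF gf] lim[OF g]]] show ?thesis by simp
  qed
  have Minv: "M \<in> invariant_probs f" by (rule invariant_probsI[OF c f M inv])
  interpret compact_invariant_measure f M
    by unfold_locales (simp_all add: borel_measurable_continuous_onI[OF f] Minv c f)
  have cim: "compact_invariant_measure f M" by unfold_locales
  \<comment> \<open>The partition comes after the limit, since its cells must be Jordan for
    \<open>M\<close>. The bound \<open>\<epsilon>\<close> on distances inside a cell makes the names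
    of separated points distinct.\<close>
  obtain X :: "'a \<Rightarrow> nat" where X: "finite (range X)" "\<And>x y. X x = X y \<Longrightarrow> dist x y \<le> \<epsilon>"
    "\<And>v. jordan_set M (X -` {v})"
    by (rule jordan_partition[OF c M \<epsilon>]) blast
  have sX: "simple_function M X"
    using X(1) jordan_set_borel[OF X(3)] by (simp add: simple_iff sets_eq)
  have inj: "inj_on (itinerary f X {..<m k}) (set_pmf (\<sigma> k))" for k
  proof (rule inj_onI, rule ccontr)
    fix x y assume xy: "x \<in> set_pmf (\<sigma> k)" "y \<in> set_pmf (\<sigma> k)"
      "itinerary f X {..<m k} x = itinerary f X {..<m k} y" "x \<noteq> y"
    from sep[of x k y] xy obtain i where i: "i < m k" "\<epsilon> < dist ((f ^^ i) x) ((f ^^ i) y)" by (auto simp: \<sigma>E)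
    have "X ((f ^^ i) x) = X ((f ^^ i) y)" using xy(3) i(1) by (simp add: itinerary_eq_iff)
    from X(2)[OF this] i(2) show False by simp
  qed
  have conv: "((\<lambda>k. ?L k (indicator A)) \<longlongrightarrow> measure M A) F" if A: "jordan_set M A" for A
  proof (rule tendstoI)
    fix e :: real assume "e > 0"
    then have e2: "e/2 > 0" by simp
    from A e2 obtain g h :: "'a \<Rightarrow> real" where gh: "continuous_on UNIV g" "continuous_on UNIV h"
      "\<And>x. g x \<le> indicator A x" "\<And>x. indicator A x \<le> h x" "(\<integral>x. h x \<partial>M) - (\<integral>x. g x \<partial>M) < e/2"
      by (rule jordan_setE) blast
    have iA: "integrable M (indicator A :: 'a \<Rightarrow> real)" and mA: "(\<integral>x. indicator A x \<partial>M) = measure M A"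
      using jordan_set_borel[OF A] by (simp_all add: sets_eq space_UNIV emeasure_eq_measure)
    have 1: "(\<integral>x. g x \<partial>M) \<le> measure M A" "measure M A \<le> (\<integral>x. h x \<partial>M)"
      unfolding mA[symmetric]
      by (intro integral_mono iA gh(3,4) borel_prob_integrable[OF c M] gh(1,2))+
    show "\<forall>\<^sub>F k in F. dist (?L k (indicator A)) (measure M A) < e"
      using tendstoD[OF lim[OF gh(1)] e2] tendstoD[OF lim[OF gh(2)] e2]
    proof eventually_elim
      case (elim k)
      have "?L k g \<le> ?L k (indicator A)" "?L k (indicator A) \<le> ?L k h"
        by (intro empirical_average_mono[OF fin] gh(3,4))+
      then show ?case using elim 1 gh(5) unfolding dist_real_def by linarith
    qed
  qed
  \<comment> \<open>The limit in \<open>k\<close> along \<open>F\<close> is taken with the word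
    length \<open>q\<close> fixed: the fibres of words of length \<open>q\<close> are Jordan, so
    their empirical weights converge. Only afterwards does \<open>q\<close> tend to
    infinity.\<close>
  have Yq: "0 \<le> rv_entropy M (itinerary f X {..<q}) / real q + (\<integral>x. \<Phi> x \<partial>M)" if q: "q > 0" for q
  proof -
    let ?Y = "itinerary f X {..<q}"
    let ?V = "range ?Y"
    let ?p = "\<lambda>k v. ?L k (indicator (?Y -` {v}))"
    let ?K = "ln (card ?V)"
    have jV: "jordan_set M (?Y -` {v})" if "v \<in> ?V" for v
    proof -
      from that obtain x where v: "v = ?Y x" by auto
      have "?Y -` {v} = (\<Inter>i\<in>{..<q}. (f ^^ i) -` (X -` {X ((f ^^ i) x)}))"
        unfolding v by (intro set_eqI) (simp add: itinerary_eq_iff)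
      moreover have "jordan_set M (\<Inter>i\<in>{..<q}. (f ^^ i) -` (X -` {X ((f ^^ i) x)}))"
        by (rule jordan_set_INT[OF c M]) (simp, rule jordan_set_vimage_funpow[OF cim X(3)])
      ultimately show ?thesis by simp
    qed
    have pnn: "0 \<le> ?p k v" for k v
      unfolding empirical_average_def by (intro divide_nonneg_nonneg sum_nonneg Bochner_Integration.integral_nonneg) simp_all
    have "((\<lambda>k. - (\<Sum>v\<in>?V. ?p k v * ln (?p k v))) \<longlongrightarrow> rv_entropy M ?Y) F"
      unfolding rv_entropy_def
      by (intro tendsto_minus tendsto_sum tendsto_mult_ln[OF conv[OF jV] pnn])
    then have "((\<lambda>k. - (\<Sum>v\<in>?V. ?p k v * ln (?p k v)) / real q + ?L k \<Phi> + (?K + C) / real (m k))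
       \<longlongrightarrow> rv_entropy M ?Y / real q + (\<integral>x. \<Phi> x \<partial>M) + 0) F"
      using q by (intro tendsto_add tendsto_divide tendsto_const lim[OF \<Phi>] dm) simp_all
    then have "0 \<le> rv_entropy M ?Y / real q + (\<integral>x. \<Phi> x \<partial>M) + 0"
    proof (rule tendsto_lowerbound[OF _ always_eventually F(1)], intro allI)
      fix k
      let ?h = "- (\<Sum>v\<in>?V. ?p k v * ln (?p k v))"
      have "- C \<le> ln (Z k)"
        using Zlow[of k] Z[of k] by (simp add: ln_ge_iff)
      also have "\<dots> \<le> real (m k) / real q * ?h + ?K + real (m k) * ?L k \<Phi>"
        by (rule misiurewicz_inequality[OF fin X(1) m(2) q inj \<sigma>w Z])
      finally have "0 \<le> real (m k) / real q * ?h + ?K + real (m k) * ?L k \<Phi> + C" by linarith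
      then have "0 \<le> (real (m k) / real q * ?h + ?K + real (m k) * ?L k \<Phi> + C) / real (m k)"
        by (rule divide_nonneg_nonneg) simp
      also have "\<dots> = ?h / real q + ?L k \<Phi> + (?K + C) / real (m k)"
        using m(2)[of k] q by (simp add: add_divide_distrib diff_divide_distrib)
      finally show "0 \<le> ?h / real q + ?L k \<Phi> + (?K + C) / real (m k)" .
    qed
    then show ?thesis by simp
  qed
  have "- (\<integral>x. \<Phi> x \<partial>M) \<le> process_rate X"
  proof (rule LIMSEQ_le_const[OF process_rate_tendsto[OF sX]], intro exI[of _ 1] allI impI)
    fix q :: nat assume "1 \<le> q"
    then show "- (\<integral>x. \<Phi> x \<partial>M) \<le> rv_entropy M (itinerary f X {..<q}) / real q" using Yq[of q] by simp
  qed
  then have "ereal (- (\<integral>x. \<Phi> x \<partial>M)) \<le> ereal (process_rate X)" by simp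
  also have "\<dots> \<le> measure_entropy f M" by (rule measure_entropy_ge[OF sX])
  finally show ?thesis by (rule that[OF Minv])
qed

subsection \<open>Induced pressure\<close>

text \<open>Identifies the \<open>Lim\<close> in the definitions of pressure and topological entropy
  with a supremum over all scales. Convergence has to be shown, since \<open>Lim\<close> alone says
  nothing without it.\<close>

lemma antitone_tendsto_at_right_0:
  fixes q :: "real \<Rightarrow> ereal"
  assumes "\<And>s t. 0 < s \<Longrightarrow> s \<le> t \<Longrightarrow> q t \<le> q s"
  shows "(q \<longlongrightarrow> (SUP t\<in>{0<..}. q t)) (at_right 0)"
proof (rule order_tendstoI)
  fix a assume "a < (SUP t\<in>{0<..}. q t)"
  then obtain t where t: "t > 0" "a < q t" by (auto simp: less_SUP_iff)
  have "a < q s" if "0 < s" "s < t" for s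
    using assms[OF that(1), of t] that t(2) by (meson less_imp_le less_le_trans)
  then show "\<forall>\<^sub>F s in at_right 0. a < q s"
    unfolding eventually_at_right_field using t(1) by (intro exI[of _ t]) simp
next
  fix a assume a: "(SUP t\<in>{0<..}. q t) < a"
  have "q s < a" if "0 < s" for s
  proof -
    have "q s \<le> (SUP t\<in>{0<..}. q t)" using that by (intro SUP_upper) simp
    then show ?thesis using a by simp
  qed
  then show "\<forall>\<^sub>F s in at_right 0. q s < a"
    unfolding eventually_at_right_field by (intro exI[of _ 1]) simp
qed

text \<open>The counterpart for difference quotients of a convex function, used for the right
  derivative.\<close>

lemma monotone_tendsto_at_right_0:
  fixes q :: "real \<Rightarrow> ereal"
  assumes "\<And>s t. 0 < s \<Longrightarrow> s \<le> t \<Longrightarrow> q s \<le> q t"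
  shows "(q \<longlongrightarrow> (INF t\<in>{0<..}. q t)) (at_right 0)"
proof (rule order_tendstoI)
  fix a assume "(INF t\<in>{0<..}. q t) < a"
  then obtain t where t: "t > 0" "q t < a" by (auto simp: INF_less_iff)
  have "q s < a" if "0 < s" "s < t" for s
    using assms[OF that(1), of t] that t(2) by (meson less_imp_le le_less_trans)
  then show "\<forall>\<^sub>F s in at_right 0. q s < a"
    unfolding eventually_at_right_field using t(1) by (intro exI[of _ t]) simp
next
  fix a assume a: "a < (INF t\<in>{0<..}. q t)"
  have "a < q s" if "0 < s" for s
  proof -
    have "(INF t\<in>{0<..}. q t) \<le> q s" using that by (intro INF_lower) simp
    then show ?thesis using a by simp
  qed
  then show "\<forall>\<^sub>F s in at_right 0. a < q s"
    unfolding eventually_at_right_field by (intro exI[of _ 1]) simp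
qed

lemma ln_ennreal_less_imp: "q < ennreal (exp a)" if "ln_ennreal q < ereal a"
proof (cases q)
  case (real r)
  show ?thesis
  proof (cases "r = 0")
    case True then show ?thesis using real by simp
  next
    case False
    then have r: "r > 0" using real by simp
    have "ln_ennreal q = ereal (ln r)" using real r by (simp add: ln_ennreal_def)
    then have "ln r < a" using that by simp
    then have "r < exp a" using r by (metis exp_less_cancel_iff exp_ln)
    then show ?thesis using real by (simp add: ennreal_lessI)
  qed
next
  case top then show ?thesis using that by (simp add: ln_ennreal_def)
qed

lemma less_ln_ennreal_imp: "ennreal (exp a) < q" if "ereal a < ln_ennreal q"
proof (cases q)
  case (real r)
  show ?thesis
  proof (cases "r = 0")
    case True then show ?thesis using real that by (simp add: ln_ennreal_def)
  next
    case False
    then have r: "r > 0" using real by simp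
    have "ln_ennreal q = ereal (ln r)" using real r by (simp add: ln_ennreal_def)
    then have "a < ln r" using that by simp
    then have "exp a < r" using r by (metis exp_less_cancel_iff exp_ln)
    then show ?thesis using real r by (simp add: ennreal_lessI)
  qed
next
  case top then show ?thesis by simp
qed

lemma ln_ennreal_mono: "p \<le> q \<Longrightarrow> ln_ennreal p \<le> ln_ennreal q"
proof (rule ccontr)
  assume le: "p \<le> q" and "\<not> ln_ennreal p \<le> ln_ennreal q"
  then have "ln_ennreal q < ln_ennreal p" by simp
  then obtain a where a: "ln_ennreal q < ereal a" "ereal a < ln_ennreal p" using ereal_dense2 by blast
  have "q < p" using ln_ennreal_less_imp[OF a(1)] less_ln_ennreal_imp[OF a(2)] by (rule order.strict_trans)
  then show False using le by simp
qed

lemma spanning_mono: "spanning f n \<epsilon> Z F" if "spanning f n \<epsilon>' Z F" "\<epsilon>' \<le> \<epsilon>"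
  using that unfolding spanning_def by (meson order_trans)

lemma induced_Q_antimono:
  assumes "\<epsilon> \<le> \<epsilon>'"
  shows "induced_Q f \<psi> \<phi> T \<epsilon>' \<le> induced_Q f \<psi> \<phi> T \<epsilon>"
  unfolding induced_Q_def by (rule INF_superset_mono) (use assms spanning_mono in blast, simp)

definition pressure_at :: "('a::metric_space \<Rightarrow> 'a) \<Rightarrow> ('a \<Rightarrow> real) \<Rightarrow> ('a \<Rightarrow> real) \<Rightarrow> real \<Rightarrow> ereal" where
  "pressure_at f \<psi> \<phi> \<epsilon> = Limsup at_top (\<lambda>T::real. ln_ennreal (induced_Q f \<psi> \<phi> T \<epsilon>) / ereal T)"

lemma pressure_at_antimono:
  assumes "\<epsilon> \<le> \<epsilon>'"
  shows "pressure_at f \<psi> \<phi> \<epsilon>' \<le> pressure_at f \<psi> \<phi> \<epsilon>"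
  unfolding pressure_at_def
proof (rule Limsup_mono)
  show "\<forall>\<^sub>F T::real in at_top. ln_ennreal (induced_Q f \<psi> \<phi> T \<epsilon>') / ereal T \<le> ln_ennreal (induced_Q f \<psi> \<phi> T \<epsilon>) / ereal T"
    using eventually_gt_at_top[of 0]
    by eventually_elim (simp add: ereal_divide_right_mono ln_ennreal_mono induced_Q_antimono[OF assms])
qed

lemma induced_pressure_eq_SUP: "induced_pressure f \<psi> \<phi> = (SUP \<epsilon>\<in>{0<..}. pressure_at f \<psi> \<phi> \<epsilon>)"
proof -
  have "(pressure_at f \<psi> \<phi> \<longlongrightarrow> (SUP \<epsilon>\<in>{0<..}. pressure_at f \<psi> \<phi> \<epsilon>)) (at_right 0)"
    by (rule antitone_tendsto_at_right_0) (rule pressure_at_antimono)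
  then have "Lim (at_right 0) (pressure_at f \<psi> \<phi>) = (SUP \<epsilon>\<in>{0<..}. pressure_at f \<psi> \<phi> \<epsilon>)"
    by (intro tendsto_Lim) simp_all
  then show ?thesis by (simp add: induced_pressure_def pressure_at_def[abs_def])
qed

lemma infsum_ennreal_mono_set:
  fixes g :: "'b \<Rightarrow> ennreal"
  assumes "A \<subseteq> B"
  shows "infsum g A \<le> infsum g B"
  using assms by (intro infsum_mono_neutral nonneg_summable_on_complete) auto

lemma sum_UN_le:
  fixes g :: "'b \<Rightarrow> real"
  assumes "finite K" "\<And>k. k \<in> K \<Longrightarrow> finite (G k)" "\<And>x. 0 \<le> g x"
  shows "(\<Sum>x\<in>(\<Union>k\<in>K. G k). g x) \<le> (\<Sum>k\<in>K. \<Sum>x\<in>G k. g x)"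
  using assms(1,2)
proof (induction K rule: finite_induct)
  case empty show ?case by simp
next
  case (insert k K)
  have "(\<Sum>x\<in>G k \<union> (\<Union>k\<in>K. G k). g x) + (\<Sum>x\<in>G k \<inter> (\<Union>k\<in>K. G k). g x) = (\<Sum>x\<in>G k. g x) + (\<Sum>x\<in>(\<Union>k\<in>K. G k). g x)"
    using insert by (intro sum.union_inter) auto
  moreover have "0 \<le> (\<Sum>x\<in>G k \<inter> (\<Union>k\<in>K. G k). g x)" by (intro sum_nonneg assms(3))
  moreover have "(\<Sum>x\<in>(\<Union>k\<in>K. G k). g x) \<le> (\<Sum>k\<in>K. \<Sum>x\<in>G k. g x)" using insert by simp
  ultimately have "(\<Sum>x\<in>G k \<union> (\<Union>k\<in>K. G k). g x) \<le> (\<Sum>x\<in>G k. g x) + (\<Sum>k\<in>K. \<Sum>x\<in>G k. g x)" by linarith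
  then show ?case using insert by simp
qed

lemma birkhoff_sum_Suc: "birkhoff_sum f \<psi> (Suc n) x = birkhoff_sum f \<psi> n x + \<psi> ((f ^^ n) x)"
  by (simp add: birkhoff_sum_def)

lemma birkhoff_sum_diff_mult:
  "birkhoff_sum f (\<lambda>x. \<phi> x - b * \<psi> x) n x = birkhoff_sum f \<phi> n x - b * birkhoff_sum f \<psi> n x"
  by (simp add: birkhoff_sum_def sum_subtractf sum_distrib_left)

lemma bowen_dist_le_iff:
  assumes "n > 0"
  shows "bowen_dist f n x y \<le> \<epsilon> \<longleftrightarrow> (\<forall>i<n. dist ((f ^^ i) x) ((f ^^ i) y) \<le> \<epsilon>)"
  unfolding bowen_dist_def using assms by (subst Max_le_iff) auto

section \<open>Spanning and separated sets, existence of invariant measures, the bound by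
  topological entropy\<close>

locale compact_system =
  fixes f :: "'a::metric_space \<Rightarrow> 'a"
  assumes compact_UNIV: "compact (UNIV :: 'a set)" and f_continuous: "continuous_on UNIV f"
begin

lemma compact_invariant_measureI: "M \<in> invariant_probs f \<Longrightarrow> compact_invariant_measure f M"
  by unfold_locales (simp_all add: borel_measurable_continuous_onI[OF f_continuous] compact_UNIV f_continuous)

lemma finite_spanning_exists:
  assumes n: "n > 0" and \<epsilon>: "\<epsilon> > 0"
  obtains F where "finite F" "spanning f n \<epsilon> UNIV F"
proof -
  define U where "U x = (\<Inter>i\<in>{..<n}. {y. dist ((f ^^ i) x) ((f ^^ i) y) < \<epsilon>})" for x
  have "open (U x)" for x
    unfolding U_def using continuous_funpow[OF f_continuous]
    by (intro open_INT ballI open_Collect_less continuous_on_dist continuous_on_const) simp_all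
  moreover have "UNIV \<subseteq> (\<Union>x\<in>UNIV. U x)"
  proof
    fix x
    have "x \<in> U x" using \<epsilon> by (simp add: U_def)
    then show "x \<in> (\<Union>x\<in>UNIV. U x)" by (intro UN_I[of x]) simp_all
  qed
  ultimately obtain D where D: "finite D" "UNIV \<subseteq> (\<Union>x\<in>D. U x)"
    using compactE_image[OF compact_UNIV, of UNIV U] by metis
  have "spanning f n \<epsilon> UNIV D"
    unfolding spanning_def
  proof
    fix y :: 'a
    have "y \<in> (\<Union>x\<in>D. U x)" by (rule subsetD[OF D(2) UNIV_I])
    then obtain x where x: "x \<in> D" "y \<in> U x" by (rule UN_E)
    then show "\<exists>x\<in>D. bowen_dist f n x y \<le> \<epsilon>"
      by (intro bexI[of _ x]) (auto simp: bowen_dist_le_iff[OF n] U_def intro: less_imp_le)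
  qed
  then show ?thesis using that D(1) by simp
qed

text \<open>Each point of an \<open>\<epsilon>/2\<close>-spanning set serves at most one point of an
  \<open>\<epsilon>\<close>-separated set, which bounds the cardinality; a separated set of maximal
  size is spanning, since otherwise a point could be added.\<close>

lemma maximal_separated:
  assumes n: "n > 0" and \<epsilon>: "\<epsilon> > 0"
  obtains E where "finite E" "E \<subseteq> X" "spanning f n \<epsilon> X E"
    "\<And>x y. x \<in> E \<Longrightarrow> y \<in> E \<Longrightarrow> x \<noteq> y \<Longrightarrow> \<exists>i<n. \<epsilon> < dist ((f ^^ i) x) ((f ^^ i) y)"
proof -
  let ?P = "\<lambda>E. finite E \<and> E \<subseteq> X \<and> (\<forall>x\<in>E. \<forall>y\<in>E. x \<noteq> y \<longrightarrow> (\<exists>i<n. \<epsilon> < dist ((f ^^ i) x) ((f ^^ i) y)))"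
  have "\<epsilon>/2 > 0" using \<epsilon> by simp
  from n this obtain D where D: "finite D" "spanning f n (\<epsilon>/2) UNIV D" by (rule finite_spanning_exists)
  have bound: "card E < Suc (card D)" if E: "?P E" for E
  proof -
    have "\<forall>x\<in>E. \<exists>y. y \<in> D \<and> bowen_dist f n y x \<le> \<epsilon>/2" using D(2) unfolding spanning_def by auto
    from bchoice[OF this] obtain g where g: "\<forall>x\<in>E. g x \<in> D \<and> bowen_dist f n (g x) x \<le> \<epsilon>/2" by (elim exE)
    have "inj_on g E"
    proof (rule inj_onI, rule ccontr)
      fix x y assume xy: "x \<in> E" "y \<in> E" "g x = g y" "x \<noteq> y"
      from E have "\<forall>x\<in>E. \<forall>y\<in>E. x \<noteq> y \<longrightarrow> (\<exists>i<n. \<epsilon> < dist ((f ^^ i) x) ((f ^^ i) y))" by (elim conjE)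
      from this[rule_format, OF xy(1,2,4)] obtain i where i: "i < n" "\<epsilon> < dist ((f ^^ i) x) ((f ^^ i) y)"
        by (elim exE conjE)
      have "dist ((f ^^ i) (g x)) ((f ^^ i) x) \<le> \<epsilon>/2" using g xy(1) i(1) by (intro bowen_dist_leD) auto
      moreover have "dist ((f ^^ i) (g x)) ((f ^^ i) y) \<le> \<epsilon>/2" using g xy(2,3) i(1) by (intro bowen_dist_leD) auto
      ultimately show False
        using i(2) dist_triangle3[of "(f ^^ i) x" "(f ^^ i) y" "(f ^^ i) (g x)"] by linarith
    qed
    moreover have "g ` E \<subseteq> D" using g by auto
    ultimately have "card E \<le> card D" by (rule card_inj_on_le[OF _ _ D(1)])
    then show ?thesis by simp
  qed
  have "?P {}" by simp
  from ex_has_greatest_nat[of ?P "{}" card "Suc (card D)", OF this] bound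
  obtain E where E: "?P E" "\<forall>E'. ?P E' \<longrightarrow> card E' \<le> card E" by (metis (no_types, lifting) less_imp_le)
  have "spanning f n \<epsilon> X E"
    unfolding spanning_def
  proof (rule ballI, rule ccontr)
    fix y assume y: "y \<in> X" "\<not> (\<exists>x\<in>E. bowen_dist f n x y \<le> \<epsilon>)"
    have far: "\<exists>i<n. \<epsilon> < dist ((f ^^ i) x) ((f ^^ i) y)" if "x \<in> E" for x
    proof -
      have "\<not> bowen_dist f n x y \<le> \<epsilon>" using y(2) that by simp
      then show ?thesis unfolding bowen_dist_le_iff[OF n] by (auto simp: not_le)
    qed
    have "y \<notin> E"
    proof
      assume "y \<in> E"
      from far[OF this] \<epsilon> show False by auto
    qed
    have "?P (insert y E)"
      using E(1) y(1) far by (auto simp: dist_commute)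
    then have "card (insert y E) \<le> card E" using E(2) by simp
    then show False using E(1) \<open>y \<notin> E\<close> by simp
  qed
  then show ?thesis using that[of E] E(1) by simp
qed

text \<open>Krylov-Bogolyubov: single points are trivially separated, and with potential 0 their
  weight is \<open>exp 0\<close>.\<close>

lemma exists_invariant_prob: "invariant_probs f \<noteq> {}"
proof -
  obtain M where "M \<in> invariant_probs f" "ereal (- (\<integral>x. (0::real) \<partial>M)) \<le> measure_entropy f M"
    by (rule separated_sets_entropy[OF compact_UNIV f_continuous, of "\<lambda>_. 0" 1 Suc "\<lambda>_. {undefined}" 0])
      (simp_all add: filterlim_Suc birkhoff_sum_def)
  then show ?thesis by auto
qed

text \<open>One half of the classical variational principle, from the spanning criterion with the
  constant potential \<open>-a\<close>: for large \<open>n\<close> fewer than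
  \<open>exp (a n)\<close> points span, so the weighted sums stay bounded.\<close>

lemma measure_entropy_le_top_entropy:
  assumes M: "M \<in> invariant_probs f" and a: "top_entropy f < ereal a"
  shows "measure_entropy f M \<le> ereal a"
proof -
  interpret compact_invariant_measure f M by (rule compact_invariant_measureI[OF M])
  let ?G = "\<lambda>\<epsilon>. limsup (\<lambda>n. ereal (ln (real (span_number f n \<epsilon>)) / real n))"
  have att: "\<exists>F. finite F \<and> spanning f n \<epsilon> UNIV F \<and> card F = span_number f n \<epsilon>" if np: "n > 0" "\<epsilon> > 0" for n \<epsilon>
  proof -
    let ?S = "{card F |F. finite F \<and> spanning f n \<epsilon> UNIV F}"
    obtain F where "finite F" "spanning f n \<epsilon> UNIV F" using np by (rule finite_spanning_exists)
    then have "?S \<noteq> {}" by auto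
    from Inf_nat_def1[OF this] have "span_number f n \<epsilon> \<in> ?S" by (simp only: span_number_def)
    then show ?thesis by auto
  qed
  have pos: "span_number f n \<epsilon> > 0" if np: "n > 0" "\<epsilon> > 0" for n \<epsilon>
  proof -
    obtain F where F: "finite F" "spanning f n \<epsilon> UNIV F" "card F = span_number f n \<epsilon>" using att[OF np] by (elim exE conjE)
    have "F \<noteq> {}" using F(2) by (auto simp: spanning_def)
    then show ?thesis using F(1,3) by (metis card_gt_0_iff)
  qed
  have mono: "?G \<epsilon>' \<le> ?G \<epsilon>" if ep: "0 < \<epsilon>" "\<epsilon> \<le> \<epsilon>'" for \<epsilon> \<epsilon>'
  proof (rule Limsup_mono)
    show "\<forall>\<^sub>F n in sequentially. ereal (ln (real (span_number f n \<epsilon>')) / real n) \<le> ereal (ln (real (span_number f n \<epsilon>)) / real n)"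
      using eventually_gt_at_top[of 0]
    proof eventually_elim
      case (elim n)
      obtain F where F: "finite F" "spanning f n \<epsilon> UNIV F" "card F = span_number f n \<epsilon>" using att[OF elim ep(1)] by (elim exE conjE)
      have "span_number f n \<epsilon>' \<le> card F"
        unfolding span_number_def using F(1) spanning_mono[OF F(2) ep(2)] by (intro cInf_lower) auto
      then have "real (span_number f n \<epsilon>') \<le> real (span_number f n \<epsilon>)" using F(3) by simp
      moreover have "real (span_number f n \<epsilon>') > 0" using pos[OF elim, of \<epsilon>'] ep by simp
      ultimately show ?case by (simp add: divide_right_mono)
    qed
  qed
  have "(?G \<longlongrightarrow> (SUP t\<in>{0<..}. ?G t)) (at_right 0)" by (rule antitone_tendsto_at_right_0) (rule mono)
  then have "top_entropy f = (SUP t\<in>{0<..}. ?G t)"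
    unfolding top_entropy_def by (intro tendsto_Lim) simp_all
  then have Ga: "?G \<epsilon> < ereal a" if "\<epsilon> > 0" for \<epsilon>
    using a SUP_upper[of \<epsilon> "{0<..}" ?G] that by (metis greaterThan_iff le_less_trans)
  have "process_rate X + (\<integral>x. - a \<partial>M) \<le> 0" if X: "simple_function M X" for X :: "'a \<Rightarrow> 'a set"
  proof (rule process_rate_le_spanning_growth[OF _ X])
    fix r :: real assume r: "r > 0"
    show "\<exists>\<epsilon>0>0. \<forall>\<epsilon>. 0 < \<epsilon> \<and> \<epsilon> \<le> \<epsilon>0 \<longrightarrow> (\<exists>C. \<forall>\<^sub>F n in sequentially. \<exists>F. finite F \<and>
      spanning f n \<epsilon> UNIV F \<and> (\<Sum>x\<in>F. exp (birkhoff_sum f (\<lambda>_. - a) n x)) \<le> exp (C + r * real n))"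
    proof (rule exI[of _ "1::real"], rule conjI, simp, intro allI impI, rule exI[of _ "0::real"])
      fix \<epsilon> :: real assume "0 < \<epsilon> \<and> \<epsilon> \<le> 1"
      then have \<epsilon>: "\<epsilon> > 0" by simp
      show "\<forall>\<^sub>F n in sequentially. \<exists>F. finite F \<and>
        spanning f n \<epsilon> UNIV F \<and> (\<Sum>x\<in>F. exp (birkhoff_sum f (\<lambda>_. - a) n x)) \<le> exp (0 + r * real n)"
        using Limsup_lessD[OF Ga[OF \<epsilon>]] eventually_gt_at_top[of 0]
      proof eventually_elim
        case (elim n)
        obtain F where F: "finite F" "spanning f n \<epsilon> UNIV F" "card F = span_number f n \<epsilon>"
          using att[OF elim(2) \<epsilon>] by (elim exE conjE)
        have s: "real (span_number f n \<epsilon>) > 0" using pos[OF elim(2) \<epsilon>] by simp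
        have "ln (real (span_number f n \<epsilon>)) < a * real n" using elim by (simp add: pos_divide_less_eq)
        then have "real (span_number f n \<epsilon>) < exp (a * real n)" using s by (metis exp_less_cancel_iff exp_ln)
        then have "real (card F) * exp (- (a * real n)) \<le> exp (a * real n) * exp (- (a * real n))"
          using F(3) by (intro mult_right_mono) simp_all
        also have "\<dots> = 1" by (simp add: exp_minus)
        also have "\<dots> \<le> exp (0 + r * real n)" using r by simp
        finally have "(\<Sum>x\<in>F. exp (birkhoff_sum f (\<lambda>_. - a) n x)) \<le> exp (0 + r * real n)"
          by (simp add: birkhoff_sum_def mult.commute)
        then show ?case using F by (intro exI[of _ F]) simp
      qed
    qed
  qed simp
  then have "process_rate X \<le> a" if "simple_function M X" for X :: "'a \<Rightarrow> 'a set"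
    using that prob_space by fastforce
  then show ?thesis by (rule measure_entropy_le)
qed

end

section \<open>Level sets of the roof function\<close>

locale suspended_system = compact_system f for f :: "'a::metric_space \<Rightarrow> 'a" +
  fixes \<psi> :: "'a \<Rightarrow> real"
  assumes \<psi>_continuous: "continuous_on UNIV \<psi>" and \<psi>_pos: "\<And>x. \<psi> x > 0"
begin

lemma roof_bounds:
  obtains a b where "a > 0" "b > 0" "\<And>x. a \<le> \<psi> x" "\<And>x. \<psi> x \<le> b"
proof -
  obtain b where b: "b > 0" "\<And>x. \<bar>\<psi> x\<bar> \<le> b" by (rule continuous_UNIV_bounded[OF compact_UNIV \<psi>_continuous]) blast
  obtain x0 where "\<forall>y\<in>UNIV. \<psi> x0 \<le> \<psi> y"
    using continuous_attains_inf[OF compact_UNIV _ \<psi>_continuous] by auto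
  moreover have "\<psi> x \<le> b" for x using b(2)[of x] by simp
  ultimately show ?thesis using b(1) \<psi>_pos[of x0] by (intro that[of "\<psi> x0" b]) simp_all
qed

lemma birkhoff_sum_ge:
  assumes "\<And>x. a \<le> \<psi> x"
  shows "real n * a \<le> birkhoff_sum f \<psi> n x"
proof -
  have "(\<Sum>i<n. a) \<le> birkhoff_sum f \<psi> n x" unfolding birkhoff_sum_def by (rule sum_mono) (rule assms)
  then show ?thesis by simp
qed

lemma birkhoff_sum_le:
  assumes "\<And>x. \<psi> x \<le> b"
  shows "birkhoff_sum f \<psi> n x \<le> real n * b"
proof -
  have "birkhoff_sum f \<psi> n x \<le> (\<Sum>i<n. b)" unfolding birkhoff_sum_def by (rule sum_mono) (rule assms)
  then show ?thesis by simp
qed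

text \<open>Spanning points need not lie in the level set, so those far from it are discarded in
  order to control the Birkhoff sum of \<psi> at the others. Finiteness holds because every term is
  at least a fixed positive constant while the finite sums stay below \<open>K\<close>.\<close>

lemma level_set_spanning_sum:
  assumes \<phi>: "continuous_on UNIV \<phi>" and n: "n > 0" and ne: "level_set f \<psi> T n \<noteq> {}"
    and Q: "induced_Q f \<psi> \<phi> T \<epsilon> < ennreal K"
  obtains G where "finite G" "spanning f n \<epsilon> (level_set f \<psi> T n) G"
    "\<And>x. x \<in> G \<Longrightarrow> \<exists>y\<in>level_set f \<psi> T n. bowen_dist f n x y \<le> \<epsilon>"
    "(\<Sum>x\<in>G. exp (birkhoff_sum f \<phi> n x)) \<le> K"
proof -
  let ?L = "level_set f \<psi> T n" and ?S = "birkhoff_sum f \<phi> n"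
  have nt: "n \<in> level_times f \<psi> T" using n ne by (simp add: level_times_def)
  from Q obtain F where F: "\<forall>n\<in>level_times f \<psi> T. spanning f n \<epsilon> (level_set f \<psi> T n) (F n)"
    and sF: "(\<Sum>\<^sub>\<infinity>n\<in>level_times f \<psi> T. \<Sum>\<^sub>\<infinity>x\<in>F n. ennreal (exp (birkhoff_sum f \<phi> n x))) < ennreal K"
    unfolding induced_Q_def INF_less_iff by auto
  define G where "G = {x\<in>F n. \<exists>y\<in>?L. bowen_dist f n x y \<le> \<epsilon>}"
  have spG: "spanning f n \<epsilon> ?L G" using bspec[OF F nt] unfolding spanning_def G_def by fastforce
  have "(\<Sum>\<^sub>\<infinity>x\<in>G. ennreal (exp (?S x))) \<le> (\<Sum>\<^sub>\<infinity>x\<in>F n. ennreal (exp (?S x)))"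
    by (rule infsum_ennreal_mono_set) (simp add: G_def)
  also have "\<dots> = (\<Sum>\<^sub>\<infinity>n\<in>{n}. \<Sum>\<^sub>\<infinity>x\<in>F n. ennreal (exp (birkhoff_sum f \<phi> n x)))" by simp
  also have "\<dots> \<le> (\<Sum>\<^sub>\<infinity>n\<in>level_times f \<psi> T. \<Sum>\<^sub>\<infinity>x\<in>F n. ennreal (exp (birkhoff_sum f \<phi> n x)))"
    by (rule infsum_ennreal_mono_set) (simp add: nt)
  also note sF
  finally have sG: "(\<Sum>\<^sub>\<infinity>x\<in>G. ennreal (exp (?S x))) < ennreal K" .
  have K0: "K > 0"
  proof (rule ccontr)
    assume "\<not> K > 0"
    then show False using sG by (simp add: ennreal_neg)
  qed
  have sub: "(\<Sum>x\<in>A. exp (?S x)) \<le> K" if "A \<subseteq> G" "finite A" for A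
  proof -
    have "ennreal (\<Sum>x\<in>A. exp (?S x)) = (\<Sum>\<^sub>\<infinity>x\<in>A. ennreal (exp (?S x)))"
      using that by (simp add: sum_ennreal infsum_finite)
    also have "\<dots> \<le> (\<Sum>\<^sub>\<infinity>x\<in>G. ennreal (exp (?S x)))" by (rule infsum_ennreal_mono_set[OF that(1)])
    also note sG
    finally have "ennreal (\<Sum>x\<in>A. exp (?S x)) < ennreal K" .
    then show ?thesis using K0 by (simp add: ennreal_less_iff sum_nonneg)
  qed
  obtain b where b: "\<And>x. \<bar>?S x\<bar> \<le> b"
    by (rule continuous_UNIV_bounded[OF compact_UNIV continuous_birkhoff_sum[OF f_continuous \<phi>]]) blast
  have "finite G"
  proof (rule finite_if_finite_subsets_card_bdd[THEN conjunct1])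
    fix A assume A: "A \<subseteq> G" "finite A"
    have "real (card A) * exp (- b) = (\<Sum>x\<in>A. exp (- b))" by simp
    also have "\<dots> \<le> (\<Sum>x\<in>A. exp (?S x))"
    proof (rule sum_mono)
      fix x show "exp (- b) \<le> exp (?S x)" using b[of x] by simp
    qed
    also have "\<dots> \<le> K" by (rule sub[OF A])
    finally have "real (card A) \<le> K * exp b" by (simp add: exp_minus field_simps)
    then show "card A \<le> nat \<lceil>K * exp b\<rceil>" by linarith
  qed
  then show ?thesis using spG sub[of G] by (intro that[of G]) (simp_all add: G_def)
qed

end

lemma ereal_divide_less_imp: "x < ereal (c * T)" if "T > 0" "x / ereal T < ereal c"
  using that by (cases x) (simp_all add: pos_divide_less_eq)

lemma less_ereal_divide_imp: "ereal (c * T) < x" if "T > 0" "ereal c < x / ereal T"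
  using that by (cases x) (simp_all add: pos_less_divide_eq)

lemma sum_power_le_geometric:
  fixes \<rho> :: real
  assumes "0 \<le> \<rho>" "\<rho> < 1" "finite K"
  shows "(\<Sum>k\<in>K. \<rho> ^ k) \<le> 1 / (1 - \<rho>)"
proof -
  have "(\<Sum>k\<in>K. \<rho> ^ k) \<le> (\<Sum>k. \<rho> ^ k)" using assms by (intro sum_le_suminf summable_geometric) simp_all
  then show ?thesis using assms by (simp add: suminf_geometric)
qed

context suspended_system
begin

lemma level_set_birkhoff_bounds:
  assumes "\<And>x. \<psi> x \<le> b" "y \<in> level_set f \<psi> T n"
  shows "birkhoff_sum f \<psi> n y \<le> T" "T - b < birkhoff_sum f \<psi> n y"
  using assms(2) assms(1)[of "(f ^^ n) y"] by (simp_all add: level_set_def birkhoff_sum_Suc)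

text \<open>The level sets at the heights \<open>k a\<close>, with \<open>a\<close> a lower bound of the roof, cover \<open>X\<close> for each fixed time \<open>n\<close>;
  only heights at least \<open>n a\<close> occur, so the weights \<open>exp (-\<beta> k a)\<close> beat the growth of \<open>induced_Q\<close>.\<close>

lemma spanning_from_pressure:
  assumes \<phi>: "continuous_on UNIV \<phi>" and P: "pressure_at f \<psi> \<phi> \<epsilon> < ereal \<beta>0" and \<beta>: "\<beta>0 < \<beta>"
    and v: "\<And>x y. dist x y \<le> \<epsilon> \<Longrightarrow> \<bar>\<psi> x - \<psi> y\<bar> \<le> v"
  shows "\<exists>C. \<forall>\<^sub>F n in sequentially. \<exists>F. finite F \<and> spanning f n \<epsilon> UNIV F \<and>
    (\<Sum>x\<in>F. exp (birkhoff_sum f (\<lambda>x. \<phi> x - \<beta> * \<psi> x) n x)) \<le> exp (C + \<bar>\<beta>\<bar> * v * real n)"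
proof -
  obtain a b where ab: "a > 0" "b > 0" "\<And>x. a \<le> \<psi> x" "\<And>x. \<psi> x \<le> b" by (rule roof_bounds) blast
  have "\<forall>\<^sub>F T in at_top. induced_Q f \<psi> \<phi> T \<epsilon> < ennreal (exp (\<beta>0 * T))"
    using Limsup_lessD[OF P[unfolded pressure_at_def]] eventually_gt_at_top[of 0]
  proof eventually_elim
    case (elim T)
    show ?case by (rule ln_ennreal_less_imp[OF ereal_divide_less_imp[OF elim(2) elim(1)]])
  qed
  then obtain T0 where T0: "\<And>T. T \<ge> T0 \<Longrightarrow> induced_Q f \<psi> \<phi> T \<epsilon> < ennreal (exp (\<beta>0 * T))"
    unfolding eventually_at_top_linorder by auto
  \<comment> \<open>Raising the height \<open>T\<close> by \<open>a\<close> multiplies the product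
    of the bound \<open>exp (\<beta>0 T)\<close> and the weight \<open>exp (- \<beta> T)\<close> by
    \<open>\<rho> < 1\<close>, so the sum over the heights is geometric.\<close>
  define \<rho> where "\<rho> = exp (- ((\<beta> - \<beta>0) * a))"
  have \<rho>: "0 \<le> \<rho>" "\<rho> < 1" using \<beta> ab(1) by (simp_all add: \<rho>_def)
  define C where "C = \<bar>\<beta>\<bar> * b + ln (1 / (1 - \<rho>))"
  \<comment> \<open>From \<open>n0\<close> on, all heights that occur are at least
    \<open>n a\<close> and therefore lie beyond \<open>T0\<close>.\<close>
  obtain n0 where n0: "real n0 * a > T0" using reals_Archimedean3[OF ab(1)] by auto
  have "\<forall>\<^sub>F n in sequentially. \<exists>F. finite F \<and> spanning f n \<epsilon> UNIV F \<and>
    (\<Sum>x\<in>F. exp (birkhoff_sum f (\<lambda>x. \<phi> x - \<beta> * \<psi> x) n x)) \<le> exp (C + \<bar>\<beta>\<bar> * v * real n)"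
    using eventually_ge_at_top[of n0] eventually_gt_at_top[of 0]
  proof eventually_elim
    case (elim n)
    have n: "n > 0" by (rule elim(2))
    let ?S = "birkhoff_sum f \<psi> n" and ?S\<phi> = "birkhoff_sum f \<phi> n" and ?S\<Phi> = "birkhoff_sum f (\<lambda>x. \<phi> x - \<beta> * \<psi> x) n"
    define K where "K = {k. level_set f \<psi> (real k * a) n \<noteq> {}}"
    have Kge: "n \<le> k" if k: "k \<in> K" for k
    proof -
      obtain y where y: "y \<in> level_set f \<psi> (real k * a) n" using k by (auto simp: K_def)
      have "real n * a \<le> ?S y" by (rule birkhoff_sum_ge[OF ab(3)])
      also have "\<dots> \<le> real k * a" by (rule level_set_birkhoff_bounds(1)[OF ab(4) y])
      finally show ?thesis using ab(1) by simp
    qed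
    have "k \<le> nat \<lceil>(real n + 1) * b / a\<rceil>" if k: "k \<in> K" for k
    proof -
      obtain y where y: "y \<in> level_set f \<psi> (real k * a) n" using k by (auto simp: K_def)
      have "real k * a \<le> ?S y + b" using level_set_birkhoff_bounds(2)[OF ab(4) y] by simp
      also have "\<dots> \<le> (real n + 1) * b" using birkhoff_sum_le[OF ab(4), of n y] by (simp add: algebra_simps)
      finally have "real k \<le> (real n + 1) * b / a" using ab(1) by (simp add: pos_le_divide_eq)
      then show ?thesis by linarith
    qed
    then have "K \<subseteq> {..nat \<lceil>(real n + 1) * b / a\<rceil>}" by auto
    then have finK: "finite K" by (rule finite_subset) simp
    have "\<forall>k\<in>K. \<exists>G. finite G \<and> spanning f n \<epsilon> (level_set f \<psi> (real k * a) n) G \<and>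
      (\<forall>x\<in>G. \<exists>y\<in>level_set f \<psi> (real k * a) n. bowen_dist f n x y \<le> \<epsilon>) \<and>
      (\<Sum>x\<in>G. exp (?S\<phi> x)) \<le> exp (\<beta>0 * (real k * a))"
    proof
      fix k assume k: "k \<in> K"
      have "T0 \<le> real n0 * a" using n0 by simp
      also have "\<dots> \<le> real k * a" using elim(1) Kge[OF k] ab(1) by (intro mult_right_mono) simp_all
      finally have Q: "induced_Q f \<psi> \<phi> (real k * a) \<epsilon> < ennreal (exp (\<beta>0 * (real k * a)))" by (rule T0)
      have ne: "level_set f \<psi> (real k * a) n \<noteq> {}" using k by (simp add: K_def)
      obtain G where "finite G" "spanning f n \<epsilon> (level_set f \<psi> (real k * a) n) G"
        "\<And>x. x \<in> G \<Longrightarrow> \<exists>y\<in>level_set f \<psi> (real k * a) n. bowen_dist f n x y \<le> \<epsilon>"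
        "(\<Sum>x\<in>G. exp (?S\<phi> x)) \<le> exp (\<beta>0 * (real k * a))"
        by (rule level_set_spanning_sum[OF \<phi> n ne Q]) blast
      then show "\<exists>G. finite G \<and> spanning f n \<epsilon> (level_set f \<psi> (real k * a) n) G \<and>
        (\<forall>x\<in>G. \<exists>y\<in>level_set f \<psi> (real k * a) n. bowen_dist f n x y \<le> \<epsilon>) \<and>
        (\<Sum>x\<in>G. exp (?S\<phi> x)) \<le> exp (\<beta>0 * (real k * a))" by (intro exI[of _ G]) simp
    qed
    from bchoice[OF this] obtain G where GG: "\<forall>k\<in>K. finite (G k) \<and> spanning f n \<epsilon> (level_set f \<psi> (real k * a) n) (G k) \<and>
      (\<forall>x\<in>G k. \<exists>y\<in>level_set f \<psi> (real k * a) n. bowen_dist f n x y \<le> \<epsilon>) \<and>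
      (\<Sum>x\<in>G k. exp (?S\<phi> x)) \<le> exp (\<beta>0 * (real k * a))" by (elim exE)
    have G: "finite (G k)" "spanning f n \<epsilon> (level_set f \<psi> (real k * a) n) (G k)"
      "\<forall>x\<in>G k. \<exists>y\<in>level_set f \<psi> (real k * a) n. bowen_dist f n x y \<le> \<epsilon>"
      "(\<Sum>x\<in>G k. exp (?S\<phi> x)) \<le> exp (\<beta>0 * (real k * a))" if "k \<in> K" for k
      using bspec[OF GG that] by - (elim conjE, assumption)+
    have Gsum: "(\<Sum>x\<in>G k. exp (?S\<Phi> x)) \<le> exp (\<bar>\<beta>\<bar> * (b + real n * v)) * \<rho> ^ k" if k: "k \<in> K" for k
    proof -
      \<comment> \<open>\<open>x\<close> is close to a point \<open>y\<close> of the level set: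
        \<open>b\<close> bounds the distance of the Birkhoff sum of \<psi> at \<open>y\<close> from
        the height, and \<open>n v\<close> the change from \<open>y\<close> to
        \<open>x\<close>.\<close>
      have pt: "exp (?S\<Phi> x) \<le> exp (- \<beta> * (real k * a) + \<bar>\<beta>\<bar> * (b + real n * v)) * exp (?S\<phi> x)" if x: "x \<in> G k" for x
      proof -
        from bspec[OF G(3)[OF k] x] obtain y where y: "y \<in> level_set f \<psi> (real k * a) n" "bowen_dist f n x y \<le> \<epsilon>"
          by (elim bexE)
        have "\<bar>?S x - ?S y\<bar> \<le> real n * v" by (rule birkhoff_sum_close[OF bowen_dist_leD[OF y(2)] v])
        then have "\<bar>?S x - real k * a\<bar> \<le> b + real n * v"
          using level_set_birkhoff_bounds[OF ab(4) y(1)] ab(2) by linarith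
        then have "\<bar>\<beta>\<bar> * \<bar>?S x - real k * a\<bar> \<le> \<bar>\<beta>\<bar> * (b + real n * v)" by (rule mult_left_mono) simp
        moreover have "- (\<beta> * (?S x - real k * a)) \<le> \<bar>\<beta>\<bar> * \<bar>?S x - real k * a\<bar>"
          unfolding abs_mult[symmetric] by linarith
        ultimately have "?S\<Phi> x \<le> - \<beta> * (real k * a) + \<bar>\<beta>\<bar> * (b + real n * v) + ?S\<phi> x"
          unfolding birkhoff_sum_diff_mult right_diff_distrib by linarith
        then show ?thesis by (simp flip: exp_add)
      qed
      have "(\<Sum>x\<in>G k. exp (?S\<Phi> x)) \<le> (\<Sum>x\<in>G k. exp (- \<beta> * (real k * a) + \<bar>\<beta>\<bar> * (b + real n * v)) * exp (?S\<phi> x))"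
        by (rule sum_mono) (rule pt)
      also have "\<dots> = exp (- \<beta> * (real k * a) + \<bar>\<beta>\<bar> * (b + real n * v)) * (\<Sum>x\<in>G k. exp (?S\<phi> x))"
        by (rule sum_distrib_left[symmetric])
      also have "\<dots> \<le> exp (- \<beta> * (real k * a) + \<bar>\<beta>\<bar> * (b + real n * v)) * exp (\<beta>0 * (real k * a))"
        by (rule mult_left_mono[OF G(4)[OF k]]) simp
      also have "\<dots> = exp (\<bar>\<beta>\<bar> * (b + real n * v)) * exp (real k * (- ((\<beta> - \<beta>0) * a)))"
        unfolding exp_add[symmetric] by (rule arg_cong[where f=exp]) (simp add: algebra_simps)
      also have "exp (real k * (- ((\<beta> - \<beta>0) * a))) = \<rho> ^ k" unfolding \<rho>_def by (rule exp_of_nat_mult)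
      finally show ?thesis .
    qed
    let ?F = "\<Union>k\<in>K. G k"
    have finF: "finite ?F" using finK G(1) by (rule finite_UN_I)
    have "spanning f n \<epsilon> UNIV ?F"
      unfolding spanning_def
    proof
      fix y :: 'a
      \<comment> \<open>The lowest multiple of \<open>a\<close> not below \<open>?S y\<close>; it
        exceeds \<open>?S y\<close> by less than \<open>a\<close>, so the next step of the orbit
        crosses it.\<close>
      define k where "k = nat \<lceil>?S y / a\<rceil>"
      have S0: "0 \<le> ?S y / a" using birkhoff_sum_ge[OF ab(3), of n y] ab(1)
        by (intro divide_nonneg_nonneg) (auto intro: order_trans[rotated])
      have "?S y / a \<le> real k" "real k < ?S y / a + 1" using S0 unfolding k_def by linarith+
      then have 1: "?S y \<le> real k * a" "real k * a < ?S y + a"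
        using ab(1) by (simp_all add: field_simps)
      have "real k * a < birkhoff_sum f \<psi> (Suc n) y"
        unfolding birkhoff_sum_Suc using 1(2) ab(3)[of "(f ^^ n) y"] by linarith
      then have y: "y \<in> level_set f \<psi> (real k * a) n" using 1(1) by (simp add: level_set_def)
      then have k: "k \<in> K" by (auto simp: K_def)
      from G(2)[OF k] y obtain x where "x \<in> G k" "bowen_dist f n x y \<le> \<epsilon>" unfolding spanning_def by auto
      then show "\<exists>x\<in>?F. bowen_dist f n x y \<le> \<epsilon>" using k by (intro bexI[of _ x] UN_I[of k])
    qed
    moreover have "(\<Sum>x\<in>?F. exp (?S\<Phi> x)) \<le> exp (C + \<bar>\<beta>\<bar> * v * real n)"
    proof -
      have "(\<Sum>x\<in>?F. exp (?S\<Phi> x)) \<le> (\<Sum>k\<in>K. \<Sum>x\<in>G k. exp (?S\<Phi> x))" by (rule sum_UN_le[OF finK G(1)]) simp_all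
      also have "\<dots> \<le> (\<Sum>k\<in>K. exp (\<bar>\<beta>\<bar> * (b + real n * v)) * \<rho> ^ k)" by (rule sum_mono) (rule Gsum)
      also have "\<dots> = exp (\<bar>\<beta>\<bar> * (b + real n * v)) * (\<Sum>k\<in>K. \<rho> ^ k)" by (rule sum_distrib_left[symmetric])
      also have "\<dots> \<le> exp (\<bar>\<beta>\<bar> * (b + real n * v)) * (1 / (1 - \<rho>))"
        by (rule mult_left_mono[OF sum_power_le_geometric[OF \<rho> finK]]) simp
      also have "1 / (1 - \<rho>) = exp (ln (1 / (1 - \<rho>)))" using \<rho> by (intro exp_ln[symmetric]) simp
      also have "exp (\<bar>\<beta>\<bar> * (b + real n * v)) * exp (ln (1 / (1 - \<rho>))) = exp (C + \<bar>\<beta>\<bar> * v * real n)"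
        unfolding exp_add[symmetric] C_def by (rule arg_cong[where f=exp]) (simp add: algebra_simps)
      finally show ?thesis .
    qed
    ultimately show ?case using finF by (intro exI[of _ ?F]) simp
  qed
  then show ?thesis by (rule exI)
qed

lemma integrable_continuous:
  "M \<in> invariant_probs f \<Longrightarrow> continuous_on UNIV g \<Longrightarrow> integrable M (g :: 'a \<Rightarrow> real)"
  by (intro borel_prob_integrable[OF compact_UNIV]) (simp_all add: invariant_probs_def)

lemma integral_diff_mult_roof:
  assumes "M \<in> invariant_probs f" "continuous_on UNIV \<phi>"
  shows "(\<integral>x. \<phi> x - \<beta> * \<psi> x \<partial>M) = (\<integral>x. \<phi> x \<partial>M) - \<beta> * (\<integral>x. \<psi> x \<partial>M)"
  using integrable_continuous[OF assms] integrable_continuous[OF assms(1) \<psi>_continuous] by simp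

text \<open>For \<beta> above the pressure the potential \<phi> - \<beta> \<psi> has spanning sums
  of arbitrarily small exponential growth, by \<open>spanning_from_pressure\<close>.\<close>

lemma measure_entropy_le_pressure:
  assumes \<phi>: "continuous_on UNIV \<phi>" and M: "M \<in> invariant_probs f"
    and P: "induced_pressure f \<psi> \<phi> < ereal \<beta>"
  shows "measure_entropy f M \<le> ereal (\<beta> * (\<integral>x. \<psi> x \<partial>M) - (\<integral>x. \<phi> x \<partial>M))"
proof -
  interpret compact_invariant_measure f M by (rule compact_invariant_measureI[OF M])
  obtain \<beta>0 where \<beta>0: "induced_pressure f \<psi> \<phi> < ereal \<beta>0" "ereal \<beta>0 < ereal \<beta>" using ereal_dense2[OF P] by auto
  have Pe: "pressure_at f \<psi> \<phi> \<epsilon> < ereal \<beta>0" if "\<epsilon> > 0" for \<epsilon>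
  proof -
    have "pressure_at f \<psi> \<phi> \<epsilon> \<le> induced_pressure f \<psi> \<phi>"
      unfolding induced_pressure_eq_SUP using that by (intro SUP_upper) simp
    then show ?thesis using \<beta>0(1) by simp
  qed
  let ?\<Phi> = "\<lambda>x. \<phi> x - \<beta> * \<psi> x"
  have c\<Phi>: "continuous_on UNIV ?\<Phi>" by (intro continuous_intros \<phi> \<psi>_continuous)
  have "process_rate X + (\<integral>x. ?\<Phi> x \<partial>M) \<le> 0" if X: "simple_function M X" for X :: "'a \<Rightarrow> 'a set"
  proof (rule process_rate_le_spanning_growth[OF c\<Phi> X])
    fix r :: real assume r: "r > 0"
    \<comment> \<open>The variation of \<psi> enters multiplied by
      \<open>\<bar>\<beta>\<bar>\<close>; the added 1 avoids division by 0.\<close>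
    define v where "v = r / (\<bar>\<beta>\<bar> + 1)"
    have v: "v > 0" "\<bar>\<beta>\<bar> * v \<le> r" using r by (simp_all add: v_def field_simps)
    obtain \<delta> where \<delta>: "\<delta> > 0" "\<And>x y. dist x y \<le> \<delta> \<Longrightarrow> \<bar>\<psi> x - \<psi> y\<bar> \<le> v"
      by (rule uniformly_continuous_UNIV[OF compact_UNIV \<psi>_continuous v(1)]) blast
    show "\<exists>\<epsilon>0>0. \<forall>\<epsilon>. 0 < \<epsilon> \<and> \<epsilon> \<le> \<epsilon>0 \<longrightarrow> (\<exists>C. \<forall>\<^sub>F n in sequentially. \<exists>F. finite F \<and>
      spanning f n \<epsilon> UNIV F \<and> (\<Sum>x\<in>F. exp (birkhoff_sum f ?\<Phi> n x)) \<le> exp (C + r * real n))"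
    proof (rule exI[of _ \<delta>], rule conjI, rule \<delta>(1), intro allI impI)
      fix \<epsilon> assume \<epsilon>: "0 < \<epsilon> \<and> \<epsilon> \<le> \<delta>"
      have "\<exists>C. \<forall>\<^sub>F n in sequentially. \<exists>F. finite F \<and> spanning f n \<epsilon> UNIV F \<and>
        (\<Sum>x\<in>F. exp (birkhoff_sum f ?\<Phi> n x)) \<le> exp (C + \<bar>\<beta>\<bar> * v * real n)"
        using \<epsilon> \<beta>0(2) by (intro spanning_from_pressure[OF \<phi> Pe] \<delta>(2)) simp_all
      then obtain C where C: "\<forall>\<^sub>F n in sequentially. \<exists>F. finite F \<and> spanning f n \<epsilon> UNIV F \<and>
        (\<Sum>x\<in>F. exp (birkhoff_sum f ?\<Phi> n x)) \<le> exp (C + \<bar>\<beta>\<bar> * v * real n)" by (elim exE)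
      have "\<forall>\<^sub>F n in sequentially. \<exists>F. finite F \<and> spanning f n \<epsilon> UNIV F \<and>
        (\<Sum>x\<in>F. exp (birkhoff_sum f ?\<Phi> n x)) \<le> exp (C + r * real n)"
        using C
      proof eventually_elim
        case (elim n)
        then obtain F where F: "finite F" "spanning f n \<epsilon> UNIV F"
          "(\<Sum>x\<in>F. exp (birkhoff_sum f ?\<Phi> n x)) \<le> exp (C + \<bar>\<beta>\<bar> * v * real n)" by (elim exE conjE)
        have "exp (C + \<bar>\<beta>\<bar> * v * real n) \<le> exp (C + r * real n)" using v(2) by (simp add: mult_right_mono)
        from order_trans[OF F(3) this] F(1,2) show ?case by (intro exI[of _ F] conjI)
      qed
      then show "\<exists>C. \<forall>\<^sub>F n in sequentially. \<exists>F. finite F \<and> spanning f n \<epsilon> UNIV F \<and>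
        (\<Sum>x\<in>F. exp (birkhoff_sum f ?\<Phi> n x)) \<le> exp (C + r * real n)" by (rule exI)
    qed
  qed
  then show ?thesis
    unfolding integral_diff_mult_roof[OF M \<phi>] by (intro measure_entropy_le) (smt (verit))
qed

text \<open>At a height \<open>T\<close> where \<open>induced_Q\<close> exceeds
  \<open>exp (\<beta>1 T)\<close>, maximal separated subsets of the level sets form an admissible
  family. At most \<open>T / a\<close> times occur, so one of them carries at least
  \<open>a / T\<close> times \<open>exp (\<beta>1 T)\<close>, and the gap between
  \<open>\<beta>\<close> and \<open>\<beta>1\<close> pays for this factor.\<close>

lemma separated_set_from_pressure:
  assumes \<phi>: "continuous_on UNIV \<phi>" and \<epsilon>: "\<epsilon> > 0" and \<beta>: "\<beta> < \<beta>1" "ereal \<beta>1 < pressure_at f \<psi> \<phi> \<epsilon>"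
    and ab: "a > 0" "b > 0" "\<And>x. a \<le> \<psi> x" "\<And>x. \<psi> x \<le> b"
  shows "\<exists>n E. N < n \<and> finite E \<and> E \<noteq> {} \<and>
    (\<forall>x\<in>E. \<forall>y\<in>E. x \<noteq> y \<longrightarrow> (\<exists>i<n. \<epsilon> < dist ((f ^^ i) x) ((f ^^ i) y))) \<and>
    exp (- (\<bar>\<beta>\<bar> * b)) \<le> (\<Sum>x\<in>E. exp (birkhoff_sum f (\<lambda>x. \<phi> x - \<beta> * \<psi> x) n x))"
proof -
  define \<delta> where "\<delta> = \<beta>1 - \<beta>"
  have \<delta>: "\<delta> > 0" using \<beta>(1) by (simp add: \<delta>_def)
  \<comment> \<open>The first bound gives
    \<open>T / a \<le> (\<delta> T)^2 / 2 \<le> exp (\<delta> T)\<close>, the second forces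
    \<open>N < n\<close>, and the last makes \<open>T\<close> positive.\<close>
  define T1 where "T1 = max (2 / (a * \<delta>^2)) (max ((real N + 2) * b) 1)"
  have "\<exists>T\<ge>T1. ereal \<beta>1 < ln_ennreal (induced_Q f \<psi> \<phi> T \<epsilon>) / ereal T"
  proof (rule ccontr)
    assume "\<not> (\<exists>T\<ge>T1. ereal \<beta>1 < ln_ennreal (induced_Q f \<psi> \<phi> T \<epsilon>) / ereal T)"
    then have "\<forall>\<^sub>F T in at_top. ln_ennreal (induced_Q f \<psi> \<phi> T \<epsilon>) / ereal T \<le> ereal \<beta>1"
      unfolding eventually_at_top_linorder by (intro exI[of _ T1]) (auto simp: not_less)
    from Limsup_bounded[OF this] show False using \<beta>(2) by (simp add: pressure_at_def)
  qed
  then obtain T where T: "T \<ge> T1" "ereal \<beta>1 < ln_ennreal (induced_Q f \<psi> \<phi> T \<epsilon>) / ereal T" by (elim exE conjE)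
  have Tb: "T \<ge> 2 / (a * \<delta>^2)" "T \<ge> (real N + 2) * b" "T > 0" using T(1) by (simp_all add: T1_def)
  have Q: "ennreal (exp (\<beta>1 * T)) < induced_Q f \<psi> \<phi> T \<epsilon>"
    by (rule less_ln_ennreal_imp[OF less_ereal_divide_imp[OF Tb(3) T(2)]])
  let ?L = "level_set f \<psi> T" and ?I = "level_times f \<psi> T"
  have Ia: "real n \<le> T / a" "n > 0" if n: "n \<in> ?I" for n
  proof -
    obtain y where y: "y \<in> ?L n" using n by (auto simp: level_times_def)
    have "real n * a \<le> birkhoff_sum f \<psi> n y" by (rule birkhoff_sum_ge[OF ab(3)])
    also have "\<dots> \<le> T" by (rule level_set_birkhoff_bounds(1)[OF ab(4) y])
    finally show "real n \<le> T / a" using ab(1) by (simp add: pos_le_divide_eq)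
    show "n > 0" using n by (simp add: level_times_def)
  qed
  have "n \<in> {1..nat \<lfloor>T / a\<rfloor>}" if n: "n \<in> ?I" for n
    using Ia[OF n] by (simp add: le_nat_floor Suc_le_eq)
  then have Isub: "?I \<subseteq> {1..nat \<lfloor>T / a\<rfloor>}" by (rule subsetI)
  then have finI: "finite ?I" by (rule finite_subset) simp
  have "card ?I \<le> nat \<lfloor>T / a\<rfloor>" using card_mono[OF _ Isub] by simp
  moreover have "T / a \<ge> 0" using Tb(3) ab(1) by simp
  ultimately have cardI: "real (card ?I) \<le> T / a" by linarith
  have "\<forall>n\<in>?I. \<exists>E. finite E \<and> E \<subseteq> ?L n \<and> spanning f n \<epsilon> (?L n) E \<and>
    (\<forall>x\<in>E. \<forall>y\<in>E. x \<noteq> y \<longrightarrow> (\<exists>i<n. \<epsilon> < dist ((f ^^ i) x) ((f ^^ i) y)))"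
  proof
    fix n assume n: "n \<in> ?I"
    obtain E where "finite E" "E \<subseteq> ?L n" "spanning f n \<epsilon> (?L n) E"
      "\<And>x y. x \<in> E \<Longrightarrow> y \<in> E \<Longrightarrow> x \<noteq> y \<Longrightarrow> \<exists>i<n. \<epsilon> < dist ((f ^^ i) x) ((f ^^ i) y)"
      by (rule maximal_separated[OF Ia(2)[OF n] \<epsilon>]) blast
    then show "\<exists>E. finite E \<and> E \<subseteq> ?L n \<and> spanning f n \<epsilon> (?L n) E \<and>
      (\<forall>x\<in>E. \<forall>y\<in>E. x \<noteq> y \<longrightarrow> (\<exists>i<n. \<epsilon> < dist ((f ^^ i) x) ((f ^^ i) y)))"
      by (intro exI[of _ E]) simp
  qed
  from bchoice[OF this] obtain E where EE: "\<forall>n\<in>?I. finite (E n) \<and> E n \<subseteq> ?L n \<and> spanning f n \<epsilon> (?L n) (E n) \<and>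
    (\<forall>x\<in>E n. \<forall>y\<in>E n. x \<noteq> y \<longrightarrow> (\<exists>i<n. \<epsilon> < dist ((f ^^ i) x) ((f ^^ i) y)))" by (elim exE)
  have E: "finite (E n)" "E n \<subseteq> ?L n" "spanning f n \<epsilon> (?L n) (E n)"
    "\<forall>x\<in>E n. \<forall>y\<in>E n. x \<noteq> y \<longrightarrow> (\<exists>i<n. \<epsilon> < dist ((f ^^ i) x) ((f ^^ i) y))" if "n \<in> ?I" for n
    using bspec[OF EE that] by - (elim conjE, assumption)+
  let ?s = "\<lambda>n. \<Sum>x\<in>E n. exp (birkhoff_sum f \<phi> n x)"
  have "induced_Q f \<psi> \<phi> T \<epsilon> \<le> (\<Sum>\<^sub>\<infinity>n\<in>?I. \<Sum>\<^sub>\<infinity>x\<in>E n. ennreal (exp (birkhoff_sum f \<phi> n x)))"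
    unfolding induced_Q_def by (rule INF_lower) (simp add: E(3))
  also have "\<dots> = (\<Sum>n\<in>?I. \<Sum>\<^sub>\<infinity>x\<in>E n. ennreal (exp (birkhoff_sum f \<phi> n x)))" by (rule infsum_finite[OF finI])
  also have "\<dots> = (\<Sum>n\<in>?I. ennreal (?s n))"
    by (rule sum.cong[OF refl]) (simp add: infsum_finite[OF E(1)] sum_ennreal)
  also have "\<dots> = ennreal (\<Sum>n\<in>?I. ?s n)" by (simp add: sum_ennreal sum_nonneg)
  finally have "ennreal (exp (\<beta>1 * T)) < ennreal (\<Sum>n\<in>?I. ?s n)" using Q by simp
  then have big: "exp (\<beta>1 * T) < (\<Sum>n\<in>?I. ?s n)" by (simp add: ennreal_less_iff)
  have "\<exists>n\<in>?I. exp (\<beta>1 * T) \<le> ?s n * (T / a)"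
  proof (rule ccontr)
    assume "\<not> (\<exists>n\<in>?I. exp (\<beta>1 * T) \<le> ?s n * (T / a))"
    then have "?s n \<le> exp (\<beta>1 * T) / (T / a)" if "n \<in> ?I" for n
      using that Tb(3) ab(1) by (subst pos_le_divide_eq) (auto simp: not_le intro: less_imp_le)
    then have "(\<Sum>n\<in>?I. ?s n) \<le> (\<Sum>n\<in>?I. exp (\<beta>1 * T) / (T / a))" by (rule sum_mono)
    also have "\<dots> = real (card ?I) * (exp (\<beta>1 * T) / (T / a))" by simp
    also have "\<dots> \<le> (T / a) * (exp (\<beta>1 * T) / (T / a))"
      using Tb(3) ab(1) by (intro mult_right_mono cardI) simp_all
    also have "\<dots> = exp (\<beta>1 * T)" using Tb(3) ab(1) by simp
    finally show False using big by simp
  qed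
  then obtain n where n: "n \<in> ?I" "exp (\<beta>1 * T) \<le> ?s n * (T / a)" by (elim bexE)
  have "N < n"
  proof -
    obtain y where y: "y \<in> ?L n" using n(1) by (auto simp: level_times_def)
    have "T - b < birkhoff_sum f \<psi> n y" by (rule level_set_birkhoff_bounds(2)[OF ab(4) y])
    also have "\<dots> \<le> real n * b" by (rule birkhoff_sum_le[OF ab(4)])
    finally have "(real N + 2) * b < (real n + 1) * b" using Tb(2) by (simp add: algebra_simps)
    then show ?thesis using ab(2) by simp
  qed
  have pt: "exp (- (\<beta> * T) - \<bar>\<beta>\<bar> * b) * exp (birkhoff_sum f \<phi> n x) \<le> exp (birkhoff_sum f (\<lambda>x. \<phi> x - \<beta> * \<psi> x) n x)"
    if x: "x \<in> E n" for x
  proof -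
    let ?S = "birkhoff_sum f \<psi> n x"
    have "x \<in> ?L n" using subsetD[OF E(2)[OF n(1)] x] .
    from level_set_birkhoff_bounds[OF ab(4) this] have "\<bar>?S - T\<bar> \<le> b" by linarith
    then have "\<bar>\<beta>\<bar> * \<bar>?S - T\<bar> \<le> \<bar>\<beta>\<bar> * b" by (rule mult_left_mono) simp
    moreover have "\<beta> * (?S - T) \<le> \<bar>\<beta>\<bar> * \<bar>?S - T\<bar>" unfolding abs_mult[symmetric] by linarith
    ultimately have "- (\<beta> * T) - \<bar>\<beta>\<bar> * b + birkhoff_sum f \<phi> n x \<le> birkhoff_sum f (\<lambda>x. \<phi> x - \<beta> * \<psi> x) n x"
      unfolding birkhoff_sum_diff_mult right_diff_distrib by linarith
    then show ?thesis by (simp flip: exp_add)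
  qed
  have Ta: "T / a \<le> exp (\<delta> * T)"
  proof -
    have "2 \<le> T * (a * \<delta>^2)" using Tb(1) ab(1) \<delta> by (simp add: pos_divide_le_eq)
    then have "T * 2 \<le> T * (T * (a * \<delta>^2))" using Tb(3) by (intro mult_left_mono) simp_all
    then have "T / a \<le> (\<delta> * T)^2 / 2" using ab(1) by (simp add: field_simps power2_eq_square)
    also have "\<dots> \<le> exp (\<delta> * T)"
    proof -
      have "0 \<le> \<delta> * T" using \<delta> Tb(3) by simp
      from exp_lower_Taylor_quadratic[OF this] this show ?thesis by linarith
    qed
    finally show ?thesis .
  qed
  have Ta0: "T / a > 0" using Tb(3) ab(1) by simp
  have "exp (- (\<bar>\<beta>\<bar> * b)) * (T / a) \<le> exp (- (\<bar>\<beta>\<bar> * b)) * exp (\<delta> * T)"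
    by (rule mult_left_mono[OF Ta]) simp
  also have "\<dots> = exp (- (\<beta> * T) - \<bar>\<beta>\<bar> * b) * exp (\<beta>1 * T)"
    unfolding exp_add[symmetric] by (rule arg_cong[where f=exp]) (simp add: \<delta>_def algebra_simps)
  also have "\<dots> \<le> exp (- (\<beta> * T) - \<bar>\<beta>\<bar> * b) * (?s n * (T / a))"
    by (rule mult_left_mono[OF n(2)]) simp
  also have "\<dots> = (exp (- (\<beta> * T) - \<bar>\<beta>\<bar> * b) * ?s n) * (T / a)" by simp
  finally have "exp (- (\<bar>\<beta>\<bar> * b)) \<le> exp (- (\<beta> * T) - \<bar>\<beta>\<bar> * b) * ?s n"
    using Ta0 by (rule mult_right_le_imp_le)
  also have "\<dots> = (\<Sum>x\<in>E n. exp (- (\<beta> * T) - \<bar>\<beta>\<bar> * b) * exp (birkhoff_sum f \<phi> n x))" by (rule sum_distrib_left)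
  also have "\<dots> \<le> (\<Sum>x\<in>E n. exp (birkhoff_sum f (\<lambda>x. \<phi> x - \<beta> * \<psi> x) n x))" by (rule sum_mono) (rule pt)
  finally have low: "exp (- (\<bar>\<beta>\<bar> * b)) \<le> (\<Sum>x\<in>E n. exp (birkhoff_sum f (\<lambda>x. \<phi> x - \<beta> * \<psi> x) n x))" .
  have "E n \<noteq> {}"
  proof
    assume "E n = {}"
    then show False using low by simp
  qed
  then show ?thesis using \<open>N < n\<close> E(1,4)[OF n(1)] low by (intro exI[of _ n] exI[of _ "E n"]) simp
qed

text \<open>The separated sets exist for arbitrarily long times with a lower bound independent of
  the time, so Misiurewicz's construction applies to \<phi> - \<beta> \<psi> with
  \<open>C = \<bar>\<beta>\<bar> * b\<close>.\<close>

lemma measure_entropy_ge_pressure: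
  assumes \<phi>: "continuous_on UNIV \<phi>" and P: "ereal \<beta> < induced_pressure f \<psi> \<phi>"
  obtains M where "M \<in> invariant_probs f"
    "ereal (\<beta> * (\<integral>x. \<psi> x \<partial>M) - (\<integral>x. \<phi> x \<partial>M)) \<le> measure_entropy f M"
proof -
  obtain \<epsilon> where \<epsilon>: "\<epsilon> > 0" "ereal \<beta> < pressure_at f \<psi> \<phi> \<epsilon>"
    using P unfolding induced_pressure_eq_SUP less_SUP_iff by auto
  obtain \<beta>1 where \<beta>1: "ereal \<beta> < ereal \<beta>1" "ereal \<beta>1 < pressure_at f \<psi> \<phi> \<epsilon>" using ereal_dense2[OF \<epsilon>(2)] by auto
  have \<beta>\<beta>: "\<beta> < \<beta>1" using \<beta>1(1) by simp
  obtain a b where ab: "a > 0" "b > 0" "\<And>x. a \<le> \<psi> x" "\<And>x. \<psi> x \<le> b" by (rule roof_bounds) blast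
  let ?\<Phi> = "\<lambda>x. \<phi> x - \<beta> * \<psi> x"
  have c\<Phi>: "continuous_on UNIV ?\<Phi>" by (intro continuous_intros \<phi> \<psi>_continuous)
  have "\<forall>N. \<exists>p. N < fst p \<and> finite (snd p) \<and> snd p \<noteq> {} \<and>
    (\<forall>x\<in>snd p. \<forall>y\<in>snd p. x \<noteq> y \<longrightarrow> (\<exists>i<fst p. \<epsilon> < dist ((f ^^ i) x) ((f ^^ i) y))) \<and>
    exp (- (\<bar>\<beta>\<bar> * b)) \<le> (\<Sum>x\<in>snd p. exp (birkhoff_sum f ?\<Phi> (fst p) x))"
  proof
    fix N
    from separated_set_from_pressure[OF \<phi> \<epsilon>(1) \<beta>\<beta> \<beta>1(2) ab, of N]
    obtain n E where "N < n \<and> finite E \<and> E \<noteq> {} \<and>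
      (\<forall>x\<in>E. \<forall>y\<in>E. x \<noteq> y \<longrightarrow> (\<exists>i<n. \<epsilon> < dist ((f ^^ i) x) ((f ^^ i) y))) \<and>
      exp (- (\<bar>\<beta>\<bar> * b)) \<le> (\<Sum>x\<in>E. exp (birkhoff_sum f ?\<Phi> n x))" by (elim exE)
    then show "\<exists>p. N < fst p \<and> finite (snd p) \<and> snd p \<noteq> {} \<and>
      (\<forall>x\<in>snd p. \<forall>y\<in>snd p. x \<noteq> y \<longrightarrow> (\<exists>i<fst p. \<epsilon> < dist ((f ^^ i) x) ((f ^^ i) y))) \<and>
      exp (- (\<bar>\<beta>\<bar> * b)) \<le> (\<Sum>x\<in>snd p. exp (birkhoff_sum f ?\<Phi> (fst p) x))"
      by (intro exI[of _ "(n, E)"]) simp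
  qed
  from choice[OF this] obtain p where pp: "\<forall>N. N < fst (p N) \<and> finite (snd (p N)) \<and> snd (p N) \<noteq> {} \<and>
    (\<forall>x\<in>snd (p N). \<forall>y\<in>snd (p N). x \<noteq> y \<longrightarrow> (\<exists>i<fst (p N). \<epsilon> < dist ((f ^^ i) x) ((f ^^ i) y))) \<and>
    exp (- (\<bar>\<beta>\<bar> * b)) \<le> (\<Sum>x\<in>snd (p N). exp (birkhoff_sum f ?\<Phi> (fst (p N)) x))" by (elim exE)
  have p: "N < fst (p N)" "finite (snd (p N))" "snd (p N) \<noteq> {}"
    "\<forall>x\<in>snd (p N). \<forall>y\<in>snd (p N). x \<noteq> y \<longrightarrow> (\<exists>i<fst (p N). \<epsilon> < dist ((f ^^ i) x) ((f ^^ i) y))"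
    "exp (- (\<bar>\<beta>\<bar> * b)) \<le> (\<Sum>x\<in>snd (p N). exp (birkhoff_sum f ?\<Phi> (fst (p N)) x))" for N
    using spec[OF pp, of N] by - (elim conjE, assumption)+
  have p0: "fst (p N) > 0" for N using p(1)[of N] by simp
  have flim: "filterlim (\<lambda>N. fst (p N)) sequentially sequentially"
    by (rule filterlim_at_top_mono[OF filterlim_ident]) (simp add: less_imp_le[OF p(1)])
  have sep: "\<exists>i<fst (p N). \<epsilon> < dist ((f ^^ i) x) ((f ^^ i) y)"
    if "x \<in> snd (p N)" "y \<in> snd (p N)" "x \<noteq> y" for N x y
    using p(4)[of N, rule_format, OF that] .
  obtain M where M: "M \<in> invariant_probs f" "ereal (- (\<integral>x. ?\<Phi> x \<partial>M)) \<le> measure_entropy f M"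
    by (rule separated_sets_entropy[OF compact_UNIV f_continuous c\<Phi> \<epsilon>(1) flim p0 p(2,3) sep p(5)])
  have "- (\<integral>x. ?\<Phi> x \<partial>M) = \<beta> * (\<integral>x. \<psi> x \<partial>M) - (\<integral>x. \<phi> x \<partial>M)"
    unfolding integral_diff_mult_roof[OF M(1) \<phi>] by simp
  with M show ?thesis by (intro that) simp_all
qed

end

subsection \<open>Mixtures of measures\<close>

context
  fixes \<mu> \<nu> :: "'a::metric_space measure" and p :: real
  assumes \<mu>: "\<mu> \<in> borel_probs" and \<nu>: "\<nu> \<in> borel_probs" and p: "p \<in> {0..1}"
begin

lemma sets_mix_measure: "sets (mix_measure p \<mu> \<nu>) = sets borel"
  unfolding mix_measure_def by (metis sets.sets_measure_of_eq space_borel)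

lemma emeasure_mix_measure:
  assumes A: "A \<in> sets borel"
  shows "emeasure (mix_measure p \<mu> \<nu>) A = ennreal p * emeasure \<mu> A + ennreal (1 - p) * emeasure \<nu> A"
proof -
  have s: "sets \<mu> = sets borel" "sets \<nu> = sets borel" using \<mu> \<nu> by (simp_all add: space_prob_algebra)
  let ?m = "\<lambda>A. ennreal p * emeasure \<mu> A + ennreal (1 - p) * emeasure \<nu> A"
  have "countably_additive (sets borel) ?m"
  proof (rule countably_additiveI)
    fix A :: "nat \<Rightarrow> 'a set"
    assume A: "range A \<subseteq> sets borel" "disjoint_family A"
    have "(\<Sum>i. ?m (A i)) = ennreal p * (\<Sum>i. emeasure \<mu> (A i)) + ennreal (1 - p) * (\<Sum>i. emeasure \<nu> (A i))"
      by (subst suminf_add[symmetric]) (simp_all add: ennreal_suminf_cmult)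
    also have "\<dots> = ?m (\<Union>i. A i)" using A s by (simp add: suminf_emeasure)
    finally show "(\<Sum>i. ?m (A i)) = ?m (\<Union>i. A i)" .
  qed
  moreover have "sigma_algebra UNIV (sets (borel :: 'a measure))" by (metis sets.sigma_algebra_axioms space_borel)
  ultimately show ?thesis
    unfolding mix_measure_def using A by (intro emeasure_measure_of_sigma) (simp_all add: positive_def)
qed

lemma mix_measure_borel_prob: "mix_measure p \<mu> \<nu> \<in> borel_probs"
proof -
  interpret M: prob_space \<mu> using \<mu> by (simp add: space_prob_algebra)
  interpret N: prob_space \<nu> using \<nu> by (simp add: space_prob_algebra)
  have "emeasure (mix_measure p \<mu> \<nu>) UNIV = ennreal p + ennreal (1 - p)"
    using emeasure_mix_measure[of UNIV] M.emeasure_space_1 N.emeasure_space_1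
    by (simp add: space_borel_prob[OF \<mu>] space_borel_prob[OF \<nu>])
  also have "\<dots> = 1" using p by (simp flip: ennreal_plus)
  finally have 1: "emeasure (mix_measure p \<mu> \<nu>) UNIV = 1" .
  have "space (mix_measure p \<mu> \<nu>) = UNIV" using sets_eq_imp_space_eq[OF sets_mix_measure] by simp
  then have "prob_space (mix_measure p \<mu> \<nu>)" using 1 by (intro prob_spaceI) simp
  then show ?thesis using sets_mix_measure by (simp add: space_prob_algebra)
qed

lemma nn_integral_mix_measure:
  assumes "g \<in> borel_measurable borel"
  shows "(\<integral>\<^sup>+x. g x \<partial>mix_measure p \<mu> \<nu>) = ennreal p * (\<integral>\<^sup>+x. g x \<partial>\<mu>) + ennreal (1 - p) * (\<integral>\<^sup>+x. g x \<partial>\<nu>)"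
proof -
  have s: "sets \<mu> = sets borel" "sets \<nu> = sets borel" using \<mu> \<nu> by (simp_all add: space_prob_algebra)
  note meas = measurable_cong_sets[OF s(1) refl] measurable_cong_sets[OF s(2) refl] measurable_cong_sets[OF sets_mix_measure refl]
  show ?thesis
    using assms
  proof (induction rule: borel_measurable_induct)
    case (cong u v)
    then have "u = v" by (intro ext) simp
    then show ?case using cong by simp
  next
    case (set A)
    then show ?case by (simp add: s sets_mix_measure emeasure_mix_measure)
  next
    case (mult u c)
    then show ?case by (simp add: meas nn_integral_cmult distrib_left mult.left_commute)
  next
    case (add u v)
    then show ?case by (simp add: meas nn_integral_add distrib_left add.assoc add.left_commute)
  next
    case (seq U)
    have inc: "incseq (\<lambda>i. \<integral>\<^sup>+x. U i x \<partial>Q)" for Q :: "'a measure"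
      using seq.hyps(3) by (intro incseq_SucI nn_integral_mono) (simp add: incseq_Suc_iff le_fun_def)
    have sup: "(\<integral>\<^sup>+x. (SUP i. U i) x \<partial>Q) = (SUP i. \<integral>\<^sup>+x. U i x \<partial>Q)"
      if "sets Q = sets borel" for Q :: "'a measure"
    proof -
      have "U i \<in> borel_measurable Q" for i unfolding measurable_cong_sets[OF that refl] by (rule seq.hyps(1))
      then show ?thesis
        using nn_integral_monotone_convergence_SUP[OF seq.hyps(3), of Q] by (simp add: image_comp)
    qed
    have "(\<integral>\<^sup>+x. (SUP i. U i) x \<partial>mix_measure p \<mu> \<nu>) =
        (SUP i. ennreal p * (\<integral>\<^sup>+x. U i x \<partial>\<mu>) + ennreal (1 - p) * (\<integral>\<^sup>+x. U i x \<partial>\<nu>))"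
      unfolding sup[OF sets_mix_measure] seq.IH ..
    also have "\<dots> = (SUP i. ennreal p * (\<integral>\<^sup>+x. U i x \<partial>\<mu>)) + (SUP i. ennreal (1 - p) * (\<integral>\<^sup>+x. U i x \<partial>\<nu>))"
      using inc[of \<mu>] inc[of \<nu>] by (intro ennreal_SUP_add) (auto simp: incseq_def intro: mult_left_mono)
    also have "\<dots> = ennreal p * (\<integral>\<^sup>+x. (SUP i. U i) x \<partial>\<mu>) + ennreal (1 - p) * (\<integral>\<^sup>+x. (SUP i. U i) x \<partial>\<nu>)"
      unfolding sup[OF s(1)] sup[OF s(2)] by (simp add: SUP_mult_left_ennreal)
    finally show ?case .
  qed
qed

text \<open>The formula is available for nonnegative functions; adding a bound \<open>B\<close>
  makes the continuous function nonnegative, and the constant cancels because all three measures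
  have total mass 1.\<close>

lemma integral_mix_measure:
  fixes g :: "'a \<Rightarrow> real"
  assumes c: "compact (UNIV :: 'a set)" and g: "continuous_on UNIV g"
  shows "(\<integral>x. g x \<partial>mix_measure p \<mu> \<nu>) = p * (\<integral>x. g x \<partial>\<mu>) + (1 - p) * (\<integral>x. g x \<partial>\<nu>)"
proof -
  obtain B where B: "\<And>x. \<bar>g x\<bar> \<le> B" by (rule continuous_UNIV_bounded[OF c g]) blast
  let ?g = "\<lambda>x. g x + B"
  have nn: "0 \<le> ?g x" for x using B[of x] by linarith
  have cg: "continuous_on UNIV ?g" by (intro continuous_intros g)
  have shift: "(\<integral>x. ?g x \<partial>Q) = (\<integral>x. g x \<partial>Q) + B" and nni: "0 \<le> (\<integral>x. ?g x \<partial>Q)"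
    and enn: "(\<integral>\<^sup>+x. ennreal (?g x) \<partial>Q) = ennreal (\<integral>x. ?g x \<partial>Q)"
    if Q: "Q \<in> borel_probs" for Q :: "'a measure"
  proof -
    interpret prob_space Q using Q by (simp add: space_prob_algebra)
    show "(\<integral>x. ?g x \<partial>Q) = (\<integral>x. g x \<partial>Q) + B" using borel_prob_integrable[OF c Q g] by (simp add: prob_space)
    show "0 \<le> (\<integral>x. ?g x \<partial>Q)" using nn by (intro Bochner_Integration.integral_nonneg)
    show "(\<integral>\<^sup>+x. ennreal (?g x) \<partial>Q) = ennreal (\<integral>x. ?g x \<partial>Q)"
      using nn by (intro nn_integral_eq_integral borel_prob_integrable[OF c Q cg]) simp
  qed
  have "ennreal (\<integral>x. ?g x \<partial>mix_measure p \<mu> \<nu>) = ennreal p * ennreal (\<integral>x. ?g x \<partial>\<mu>) + ennreal (1 - p) * ennreal (\<integral>x. ?g x \<partial>\<nu>)"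
    using nn_integral_mix_measure[of "\<lambda>x. ennreal (?g x)"] borel_measurable_continuous_onI[OF cg]
    by (simp add: enn[OF \<mu>] enn[OF \<nu>] enn[OF mix_measure_borel_prob])
  also have "\<dots> = ennreal (p * (\<integral>x. ?g x \<partial>\<mu>) + (1 - p) * (\<integral>x. ?g x \<partial>\<nu>))"
    using p nni[OF \<mu>] nni[OF \<nu>] by (simp add: ennreal_mult ennreal_plus)
  finally have "(\<integral>x. ?g x \<partial>mix_measure p \<mu> \<nu>) = p * (\<integral>x. ?g x \<partial>\<mu>) + (1 - p) * (\<integral>x. ?g x \<partial>\<nu>)"
    using p nni[OF \<mu>] nni[OF \<nu>] nni[OF mix_measure_borel_prob] by (subst (asm) ennreal_inj) simp_all
  then show ?thesis
    unfolding shift[OF \<mu>] shift[OF \<nu>] shift[OF mix_measure_borel_prob] by (simp add: algebra_simps)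
qed

end

subsection \<open>Variational principle, tangent functionals and equilibrium states\<close>

locale finite_entropy_system = suspended_system f \<psi> for f :: "'a::metric_space \<Rightarrow> 'a" and \<psi> +
  assumes top_entropy_finite: "top_entropy f < \<infinity>"
begin

lemma integral_roof_bounds:
  assumes "M \<in> borel_probs" "\<And>x. a \<le> \<psi> x"
  shows "a \<le> (\<integral>x. \<psi> x \<partial>M)"
proof -
  interpret prob_space M using assms(1) by (simp add: space_prob_algebra)
  have "(\<integral>x. a \<partial>M) \<le> (\<integral>x. \<psi> x \<partial>M)"
    by (intro integral_mono borel_prob_integrable[OF compact_UNIV assms(1) \<psi>_continuous] assms(2)) simp
  then show ?thesis by (simp add: prob_space)
qed

lemma integral_roof_pos: "M \<in> borel_probs \<Longrightarrow> 0 < (\<integral>x. \<psi> x \<partial>M)"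
proof -
  assume M: "M \<in> borel_probs"
  obtain a b where ab: "a > 0" "b > 0" "\<And>x. a \<le> \<psi> x" "\<And>x. \<psi> x \<le> b" by (rule roof_bounds) blast
  have "a \<le> (\<integral>x. \<psi> x \<partial>M)" by (rule integral_roof_bounds[OF M ab(3)])
  then show ?thesis using ab(1) by linarith
qed

lemma invariant_borel_prob: "M \<in> invariant_probs f \<Longrightarrow> M \<in> borel_probs"
  by (simp add: invariant_probs_def)

lemma measure_entropy_ge_0: "M \<in> invariant_probs f \<Longrightarrow> 0 \<le> measure_entropy f M"
  using compact_invariant_measureI compact_invariant_measure.axioms(1) invariant_measure.measure_entropy_nonneg by metis

lemma entropy_bound: obtains a where "\<And>M. M \<in> invariant_probs f \<Longrightarrow> measure_entropy f M \<le> ereal a"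
proof -
  obtain a where a: "top_entropy f < ereal a" using ereal_dense2[OF top_entropy_finite] by auto
  show ?thesis by (rule that[of a]) (rule measure_entropy_le_top_entropy[OF _ a])
qed

definition real_entropy :: "'a measure \<Rightarrow> real" where "real_entropy M = real_of_ereal (measure_entropy f M)"

definition real_pressure :: "('a \<Rightarrow> real) \<Rightarrow> real" where "real_pressure \<phi> = real_of_ereal (induced_pressure f \<psi> \<phi>)"

lemma real_entropy: "M \<in> invariant_probs f \<Longrightarrow> measure_entropy f M = ereal (real_entropy M)"
proof -
  assume M: "M \<in> invariant_probs f"
  obtain a where "measure_entropy f M \<le> ereal a" using entropy_bound M by metis
  then show ?thesis unfolding real_entropy_def using measure_entropy_ge_0[OF M] by (cases "measure_entropy f M") simp_all
qed

text \<open>Pressure \<open>\<infinity>\<close> would yield an invariant measure whose entropy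
  exceeds \<open>entropy_bound\<close>; pressure \<open>-\<infinity>\<close> would force a negative
  entropy on every invariant measure.\<close>

lemma real_pressure:
  assumes \<phi>: "continuous_on UNIV \<phi>"
  shows "induced_pressure f \<psi> \<phi> = ereal (real_pressure \<phi>)"
proof -
  obtain c d where cd: "c > 0" "d > 0" "\<And>x. c \<le> \<psi> x" "\<And>x. \<psi> x \<le> d" by (rule roof_bounds) blast
  obtain B where B: "B > 0" "\<And>x. \<bar>\<phi> x\<bar> \<le> B" by (rule continuous_UNIV_bounded[OF compact_UNIV \<phi>]) blast
  have I\<phi>: "\<bar>\<integral>x. \<phi> x \<partial>M\<bar> \<le> B" if M: "M \<in> invariant_probs f" for M
  proof -
    have "integral_functional M \<in> riesz_functionals"
      by (rule integral_functional_mem[OF compact_UNIV invariant_borel_prob[OF M]])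
    from riesz_functionals_bound[OF this \<phi> B(2)] show ?thesis using \<phi> by (simp add: integral_functional_def)
  qed
  have I\<psi>: "c \<le> (\<integral>x. \<psi> x \<partial>M)" if M: "M \<in> invariant_probs f" for M
    by (rule integral_roof_bounds[OF invariant_borel_prob[OF M] cd(3)])
  have "induced_pressure f \<psi> \<phi> \<noteq> \<infinity>"
  proof
    assume inf: "induced_pressure f \<psi> \<phi> = \<infinity>"
    obtain a where a: "\<And>M. M \<in> invariant_probs f \<Longrightarrow> measure_entropy f M \<le> ereal a" by (rule entropy_bound) blast
    \<comment> \<open>Large enough that \<open>\<beta> * c\<close> exceeds \<open>a + B\<close>,
      where \<open>c\<close> is a lower bound of the integral of \<psi>.\<close>
    define \<beta> where "\<beta> = (\<bar>a\<bar> + B + 1) / c"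
    have lt: "ereal \<beta> < induced_pressure f \<psi> \<phi>" using inf by simp
    obtain M where M: "M \<in> invariant_probs f" "ereal (\<beta> * (\<integral>x. \<psi> x \<partial>M) - (\<integral>x. \<phi> x \<partial>M)) \<le> measure_entropy f M"
      by (rule measure_entropy_ge_pressure[OF \<phi> lt])
    have "ereal (\<beta> * (\<integral>x. \<psi> x \<partial>M) - (\<integral>x. \<phi> x \<partial>M)) \<le> ereal a" using M(2) a[OF M(1)] by (rule order_trans)
    then have le: "\<beta> * (\<integral>x. \<psi> x \<partial>M) - (\<integral>x. \<phi> x \<partial>M) \<le> a" by simp
    have "\<beta> * c \<le> \<beta> * (\<integral>x. \<psi> x \<partial>M)" using I\<psi>[OF M(1)] B(1) cd(1) by (intro mult_left_mono) (simp_all add: \<beta>_def)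
    moreover have "\<beta> * c = \<bar>a\<bar> + B + 1" using cd(1) by (simp add: \<beta>_def)
    ultimately show False using le I\<phi>[OF M(1)] by linarith
  qed
  moreover have "induced_pressure f \<psi> \<phi> \<noteq> - \<infinity>"
  proof
    assume inf: "induced_pressure f \<psi> \<phi> = - \<infinity>"
    obtain M where M: "M \<in> invariant_probs f" using exists_invariant_prob by auto
    define \<beta> where "\<beta> = - ((B + 1) / c)"
    have lt: "induced_pressure f \<psi> \<phi> < ereal \<beta>" using inf by simp
    have "0 \<le> ereal (\<beta> * (\<integral>x. \<psi> x \<partial>M) - (\<integral>x. \<phi> x \<partial>M))"
      using measure_entropy_ge_0[OF M] measure_entropy_le_pressure[OF \<phi> M lt] by (rule order_trans)
    then have le: "0 \<le> \<beta> * (\<integral>x. \<psi> x \<partial>M) - (\<integral>x. \<phi> x \<partial>M)" by simp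
    have "\<beta> * (\<integral>x. \<psi> x \<partial>M) \<le> \<beta> * c" using I\<psi>[OF M] B(1) cd(1) by (intro mult_left_mono_neg) (simp_all add: \<beta>_def)
    moreover have "\<beta> * c = - (B + 1)" using cd(1) by (simp add: \<beta>_def)
    ultimately show False using le I\<phi>[OF M] by linarith
  qed
  ultimately show ?thesis unfolding real_pressure_def by (cases "induced_pressure f \<psi> \<phi>") simp_all
qed

lemma variational_le:
  assumes \<phi>: "continuous_on UNIV \<phi>" and M: "M \<in> invariant_probs f"
  shows "real_entropy M + (\<integral>x. \<phi> x \<partial>M) \<le> real_pressure \<phi> * (\<integral>x. \<psi> x \<partial>M)"
proof (rule field_le_epsilon)
  fix e :: real assume e: "e > 0"
  let ?I = "\<integral>x. \<psi> x \<partial>M"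
  have I: "?I > 0" by (rule integral_roof_pos[OF invariant_borel_prob[OF M]])
  \<comment> \<open>An excess of \<open>e / ?I\<close> in the pressure becomes exactly
    \<open>e\<close> after multiplication by \<open>?I\<close>.\<close>
  have "induced_pressure f \<psi> \<phi> < ereal (real_pressure \<phi> + e / ?I)" using real_pressure[OF \<phi>] e I by simp
  from measure_entropy_le_pressure[OF \<phi> M this]
  have "real_entropy M \<le> (real_pressure \<phi> + e / ?I) * ?I - (\<integral>x. \<phi> x \<partial>M)" using real_entropy[OF M] by simp
  then show "real_entropy M + (\<integral>x. \<phi> x \<partial>M) \<le> real_pressure \<phi> * ?I + e" using I by (simp add: distrib_right)
qed

lemma variational_ge:
  assumes \<phi>: "continuous_on UNIV \<phi>" and \<delta>: "\<delta> > 0"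
  obtains M where "M \<in> invariant_probs f" "(real_pressure \<phi> - \<delta>) * (\<integral>x. \<psi> x \<partial>M) \<le> real_entropy M + (\<integral>x. \<phi> x \<partial>M)"
proof -
  have lt: "ereal (real_pressure \<phi> - \<delta>) < induced_pressure f \<psi> \<phi>" using real_pressure[OF \<phi>] \<delta> by simp
  obtain M where M: "M \<in> invariant_probs f" "ereal ((real_pressure \<phi> - \<delta>) * (\<integral>x. \<psi> x \<partial>M) - (\<integral>x. \<phi> x \<partial>M)) \<le> measure_entropy f M"
    by (rule measure_entropy_ge_pressure[OF \<phi> lt])
  show ?thesis using M(2) real_entropy[OF M(1)] by (intro that[OF M(1)]) simp
qed

text \<open>Pressures are compared through almost optimal measures, since in general no measure
  attaining the supremum is at hand.\<close>

lemma real_pressure_leI: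
  assumes \<phi>: "continuous_on UNIV \<phi>"
    and le: "\<And>M. M \<in> invariant_probs f \<Longrightarrow> real_entropy M + (\<integral>x. \<phi> x \<partial>M) \<le> c * (\<integral>x. \<psi> x \<partial>M)"
  shows "real_pressure \<phi> \<le> c"
proof (rule field_le_epsilon)
  fix e :: real assume e: "e > 0"
  obtain M where M: "M \<in> invariant_probs f" "(real_pressure \<phi> - e) * (\<integral>x. \<psi> x \<partial>M) \<le> real_entropy M + (\<integral>x. \<phi> x \<partial>M)"
    by (rule variational_ge[OF \<phi> e])
  have "(real_pressure \<phi> - e) * (\<integral>x. \<psi> x \<partial>M) \<le> c * (\<integral>x. \<psi> x \<partial>M)" using M(2) le[OF M(1)] by (rule order_trans)
  then have "real_pressure \<phi> - e \<le> c" by (rule mult_right_le_imp_le[OF _ integral_roof_pos[OF invariant_borel_prob[OF M(1)]]])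
  then show "real_pressure \<phi> \<le> c + e" by simp
qed

text \<open>Cleared of the positive denominator, the condition is linear in the measure; compactness
  and convexity both rest on this form.\<close>

lemma tangent_functionals_iff:
  assumes \<phi>: "continuous_on UNIV \<phi>"
  shows "\<mu> \<in> tangent_functionals f \<psi> \<phi> \<longleftrightarrow> \<mu> \<in> borel_probs \<and>
    (\<forall>g. continuous_on UNIV g \<longrightarrow> (\<integral>x. g x \<partial>\<mu>) \<le> (real_pressure (\<lambda>x. \<phi> x + g x) - real_pressure \<phi>) * (\<integral>x. \<psi> x \<partial>\<mu>))"
proof -
  have "ereal ((\<integral>x. g x \<partial>\<mu>) / (\<integral>x. \<psi> x \<partial>\<mu>)) \<le> induced_pressure f \<psi> (\<lambda>x. \<phi> x + g x) - induced_pressure f \<psi> \<phi>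
      \<longleftrightarrow> (\<integral>x. g x \<partial>\<mu>) \<le> (real_pressure (\<lambda>x. \<phi> x + g x) - real_pressure \<phi>) * (\<integral>x. \<psi> x \<partial>\<mu>)"
    if "\<mu> \<in> borel_probs" and g: "continuous_on UNIV g" for g :: "'a \<Rightarrow> real"
    using integral_roof_pos[OF that(1)] real_pressure[OF \<phi>] real_pressure[OF continuous_on_add[OF \<phi> g]]
    by (simp add: pos_divide_le_eq)
  then show ?thesis unfolding tangent_functionals_def by auto
qed

lemma equilibrium_states_iff:
  assumes \<phi>: "continuous_on UNIV \<phi>"
  shows "M \<in> equilibrium_states f \<psi> \<phi> \<longleftrightarrow> M \<in> invariant_probs f \<and> real_pressure \<phi> * (\<integral>x. \<psi> x \<partial>M) = real_entropy M + (\<integral>x. \<phi> x \<partial>M)"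
proof -
  have "induced_pressure f \<psi> \<phi> = (measure_entropy f M + ereal (\<integral>x. \<phi> x \<partial>M)) / ereal (\<integral>x. \<psi> x \<partial>M)
    \<longleftrightarrow> real_pressure \<phi> * (\<integral>x. \<psi> x \<partial>M) = real_entropy M + (\<integral>x. \<phi> x \<partial>M)" if M: "M \<in> invariant_probs f"
    using integral_roof_pos[OF invariant_borel_prob[OF M]] real_pressure[OF \<phi>] real_entropy[OF M]
    by (simp add: nonzero_eq_divide_eq)
  then show ?thesis unfolding equilibrium_states_def by auto
qed

text \<open>Subtract the equality at \<phi> from the variational inequality at
  \<open>\<phi> + g\<close> for the same measure.\<close>

lemma equilibrium_states_subset:
  assumes \<phi>: "continuous_on UNIV \<phi>"
  shows "equilibrium_states f \<psi> \<phi> \<subseteq> tangent_functionals f \<psi> \<phi>"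
proof
  fix M assume "M \<in> equilibrium_states f \<psi> \<phi>"
  then have M: "M \<in> invariant_probs f" and eq: "real_pressure \<phi> * (\<integral>x. \<psi> x \<partial>M) = real_entropy M + (\<integral>x. \<phi> x \<partial>M)"
    by (simp_all add: equilibrium_states_iff[OF \<phi>])
  have "(\<integral>x. g x \<partial>M) \<le> (real_pressure (\<lambda>x. \<phi> x + g x) - real_pressure \<phi>) * (\<integral>x. \<psi> x \<partial>M)" if g: "continuous_on UNIV g" for g
  proof -
    have "(\<integral>x. \<phi> x + g x \<partial>M) = (\<integral>x. \<phi> x \<partial>M) + (\<integral>x. g x \<partial>M)"
      by (intro Bochner_Integration.integral_add integrable_continuous[OF M] \<phi> g)
    then show ?thesis
      using variational_le[OF continuous_on_add[OF \<phi> g] M] eq unfolding left_diff_distrib by linarith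
  qed
  then show "M \<in> tangent_functionals f \<psi> \<phi>"
    by (simp add: tangent_functionals_iff[OF \<phi>] invariant_borel_prob[OF M])
qed

text \<open>Adding a coboundary does not change the pressure, so tangent functionals annihilate coboundaries.\<close>

lemma tangent_functionals_invariant:
  assumes \<phi>: "continuous_on UNIV \<phi>"
  shows "tangent_functionals f \<psi> \<phi> \<subseteq> invariant_probs f"
proof
  fix \<mu> assume \<mu>: "\<mu> \<in> tangent_functionals f \<psi> \<phi>"
  have \<mu>b: "\<mu> \<in> borel_probs"
    and \<mu>t: "\<And>g. continuous_on UNIV g \<Longrightarrow> (\<integral>x. g x \<partial>\<mu>) \<le> (real_pressure (\<lambda>x. \<phi> x + g x) - real_pressure \<phi>) * (\<integral>x. \<psi> x \<partial>\<mu>)"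
    using \<mu> unfolding tangent_functionals_iff[OF \<phi>] by simp_all
  have le0: "(\<integral>x. h (f x) - h x \<partial>\<mu>) \<le> 0" if h: "continuous_on UNIV h" for h :: "'a \<Rightarrow> real"
  proof -
    have hf: "continuous_on UNIV (\<lambda>x. h (f x))" using continuous_comp_funpow[OF f_continuous h, of 1] by simp
    have cg: "continuous_on UNIV (\<lambda>x. h (f x) - h x)" by (rule continuous_on_diff[OF hf h])
    have "real_pressure (\<lambda>x. \<phi> x + (h (f x) - h x)) \<le> real_pressure \<phi>"
    proof (rule real_pressure_leI[OF continuous_on_add[OF \<phi> cg]])
      fix M assume M: "M \<in> invariant_probs f"
      interpret compact_invariant_measure f M by (rule compact_invariant_measureI[OF M])
      have "(\<integral>x. \<phi> x + (h (f x) - h x) \<partial>M) = (\<integral>x. \<phi> x \<partial>M) + ((\<integral>x. h (f x) \<partial>M) - (\<integral>x. h x \<partial>M))"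
        using integrable_continuous[OF M \<phi>] integrable_continuous[OF M hf] integrable_continuous[OF M h] by simp
      moreover have "(\<integral>x. h (f x) \<partial>M) = (\<integral>x. h x \<partial>M)"
        using integral_funpow[of h 1] borel_measurable_continuous_onI[OF h] by simp
      ultimately show "real_entropy M + (\<integral>x. \<phi> x + (h (f x) - h x) \<partial>M) \<le> real_pressure \<phi> * (\<integral>x. \<psi> x \<partial>M)"
        using variational_le[OF \<phi> M] by simp
    qed
    then have "(real_pressure (\<lambda>x. \<phi> x + (h (f x) - h x)) - real_pressure \<phi>) * (\<integral>x. \<psi> x \<partial>\<mu>) \<le> 0"
      using integral_roof_pos[OF \<mu>b] by (intro mult_nonpos_nonneg) simp_all
    with \<mu>t[OF cg] show ?thesis by linarith
  qed
  show "\<mu> \<in> invariant_probs f"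
  proof (rule invariant_probsI[OF compact_UNIV f_continuous \<mu>b])
    fix g :: "'a \<Rightarrow> real" assume g: "continuous_on UNIV g"
    have gf: "continuous_on UNIV (\<lambda>x. g (f x))" using continuous_comp_funpow[OF f_continuous g, of 1] by simp
    have "(\<integral>x. g (f x) - g x \<partial>\<mu>) = (\<integral>x. g (f x) \<partial>\<mu>) - (\<integral>x. g x \<partial>\<mu>)"
      by (intro Bochner_Integration.integral_diff borel_prob_integrable[OF compact_UNIV \<mu>b] gf g)
    moreover have "(\<integral>x. - g (f x) - - g x \<partial>\<mu>) = - (\<integral>x. g (f x) \<partial>\<mu>) + (\<integral>x. g x \<partial>\<mu>)"
      using borel_prob_integrable[OF compact_UNIV \<mu>b gf] borel_prob_integrable[OF compact_UNIV \<mu>b g] by simp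
    ultimately show "(\<integral>x. g (f x) \<partial>\<mu>) = (\<integral>x. g x \<partial>\<mu>)"
      using le0[OF g] le0[OF continuous_on_minus[OF g]] by linarith
  qed
qed

text \<open>In terms of functionals, tangency is an intersection of closed conditions, each
  involving only the coordinates \<open>g\<close> and \<open>\<psi>\<close>.\<close>

lemma compactin_tangent_functionals:
  assumes \<phi>: "continuous_on UNIV \<phi>"
  shows "compactin weak_star_topology (tangent_functionals f \<psi> \<phi>)"
proof -
  let ?C = "{L :: ('a \<Rightarrow> real) \<Rightarrow> real. \<forall>g. continuous_on UNIV g \<longrightarrow> L g \<le> (real_pressure (\<lambda>x. \<phi> x + g x) - real_pressure \<phi>) * L \<psi>}"
  have cont: "continuous_on UNIV (\<lambda>L :: ('a \<Rightarrow> real) \<Rightarrow> real. L g)" for g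
    by (rule continuous_on_product_coordinates)
  have "closed ?C"
    by (intro closed_Collect_all closed_Collect_imp open_Collect_const closed_Collect_le
        continuous_on_mult continuous_on_const cont)
  from compactin_weak_star[OF compact_UNIV this]
  have "compactin weak_star_topology {M :: 'a measure. M \<in> borel_probs \<and> integral_functional M \<in> ?C}" .
  moreover have "{M :: 'a measure. M \<in> borel_probs \<and> integral_functional M \<in> ?C} = tangent_functionals f \<psi> \<phi>"
    by (intro set_eqI) (simp add: tangent_functionals_iff[OF \<phi>] integral_functional_def \<psi>_continuous)
  ultimately show ?thesis by simp
qed

lemma convex_tangent_functionals:
  assumes \<phi>: "continuous_on UNIV \<phi>"
  shows "convex_measures (tangent_functionals f \<psi> \<phi>)"
  unfolding convex_measures_def
proof (intro ballI)
  fix \<mu> \<nu> :: "'a measure" and p :: real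
  assume \<mu>: "\<mu> \<in> tangent_functionals f \<psi> \<phi>" and \<nu>: "\<nu> \<in> tangent_functionals f \<psi> \<phi>" and p: "p \<in> {0..1}"
  have \<mu>b: "\<mu> \<in> borel_probs" and \<nu>b: "\<nu> \<in> borel_probs"
    using \<mu> \<nu> by (simp_all add: tangent_functionals_iff[OF \<phi>])
  note int = integral_mix_measure[OF \<mu>b \<nu>b p compact_UNIV]
  have "(\<integral>x. g x \<partial>mix_measure p \<mu> \<nu>) \<le> (real_pressure (\<lambda>x. \<phi> x + g x) - real_pressure \<phi>) * (\<integral>x. \<psi> x \<partial>mix_measure p \<mu> \<nu>)"
    if g: "continuous_on UNIV g" for g
  proof -
    let ?c = "real_pressure (\<lambda>x. \<phi> x + g x) - real_pressure \<phi>"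
    have "(\<integral>x. g x \<partial>\<mu>) \<le> ?c * (\<integral>x. \<psi> x \<partial>\<mu>)" "(\<integral>x. g x \<partial>\<nu>) \<le> ?c * (\<integral>x. \<psi> x \<partial>\<nu>)"
      using \<mu> \<nu> g by (simp_all add: tangent_functionals_iff[OF \<phi>])
    then have "p * (\<integral>x. g x \<partial>\<mu>) \<le> p * (?c * (\<integral>x. \<psi> x \<partial>\<mu>))"
      "(1 - p) * (\<integral>x. g x \<partial>\<nu>) \<le> (1 - p) * (?c * (\<integral>x. \<psi> x \<partial>\<nu>))"
      using p by (auto intro!: mult_left_mono)
    then have "p * (\<integral>x. g x \<partial>\<mu>) + (1 - p) * (\<integral>x. g x \<partial>\<nu>)
       \<le> p * (?c * (\<integral>x. \<psi> x \<partial>\<mu>)) + (1 - p) * (?c * (\<integral>x. \<psi> x \<partial>\<nu>))" by (rule add_mono)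
    also have "\<dots> = ?c * (p * (\<integral>x. \<psi> x \<partial>\<mu>) + (1 - p) * (\<integral>x. \<psi> x \<partial>\<nu>))" by (simp add: algebra_simps)
    finally show ?thesis unfolding int[OF g] int[OF \<psi>_continuous] .
  qed
  then show "mix_measure p \<mu> \<nu> \<in> tangent_functionals f \<psi> \<phi>"
    using mix_measure_borel_prob[OF \<mu>b \<nu>b p] by (simp add: tangent_functionals_iff[OF \<phi>])
qed

text \<open>A cluster point of almost optimal measures is optimal: the integrals converge, and upper
  semicontinuity prevents the limit from having less entropy than the approximants retain.\<close>

lemma equilibrium_state_exists:
  assumes \<phi>: "continuous_on UNIV \<phi>"
    and usc: "upper_semicontinuous_map (subtopology weak_star_topology (invariant_probs f)) (measure_entropy f)"
  shows "equilibrium_states f \<psi> \<phi> \<noteq> {}"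
proof -
  have "\<forall>k. \<exists>M. M \<in> invariant_probs f \<and> (real_pressure \<phi> - 1 / real (Suc k)) * (\<integral>x. \<psi> x \<partial>M) \<le> real_entropy M + (\<integral>x. \<phi> x \<partial>M)"
  proof
    fix k
    have k: "1 / real (Suc k) > 0" by simp
    obtain M where "M \<in> invariant_probs f" "(real_pressure \<phi> - 1 / real (Suc k)) * (\<integral>x. \<psi> x \<partial>M) \<le> real_entropy M + (\<integral>x. \<phi> x \<partial>M)"
      by (rule variational_ge[OF \<phi> k])
    then show "\<exists>M. M \<in> invariant_probs f \<and> (real_pressure \<phi> - 1 / real (Suc k)) * (\<integral>x. \<psi> x \<partial>M) \<le> real_entropy M + (\<integral>x. \<phi> x \<partial>M)"
      by (intro exI[of _ M] conjI)
  qed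
  from choice[OF this] obtain Ms where Ms: "\<And>k. Ms k \<in> invariant_probs f"
    "\<And>k. (real_pressure \<phi> - 1 / real (Suc k)) * (\<integral>x. \<psi> x \<partial>Ms k) \<le> real_entropy (Ms k) + (\<integral>x. \<phi> x \<partial>Ms k)" by auto
  have pf: "positive_functional (integral_functional (Ms k))" for k
    using integral_functional_mem[OF compact_UNIV invariant_borel_prob[OF Ms(1)[of k]]]
    by (simp add: riesz_functionals_def)
  obtain F M where F: "F \<noteq> bot" "F \<le> sequentially" and Mb: "M \<in> borel_probs"
    and limf: "\<And>g. continuous_on UNIV g \<Longrightarrow> ((\<lambda>k. integral_functional (Ms k) g) \<longlongrightarrow> (\<integral>x. g x \<partial>M)) F"
    by (rule weak_star_cluster_point[OF compact_UNIV, where Ls = "\<lambda>k. integral_functional (Ms k)", OF pf]) blast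
  have lim: "((\<lambda>k. \<integral>x. g x \<partial>Ms k) \<longlongrightarrow> (\<integral>x. g x \<partial>M)) F" if g: "continuous_on UNIV g" for g :: "'a \<Rightarrow> real"
    using limf[OF g] g by (simp add: integral_functional_def)
  have Minv: "M \<in> invariant_probs f"
  proof (rule invariant_probsI[OF compact_UNIV f_continuous Mb])
    fix g :: "'a \<Rightarrow> real" assume g: "continuous_on UNIV g"
    have gf: "continuous_on UNIV (\<lambda>x. g (f x))" using continuous_comp_funpow[OF f_continuous g, of 1] by simp
    have "(\<integral>x. g (f x) \<partial>Ms k) = (\<integral>x. g x \<partial>Ms k)" for k
    proof -
      interpret compact_invariant_measure f "Ms k" by (rule compact_invariant_measureI[OF Ms(1)])
      show ?thesis using integral_funpow[of g 1] borel_measurable_continuous_onI[OF g] by simp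
    qed
    then have "((\<lambda>k. \<integral>x. g x \<partial>Ms k) \<longlongrightarrow> (\<integral>x. g (f x) \<partial>M)) F" using lim[OF gf] by simp
    from tendsto_unique[OF F(1) this lim[OF g]] show "(\<integral>x. g (f x) \<partial>M) = (\<integral>x. g x \<partial>M)" .
  qed
  have lin: "limitin weak_star_topology Ms M F"
    by (rule limitin_weak_star[OF Mb invariant_borel_prob[OF Ms(1)] lim])
  have "real_pressure \<phi> * (\<integral>x. \<psi> x \<partial>M) \<le> real_entropy M + (\<integral>x. \<phi> x \<partial>M)"
  proof (rule ccontr)
    assume "\<not> real_pressure \<phi> * (\<integral>x. \<psi> x \<partial>M) \<le> real_entropy M + (\<integral>x. \<phi> x \<partial>M)"
    then have "real_entropy M < real_pressure \<phi> * (\<integral>x. \<psi> x \<partial>M) - (\<integral>x. \<phi> x \<partial>M)" by simp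
    \<comment> \<open>An intermediate value turns semicontinuity into an open set, the measures of
      entropy below \<open>c\<close>; it contains the limit, hence eventually the approximants,
      which contradicts their near optimality.\<close>
    then obtain c where c: "real_entropy M < c" "c < real_pressure \<phi> * (\<integral>x. \<psi> x \<partial>M) - (\<integral>x. \<phi> x \<partial>M)" using dense by blast
    let ?S = "{x \<in> topspace (subtopology weak_star_topology (invariant_probs f)). measure_entropy f x < ereal c}"
    have "openin (subtopology weak_star_topology (invariant_probs f)) ?S"
      using usc by (simp only: upper_semicontinuous_map_def)
    then obtain W where W: "openin weak_star_topology W" "?S = W \<inter> invariant_probs f"
      unfolding openin_subtopology by auto
    have "M \<in> ?S" using Minv Mb c(1) real_entropy[OF Minv] by (simp add: topspace_weak_star)
    then have "M \<in> W" using W(2) by (metis IntD1)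
    with lin W(1) have ev: "\<forall>\<^sub>F k in F. Ms k \<in> W" by (simp add: limitin_def)
    have ev2: "\<forall>\<^sub>F k in F. (real_pressure \<phi> - 1 / real (Suc k)) * (\<integral>x. \<psi> x \<partial>Ms k) - (\<integral>x. \<phi> x \<partial>Ms k) \<le> c"
      using ev
    proof eventually_elim
      case (elim k)
      then have "Ms k \<in> ?S" using W(2) Ms(1)[of k] by (metis IntI)
      then have "real_entropy (Ms k) < c" using real_entropy[OF Ms(1)[of k]] by simp
      then show ?case using Ms(2)[of k] by linarith
    qed
    have inv0: "((\<lambda>k. 1 / real (Suc k)) \<longlongrightarrow> 0) F"
      by (rule tendsto_mono[OF F(2)]) (rule LIMSEQ_Suc[OF lim_1_over_n])
    have "((\<lambda>k. (real_pressure \<phi> - 1 / real (Suc k)) * (\<integral>x. \<psi> x \<partial>Ms k) - (\<integral>x. \<phi> x \<partial>Ms k))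
       \<longlongrightarrow> (real_pressure \<phi> - 0) * (\<integral>x. \<psi> x \<partial>M) - (\<integral>x. \<phi> x \<partial>M)) F"
      by (rule tendsto_diff[OF tendsto_mult[OF tendsto_diff[OF tendsto_const inv0] lim[OF \<psi>_continuous]] lim[OF \<phi>]])
    from tendsto_upperbound[OF this ev2 F(1)] c(2) show False by simp
  qed
  then have "M \<in> equilibrium_states f \<psi> \<phi>"
    using variational_le[OF \<phi> Minv] Minv by (simp add: equilibrium_states_iff[OF \<phi>])
  then show ?thesis by auto
qed

text \<open>The substitution \<open>h = \<phi> + g\<close> turns tangency into minimality of
  \<open>?G\<close> at \<phi>, and a value of \<open>?G\<close> equals the infimum exactly when it
  is a lower bound.\<close>

lemma tangent_iff_INF:
  assumes \<phi>: "continuous_on UNIV \<phi>" and \<mu>: "\<mu> \<in> borel_probs"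
  shows "\<mu> \<in> tangent_functionals f \<psi> \<phi> \<longleftrightarrow>
    induced_pressure f \<psi> \<phi> - ereal ((\<integral>x. \<phi> x \<partial>\<mu>) / (\<integral>x. \<psi> x \<partial>\<mu>)) =
    (INF h\<in>{h. continuous_on UNIV h}. induced_pressure f \<psi> h - ereal ((\<integral>x. h x \<partial>\<mu>) / (\<integral>x. \<psi> x \<partial>\<mu>)))"
proof -
  let ?I = "\<integral>x. \<psi> x \<partial>\<mu>"
  let ?G = "\<lambda>h. induced_pressure f \<psi> h - ereal ((\<integral>x. h x \<partial>\<mu>) / ?I)"
  have I: "?I > 0" by (rule integral_roof_pos[OF \<mu>])
  have G: "?G h = ereal (real_pressure h - (\<integral>x. h x \<partial>\<mu>) / ?I)" if "continuous_on UNIV h" for h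
    using real_pressure[OF that] by simp
  have shift: "(\<integral>x. g x \<partial>\<mu>) \<le> (real_pressure (\<lambda>x. \<phi> x + g x) - real_pressure \<phi>) * ?I \<longleftrightarrow> ?G \<phi> \<le> ?G (\<lambda>x. \<phi> x + g x)"
    if g: "continuous_on UNIV g" for g
  proof -
    have "(\<integral>x. \<phi> x + g x \<partial>\<mu>) = (\<integral>x. \<phi> x \<partial>\<mu>) + (\<integral>x. g x \<partial>\<mu>)"
      by (intro Bochner_Integration.integral_add borel_prob_integrable[OF compact_UNIV \<mu>] \<phi> g)
    then have "?G \<phi> \<le> ?G (\<lambda>x. \<phi> x + g x) \<longleftrightarrow> (\<integral>x. g x \<partial>\<mu>) / ?I \<le> real_pressure (\<lambda>x. \<phi> x + g x) - real_pressure \<phi>"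
      unfolding G[OF \<phi>] G[OF continuous_on_add[OF \<phi> g]] by (auto simp: add_divide_distrib)
    then show ?thesis using I by (simp add: pos_divide_le_eq)
  qed
  have all: "(\<forall>g. continuous_on UNIV g \<longrightarrow> ?G \<phi> \<le> ?G (\<lambda>x. \<phi> x + g x)) \<longleftrightarrow> (\<forall>h. continuous_on UNIV h \<longrightarrow> ?G \<phi> \<le> ?G h)"
  proof
    assume L: "\<forall>g. continuous_on UNIV g \<longrightarrow> ?G \<phi> \<le> ?G (\<lambda>x. \<phi> x + g x)"
    show "\<forall>h. continuous_on UNIV h \<longrightarrow> ?G \<phi> \<le> ?G h"
    proof (intro allI impI)
      fix h :: "'a \<Rightarrow> real" assume h: "continuous_on UNIV h"
      from L[rule_format, OF continuous_on_diff[OF h \<phi>]] show "?G \<phi> \<le> ?G h" by simp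
    qed
  next
    assume R: "\<forall>h. continuous_on UNIV h \<longrightarrow> ?G \<phi> \<le> ?G h"
    show "\<forall>g. continuous_on UNIV g \<longrightarrow> ?G \<phi> \<le> ?G (\<lambda>x. \<phi> x + g x)"
    proof (intro allI impI)
      fix g :: "'a \<Rightarrow> real" assume g: "continuous_on UNIV g"
      show "?G \<phi> \<le> ?G (\<lambda>x. \<phi> x + g x)" by (rule R[rule_format, OF continuous_on_add[OF \<phi> g]])
    qed
  qed
  have inf: "(\<forall>h. continuous_on UNIV h \<longrightarrow> ?G \<phi> \<le> ?G h) \<longleftrightarrow> ?G \<phi> = (INF h\<in>{h. continuous_on UNIV h}. ?G h)"
  proof
    assume "\<forall>h. continuous_on UNIV h \<longrightarrow> ?G \<phi> \<le> ?G h"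
    then show "?G \<phi> = (INF h\<in>{h. continuous_on UNIV h}. ?G h)"
      using \<phi> by (intro antisym INF_greatest INF_lower) simp_all
  next
    assume e: "?G \<phi> = (INF h\<in>{h. continuous_on UNIV h}. ?G h)"
    show "\<forall>h. continuous_on UNIV h \<longrightarrow> ?G \<phi> \<le> ?G h"
      unfolding e by (intro allI impI INF_lower) simp
  qed
  have "\<mu> \<in> tangent_functionals f \<psi> \<phi> \<longleftrightarrow> (\<forall>g. continuous_on UNIV g \<longrightarrow> ?G \<phi> \<le> ?G (\<lambda>x. \<phi> x + g x))"
    unfolding tangent_functionals_iff[OF \<phi>] using \<mu> shift by simp
  then show ?thesis using all inf by simp
qed

text \<open>Convexity makes the difference quotients monotone, so the limit exists and is their
  infimum; tangency tested against \<open>t g\<close> bounds every quotient from below.\<close>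

lemma right_deriv_ge:
  assumes \<phi>: "continuous_on UNIV \<phi>" and g: "continuous_on UNIV g"
  shows "(SUP \<mu>\<in>tangent_functionals f \<psi> \<phi>. ereal ((\<integral>x. g x \<partial>\<mu>) / (\<integral>x. \<psi> x \<partial>\<mu>)))
    \<le> induced_pressure_right_deriv f \<psi> \<phi> g"
proof -
  let ?\<phi> = "\<lambda>t x. \<phi> x + t * g x"
  let ?q = "\<lambda>t. (induced_pressure f \<psi> (?\<phi> t) - induced_pressure f \<psi> \<phi>) / ereal t"
  have ctg: "continuous_on UNIV (\<lambda>x. t * g x)" for t by (intro continuous_on_mult continuous_on_const g)
  have ct: "continuous_on UNIV (?\<phi> t)" for t by (rule continuous_on_add[OF \<phi> ctg])
  have q: "?q t = ereal ((real_pressure (?\<phi> t) - real_pressure \<phi>) / t)" if "t > 0" for t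
    using that real_pressure[OF \<phi>] real_pressure[OF ct[of t]] by simp
  have mono: "?q s \<le> ?q t" if st: "0 < s" "s \<le> t" for s t
  proof -
    have t: "t > 0" using st by linarith
    define l where "l = s / t"
    have l: "0 \<le> l" "0 \<le> 1 - l" "l * t = s" using st t by (simp_all add: l_def)
    \<comment> \<open>Convexity comes from the variational principle: for each invariant measure the
      quantity to be bounded is affine in \<open>s\<close>.\<close>
    have "real_pressure (?\<phi> s) \<le> (1 - l) * real_pressure \<phi> + l * real_pressure (?\<phi> t)"
    proof (rule real_pressure_leI[OF ct])
      fix M assume M: "M \<in> invariant_probs f"
      let ?a = "\<integral>x. \<phi> x \<partial>M" and ?b = "\<integral>x. g x \<partial>M" and ?I = "\<integral>x. \<psi> x \<partial>M"
      have i: "(\<integral>x. ?\<phi> u x \<partial>M) = ?a + u * ?b" for u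
        using integrable_continuous[OF M \<phi>] integrable_continuous[OF M g] by simp
      have "(1 - l) * (real_entropy M + ?a) \<le> (1 - l) * (real_pressure \<phi> * ?I)" by (rule mult_left_mono[OF variational_le[OF \<phi> M] l(2)])
      moreover have "l * (real_entropy M + (\<integral>x. ?\<phi> t x \<partial>M)) \<le> l * (real_pressure (?\<phi> t) * ?I)"
        by (rule mult_left_mono[OF variational_le[OF ct M] l(1)])
      moreover have "real_entropy M + (\<integral>x. ?\<phi> s x \<partial>M) = (1 - l) * (real_entropy M + ?a) + l * (real_entropy M + (\<integral>x. ?\<phi> t x \<partial>M))"
        unfolding i l(3)[symmetric] by (simp add: algebra_simps)
      ultimately have "real_entropy M + (\<integral>x. ?\<phi> s x \<partial>M) \<le> (1 - l) * (real_pressure \<phi> * ?I) + l * (real_pressure (?\<phi> t) * ?I)" by linarith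
      also have "\<dots> = ((1 - l) * real_pressure \<phi> + l * real_pressure (?\<phi> t)) * ?I" by (simp add: algebra_simps)
      finally show "real_entropy M + (\<integral>x. ?\<phi> s x \<partial>M) \<le> ((1 - l) * real_pressure \<phi> + l * real_pressure (?\<phi> t)) * ?I" .
    qed
    then have "real_pressure (?\<phi> s) - real_pressure \<phi> \<le> l * (real_pressure (?\<phi> t) - real_pressure \<phi>)" by (simp add: algebra_simps)
    then have "(real_pressure (?\<phi> s) - real_pressure \<phi>) / s \<le> l * (real_pressure (?\<phi> t) - real_pressure \<phi>) / s" using st(1) by (intro divide_right_mono) simp_all
    also have "\<dots> = (real_pressure (?\<phi> t) - real_pressure \<phi>) / t" using st(1) t by (simp add: l_def)
    finally show ?thesis unfolding q[OF st(1)] q[OF t] by simp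
  qed
  have "(?q \<longlongrightarrow> (INF t\<in>{0<..}. ?q t)) (at_right 0)" by (rule monotone_tendsto_at_right_0) (rule mono)
  then have d: "induced_pressure_right_deriv f \<psi> \<phi> g = (INF t\<in>{0<..}. ?q t)"
    unfolding induced_pressure_right_deriv_def by (intro tendsto_Lim) simp_all
  show ?thesis
    unfolding d
  proof (rule SUP_least, rule INF_greatest)
    fix \<mu> and t :: real assume \<mu>: "\<mu> \<in> tangent_functionals f \<psi> \<phi>" and "t \<in> {0<..}"
    then have t: "t > 0" by simp
    have \<mu>b: "\<mu> \<in> borel_probs" using \<mu> by (simp add: tangent_functionals_iff[OF \<phi>])
    have I: "0 < (\<integral>x. \<psi> x \<partial>\<mu>)" by (rule integral_roof_pos[OF \<mu>b])
    have "(\<integral>x. t * g x \<partial>\<mu>) \<le> (real_pressure (?\<phi> t) - real_pressure \<phi>) * (\<integral>x. \<psi> x \<partial>\<mu>)"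
      using \<mu> ctg[of t] unfolding tangent_functionals_iff[OF \<phi>] by blast
    then have "t * (\<integral>x. g x \<partial>\<mu>) \<le> (real_pressure (?\<phi> t) - real_pressure \<phi>) * (\<integral>x. \<psi> x \<partial>\<mu>)" by simp
    then have "(\<integral>x. g x \<partial>\<mu>) / (\<integral>x. \<psi> x \<partial>\<mu>) \<le> (real_pressure (?\<phi> t) - real_pressure \<phi>) / t"
      using I t by (simp add: field_simps)
    then show "ereal ((\<integral>x. g x \<partial>\<mu>) / (\<integral>x. \<psi> x \<partial>\<mu>)) \<le> ?q t" unfolding q[OF t] by simp
  qed
qed

end

theorem proposition3p1:
  fixes f :: "'a::metric_space \<Rightarrow> 'a" and \<phi> \<psi> :: "'a \<Rightarrow> real"
  assumes "compact (UNIV :: 'a set)"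
    and "continuous_on UNIV f"
    and "top_entropy f < \<infinity>"
    and "continuous_on UNIV \<phi>"
    and "continuous_on UNIV \<psi>"
    and "\<forall>x. \<psi> x > 0"
  shows
    "(compactin weak_star_topology (tangent_functionals f \<psi> \<phi>) \<and>
      convex_measures (tangent_functionals f \<psi> \<phi>)) \<and>
     (equilibrium_states f \<psi> \<phi> \<subseteq> tangent_functionals f \<psi> \<phi> \<and>
      tangent_functionals f \<psi> \<phi> \<subseteq> invariant_probs f) \<and>
     (upper_semicontinuous_map (subtopology weak_star_topology (invariant_probs f))
        (measure_entropy f) \<longrightarrow>
      equilibrium_states f \<psi> \<phi> \<noteq> {} \<and> tangent_functionals f \<psi> \<phi> \<noteq> {}) \<and>
     (\<forall>\<mu>\<in>borel_probs. \<mu> \<in> tangent_functionals f \<psi> \<phi> \<longleftrightarrow>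
        induced_pressure f \<psi> \<phi> - ereal ((\<integral>x. \<phi> x \<partial>\<mu>) / (\<integral>x. \<psi> x \<partial>\<mu>)) =
        (INF h\<in>{h. continuous_on UNIV h}.
           induced_pressure f \<psi> h - ereal ((\<integral>x. h x \<partial>\<mu>) / (\<integral>x. \<psi> x \<partial>\<mu>)))) \<and>
     (\<forall>g. continuous_on UNIV g \<longrightarrow>
        induced_pressure_right_deriv f \<psi> \<phi> g \<ge>
        (SUP \<mu>\<in>tangent_functionals f \<psi> \<phi>. ereal ((\<integral>x. g x \<partial>\<mu>) / (\<integral>x. \<psi> x \<partial>\<mu>))))"
proof -
  interpret finite_entropy_system f \<psi>
    by unfold_locales (use assms in simp_all)
  note \<phi> = assms(4)
  have eq: "tangent_functionals f \<psi> \<phi> \<noteq> {}" if "equilibrium_states f \<psi> \<phi> \<noteq> {}"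
    using equilibrium_states_subset[OF \<phi>] that by (metis subset_empty)
  show ?thesis
    by (intro conjI impI ballI allI compactin_tangent_functionals[OF \<phi>] convex_tangent_functionals[OF \<phi>]
        equilibrium_states_subset[OF \<phi>] tangent_functionals_invariant[OF \<phi>] equilibrium_state_exists[OF \<phi>]
        eq tangent_iff_INF[OF \<phi>] right_deriv_ge[OF \<phi>])
qed

end
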